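(* Let $d>0$ be a square-free integer with $d\equiv 7\pmod{24}$, and let $S=\mathbb{Q}(\sqrt{-2d})$. Let $H_4$ be a cyclic extension of $S$ with $[H_4:S]=4$, $H_4\subset H(S)$ and $\sqrt{2}\in H_4$. Suppose $G_p$ is a Gaussian Mersenne prime which splits completely in $H_4$. If $G_p=x^2+dy^2$ with $x,y\in\mathbb{Z}$, then $8\mid y$.
   Context: For a rational prime $p$, the Gaussian Mersenne number is $\mu_p=(1\pm i)^p-1\in\mathbb{Z}[i]$, and $G_p=N(\mu_p)$ is its norm; for odd $p$ one has $G_p=2^{p}-\left(\frac{2}{p}\right)2^{\frac{p+1}{2}}+1$, where $\left(\frac{2}{p}\right)$ is the Legendre symbol. If $G_p$ is a rational prime it is called a Gaussian Mersenne prime. $H(S)$ denotes the Hilbert class field of the number field $S$. "Splits completely in $H_4$" refers to the rational prime $G_p$ in the extension $H_4/\mathbb{Q}$. *)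

theory Defs
  imports
    Complex_Main
    "HOL-Computational_Algebra.Computational_Algebra"
    "HOL-Number_Theory.Cong"
    "HOL-Algebra.Algebra"
    "HOL-Algebra.Algebraic_Closure_Type"
begin

text \<open>Number fields are taken to be subfields of the complex numbers, so that statements such as
  \<open>sqrt 2 \<in> L\<close> and \<open>L \<subseteq> H\<close> are literal.\<close>

abbreviation complex_field :: "complex ring" where
  "complex_field \<equiv> ring_of_type_algebra"

definition number_field :: "complex set \<Rightarrow> bool" where
  "number_field K \<longleftrightarrow>
     subfield K complex_field \<and> ring.finite_dimension complex_field \<rat> K"

definition ext_degree :: "complex set \<Rightarrow> complex set \<Rightarrow> nat" where
  "ext_degree K L = ring.dim complex_field K L"

definition ring_of_integers :: "complex set \<Rightarrow> complex ring" where
  "ring_of_integers K = complex_field\<lparr>carrier := {x \<in> K. algebraic_int x}\<rparr>"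

definition finite_extension :: "complex set \<Rightarrow> complex set \<Rightarrow> bool" where
  "finite_extension K L \<longleftrightarrow>
     subfield K complex_field \<and> subfield L complex_field \<and> K \<subseteq> L \<and>
     ring.finite_dimension complex_field K L"

text \<open>The elements of \<open>BijGroup L\<close> are extensional on \<open>L\<close>, so each automorphism of
  \<open>L\<close> is counted once.\<close>

definition galois_group :: "complex set \<Rightarrow> complex set \<Rightarrow> (complex \<Rightarrow> complex) monoid" where
  "galois_group K L = (BijGroup L)\<lparr>carrier :=
     {\<sigma> \<in> Bij L. \<sigma> \<in> ring_hom (complex_field\<lparr>carrier := L\<rparr>) (complex_field\<lparr>carrier := L\<rparr>) \<and>
                  (\<forall>x\<in>K. \<sigma> x = x)}\<rparr>"

definition galois_extension :: "complex set \<Rightarrow> complex set \<Rightarrow> bool" where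
  "galois_extension K L \<longleftrightarrow> finite_extension K L \<and>
     {x \<in> L. \<forall>\<sigma> \<in> carrier (galois_group K L). \<sigma> x = x} = K"

definition cyclic_extension :: "complex set \<Rightarrow> complex set \<Rightarrow> bool" where
  "cyclic_extension K L \<longleftrightarrow> galois_extension K L \<and> cyclic_group (galois_group K L)"

definition abelian_extension :: "complex set \<Rightarrow> complex set \<Rightarrow> bool" where
  "abelian_extension K L \<longleftrightarrow> galois_extension K L \<and> comm_group (galois_group K L)"

definition ideal_power :: "complex ring \<Rightarrow> complex set \<Rightarrow> nat \<Rightarrow> complex set" where
  "ideal_power R I n = (ideal_prod R I ^^ n) (carrier R)"

text \<open>For a nonzero prime \<open>Q\<close> of \<open>L\<close> above \<open>P = Q \<inter> K\<close>, the ramification index is the exponent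
  of \<open>Q\<close> in the factorization of the extension of \<open>P\<close> to the ring of integers of \<open>L\<close>
  (to contain is to divide), and the residue degree is the degree of the residue field at \<open>Q\<close>
  over the image of the ring of integers of \<open>K\<close>, which is a copy of the residue field at
  \<open>P\<close>.\<close>

definition prime_below :: "complex set \<Rightarrow> complex set \<Rightarrow> complex set" where
  "prime_below K Q = Q \<inter> carrier (ring_of_integers K)"

definition ramification_index :: "complex set \<Rightarrow> complex set \<Rightarrow> complex set \<Rightarrow> nat" where
  "ramification_index K L Q =
     Max {e. genideal (ring_of_integers L) (prime_below K Q)
             \<subseteq> ideal_power (ring_of_integers L) Q e}"

definition residue_degree :: "complex set \<Rightarrow> complex set \<Rightarrow> complex set \<Rightarrow> nat" where
  "residue_degree K L Q =
     (let F = ring_of_integers L Quot Q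
      in ring.dim F ((\<lambda>x. Q +>\<^bsub>ring_of_integers L\<^esub> x) ` carrier (ring_of_integers K)) (carrier F))"

definition splits_completely :: "complex set \<Rightarrow> complex set \<Rightarrow> complex set \<Rightarrow> bool" where
  "splits_completely K L P \<longleftrightarrow>
     (\<forall>Q. primeideal Q (ring_of_integers L) \<and> prime_below K Q = P \<longrightarrow>
          ramification_index K L Q = 1 \<and> residue_degree K L Q = 1)"

text \<open>Unramified at all finite and infinite places. Residue fields are finite, so at a finite
  place only the ramification index matters; at an infinite place, no real embedding of \<open>K\<close>
  may extend to a non-real embedding of \<open>L\<close>.\<close>

definition unramified_extension :: "complex set \<Rightarrow> complex set \<Rightarrow> bool" where
  "unramified_extension K L \<longleftrightarrow>
     (\<forall>Q. primeideal Q (ring_of_integers L) \<and> Q \<noteq> {0} \<longrightarrow> ramification_index K L Q = 1) \<and>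
     (\<forall>\<sigma> \<in> ring_hom (complex_field\<lparr>carrier := L\<rparr>) complex_field.
          \<sigma> ` K \<subseteq> \<real> \<longrightarrow> \<sigma> ` L \<subseteq> \<real>)"

text \<open>The Hilbert class field is the maximal unramified abelian extension; as the greatest
  element for inclusion it is unique as a subfield of the complex numbers.\<close>

definition is_hilbert_class_field :: "complex set \<Rightarrow> complex set \<Rightarrow> bool" where
  "is_hilbert_class_field K H \<longleftrightarrow>
     number_field K \<and> abelian_extension K H \<and> unramified_extension K H \<and>
     (\<forall>L. abelian_extension K L \<and> unramified_extension K L \<longrightarrow> L \<subseteq> H)"

definition gaussian_mersenne :: "nat \<Rightarrow> complex" where
  "gaussian_mersenne p = (1 + \<i>) ^ p - 1"

text \<open>The floor only moves the norm, an integer on Gaussian integers, to type \<open>int\<close>; see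
  \<open>gaussian_norm_eq\<close>.\<close>

definition gaussian_norm :: "complex \<Rightarrow> int" where
  "gaussian_norm z = \<lfloor>(Re z)\<^sup>2 + (Im z)\<^sup>2\<rfloor>"

definition gaussian_mersenne_norm :: "nat \<Rightarrow> int" where
  "gaussian_mersenne_norm p = gaussian_norm (gaussian_mersenne p)"

definition gaussian_mersenne_prime :: "nat \<Rightarrow> bool" where
  "gaussian_mersenne_prime p \<longleftrightarrow> Factorial_Ring.prime p \<and> Factorial_Ring.prime (gaussian_mersenne_norm p)"

lemma gaussian_norm_eq:
  assumes "Re z \<in> \<int>" and "Im z \<in> \<int>"
  shows "of_int (gaussian_norm z) = z * cnj z"
proof -
  have "(Re z)\<^sup>2 + (Im z)\<^sup>2 \<in> \<int>"
    using assms by simp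
  then have "real_of_int (gaussian_norm z) = (Re z)\<^sup>2 + (Im z)\<^sup>2"
    unfolding gaussian_norm_def by (metis Ints_cases floor_of_int)
  then have "complex_of_real (real_of_int (gaussian_norm z)) = z * cnj z"
    by (simp add: complex_mult_cnj)
  then show ?thesis
    by simp
qed

lemma gaussian_mersenne_Ints:
  "Re (gaussian_mersenne p) \<in> \<int>" "Im (gaussian_mersenne p) \<in> \<int>"
proof -
  have "Re ((1 + \<i>) ^ p) \<in> \<int> \<and> Im ((1 + \<i>) ^ p) \<in> \<int>"
    by (induction p) auto
  then show "Re (gaussian_mersenne p) \<in> \<int>" "Im (gaussian_mersenne p) \<in> \<int>"
    by (auto simp: gaussian_mersenne_def)
qed

lemma gaussian_norm_conj_mersenne:
  "gaussian_norm ((1 - \<i>) ^ p - 1) = gaussian_mersenne_norm p"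
proof -
  have "(1 - \<i>) ^ p - 1 = cnj (gaussian_mersenne p)"
    by (simp add: gaussian_mersenne_def)
  then show ?thesis
    by (simp add: gaussian_mersenne_norm_def gaussian_norm_def)
qed

end

theory Submission
  imports Defs "HOL-Number_Theory.Number_Theory"
begin

text \<open>Write \<open>\<theta> = \<surd>(- 2 d)\<close>, \<open>s = \<surd>2\<close>, \<open>\<kappa> = \<theta> / s = \<surd>(- d)\<close>. A cyclic quartic extension of
  \<open>S = \<rat>(\<theta>)\<close> containing \<open>s\<close> is generated by a square root of
  \<open>c (a + b \<theta>) (2 + s)\<close> with integers \<open>a, b, c\<close>.
  In an unramified extension no element of \<open>S\<close> of odd valuation becomes a square, so every
  odd prime dividing the squarefree \<open>c\<close> divides \<open>d\<close>, and \<open>a\<^sup>2 + 2 d b\<^sup>2 = 2 n\<^sup>2\<close>. Complete splitting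
  of a prime \<open>G\<close> makes \<open>c (n + a + b \<kappa>)\<close> a square modulo \<open>G\<close>. As \<open>\<kappa> \<equiv> \<plusminus> x / y\<close> when \<open>G = x\<^sup>2 + d y\<^sup>2\<close>,
  quadratic reciprocity turns this into \<open>(n + a) y - b x \<equiv> \<plusminus> 1 (mod 8)\<close>, up to the sign of \<open>x\<close>.
  Here \<open>4\<close> divides \<open>y\<close>, \<open>b\<close> is \<open>\<plusminus> 1\<close> modulo \<open>8\<close>, and \<open>x\<close> is \<open>\<plusminus> 1\<close> modulo \<open>8\<close> because \<open>G \<equiv> 1 (mod 16)\<close>;
  so \<open>y / 4\<close> is even.\<close>

text \<open>Two top fields are in play: unramifiedness is known for \<open>H\<close>, so the shape
  of the radicand is found there; splitting is known for \<open>H4\<close>, so reduction modulo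
  \<open>G\<close> happens there. Only \<delta>, which lies in both, passes between them. Odd
  valuation is detected without factoring ideals. Elements outside a maximal ideal \<open>Q\<close>
  count as units; if a local generator of the prime of \<open>S\<close> below \<open>Q\<close>
  becomes a square up to such units, it lies in \<open>Q^2\<close>, and the ramification index is at
  least 2. The element c (n + a + b \<kappa>) arises by adding the roots of c (a + b \<theta>) (2 +
  s) and c (a - b \<theta>) (2 - s): their product is 2 c n, and their sum has square 4 c (n + a + b
  \<kappa>). This lies in \<rat>(\<kappa>), the field from which \<open>G\<close> is a norm.
  Reciprocity applies because e = n + a satisfies e^2 + d b^2 = 2 (n + a / 2)^2. Modulo an odd prime
  dividing e y - b x, the number b^2 G is therefore twice a square, so \<open>G\<close> has the
  quadratic character of 2 there, apart from primes dividing b, which are treated separately. The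
  congruence G \<equiv> 1 (mod 16) relies on p \<ge> 6; the exponents 2, 3, 5 give the norms 5, 13,
  41 and are checked by hand.\<close>

section \<open>Algebraic integers form a ring\<close>

context
begin

interpretation ZM: Modules.module "\<lambda>(n::int) (z::complex). of_int n * z"
  by unfold_locales (auto simp: algebra_simps)

text \<open>The Noetherian property of the integers, by induction on the generators. The
  coefficients at \<open>a\<close> that occur in \<open>N\<close> modulo the span of
  \<open>A\<close> form an ideal of the integers; an element of \<open>N\<close> realising its
  generator, together with generators of \<open>N\<close> intersected with the span of
  \<open>A\<close>, generates \<open>N\<close>.\<close>

lemma int_submodule_finitely_generated:
  assumes "finite A" "ZM.subspace N" "N \<subseteq> ZM.span A"
  shows "\<exists>B. finite B \<and> B \<subseteq> N \<and> N \<subseteq> ZM.span B"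
  using assms
proof (induction A arbitrary: N rule: finite_induct)
  case empty
  then show ?case by (intro exI[of _ "{}"]) auto
next
  case (insert a A)
  define I where "I = {k::int. \<exists>x\<in>N. x - of_int k * a \<in> ZM.span A}"
  have sub: "x - of_int q * y \<in> N" if "x \<in> N" "y \<in> N" for x y q
    using that insert.prems(1) by (intro ZM.subspace_diff ZM.subspace_scale)
  have I_comb: "k - q * l \<in> I" if kl: "k \<in> I" "l \<in> I" for k l q
  proof -
    obtain x y where x: "x \<in> N" "x - of_int k * a \<in> ZM.span A"
      and y: "y \<in> N" "y - of_int l * a \<in> ZM.span A"
      using kl by (auto simp: I_def)
    have "(x - of_int q * y) - of_int (k - q * l) * a
        = (x - of_int k * a) - of_int q * (y - of_int l * a)" by (simp add: algebra_simps)
    then have "(x - of_int q * y) - of_int (k - q * l) * a \<in> ZM.span A"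
      using ZM.span_diff[OF x(2) ZM.span_scale[OF y(2), of q]] by (simp only:)
    then show ?thesis using sub[OF x(1) y(1)] by (auto simp: I_def)
  qed
  have "\<exists>d\<in>I. \<forall>k\<in>I. d dvd k"
  proof (cases "\<exists>k\<in>I. k \<noteq> 0")
    case True
    then obtain k where k: "k \<in> I" "k \<noteq> 0" by blast
    have "0 \<in> I" using I_comb[OF k(1) k(1), of 1] by simp
    then have "- k \<in> I" using I_comb[OF _ k(1), of 0 1] by simp
    then have "\<exists>n::nat. n > 0 \<and> int n \<in> I"
      using k by (intro exI[of _ "nat \<bar>k\<bar>"]) (auto simp: abs_if)
    then obtain n where n: "n > 0" "int n \<in> I" "\<And>m. m < n \<Longrightarrow> \<not> (m > 0 \<and> int m \<in> I)"
      using exists_least_iff[of "\<lambda>n. n > 0 \<and> int n \<in> I"] by blast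
    have "int n dvd k" if "k \<in> I" for k
    proof -
      have "k mod int n \<in> I" using I_comb[OF that n(2), of "k div int n"]
        by (simp add: minus_div_mult_eq_mod)
      moreover have "nat (k mod int n) < n" using n(1) by (simp add: nat_less_iff)
      ultimately have "k mod int n = 0" using n(3)[of "nat (k mod int n)"] n(1)
        by (smt (verit) Euclidean_Rings.pos_mod_sign int_nat_eq of_nat_0_less_iff zero_less_nat_eq)
      then show ?thesis by auto
    qed
    then show ?thesis using n(2) by blast
  next
    case False
    have "0 \<in> I" using ZM.subspace_0[OF insert.prems(1)] ZM.span_zero by (auto simp: I_def intro!: bexI[of _ 0])
    with False show ?thesis by (intro bexI[of _ 0]) auto
  qed
  then obtain d xd where d: "\<And>k. k \<in> I \<Longrightarrow> d dvd k" "xd \<in> N" "xd - of_int d * a \<in> ZM.span A"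
    by (auto simp: I_def)
  have "ZM.subspace (N \<inter> ZM.span A)" using insert.prems(1) by (simp add: ZM.subspace_inter)
  then obtain B where B: "finite B" "B \<subseteq> N \<inter> ZM.span A" "N \<inter> ZM.span A \<subseteq> ZM.span B"
    using insert.IH[of "N \<inter> ZM.span A"] by auto
  have "x \<in> ZM.span (Set.insert xd B)" if x: "x \<in> N" for x
  proof -
    obtain k where k: "x - of_int k * a \<in> ZM.span A"
      using insert.prems(2) x ZM.span_insert[of a A] by auto
    then have "k \<in> I" using x by (auto simp: I_def)
    then obtain q where q: "k = d * q" using d(1) by (auto simp: dvd_def)
    have "x - of_int q * xd = (x - of_int k * a) - of_int q * (xd - of_int d * a)"
      by (simp add: algebra_simps q)
    then have "x - of_int q * xd \<in> ZM.span A"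
      using ZM.span_diff[OF k ZM.span_scale[OF d(3), of q]] by (simp only:)
    then have "x - of_int q * xd \<in> ZM.span B" using B(3) sub[OF x d(2)] by auto
    then show ?thesis unfolding ZM.span_insert by blast
  qed
  then show ?case using B(1,2) d(2) by (intro exI[of _ "Set.insert xd B"]) auto
qed

lemma int_span_powers_poly:
  assumes "w \<in> ZM.span ((\<lambda>i. z ^ i) ` {..<D})"
  shows "\<exists>p. (\<forall>i. coeff p i \<in> \<int>) \<and> (\<forall>i\<ge>D. coeff p i = 0) \<and> w = poly p z"
  using assms
proof (induction rule: ZM.span_induct_alt)
  case base
  show ?case by (intro exI[of _ 0]) auto
next
  case (step c x y)
  then obtain p i where "\<forall>i. coeff p i \<in> \<int>" "\<forall>i\<ge>D. coeff p i = 0" "y = poly p z" "i < D" "x = z ^ i"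
    by auto
  then show ?case
    by (intro exI[of _ "monom (of_int c) i + p"]) (auto simp: poly_monom)
qed

text \<open>A Noetherian argument in place of a determinant: the additive group generated by all
  powers of \<open>z\<close> sits inside the span of \<open>A\<close>, so it is finitely generated,
  and its generators involve only powers below some \<open>D\<close>. Then \<open>z ^ D\<close> is
  an integer combination of lower powers, which is a monic equation.\<close>

lemma algebraic_int_if_fin_gen_module:
  assumes A: "finite A" and one: "1 \<in> ZM.span A" and z: "\<And>a. a \<in> A \<Longrightarrow> z * a \<in> ZM.span A"
  shows "algebraic_int z"
proof -
  define pw where "pw = (\<lambda>D. (\<lambda>i. z ^ i) ` {..<D::nat})"
  define N where "N = (\<Union>D. ZM.span (pw D))"
  have mono: "ZM.span (pw D) \<subseteq> ZM.span (pw E)" if "D \<le> E" for D E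
    using that unfolding pw_def by (intro ZM.span_mono) auto
  have zM: "z * w \<in> ZM.span A" if "w \<in> ZM.span A" for w
    using that
  proof (induction rule: ZM.span_induct_alt)
    case base
    show ?case by (simp add: ZM.span_zero)
  next
    case (step c x y)
    have "z * (of_int c * x + y) = of_int c * (z * x) + z * y" by (simp add: algebra_simps)
    then show ?case using ZM.span_add[OF ZM.span_scale[OF z[OF step(1)]] step(2)] by (simp only:)
  qed
  have pow: "z ^ i \<in> ZM.span A" for i
    by (induction i) (auto intro: one zM)
  have "N \<subseteq> ZM.span A"
    unfolding N_def pw_def using pow by (intro UN_least ZM.span_minimal ZM.subspace_span) auto
  moreover have "ZM.subspace N"
  proof (rule ZM.subspaceI)
    show "0 \<in> N" by (auto simp: N_def ZM.span_zero)
    show "of_int c * x \<in> N" if "x \<in> N" for c x using that by (auto simp: N_def intro: ZM.span_scale)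
    show "x + y \<in> N" if xy: "x \<in> N" "y \<in> N" for x y
    proof -
      obtain D E where DE: "x \<in> ZM.span (pw D)" "y \<in> ZM.span (pw E)" using xy by (auto simp: N_def)
      then have "x + y \<in> ZM.span (pw (max D E))"
        using mono[of D "max D E"] mono[of E "max D E"] DE by (intro ZM.span_add) (meson max.cobounded1 max.cobounded2 subsetD)+
      then show ?thesis by (auto simp: N_def)
    qed
  qed
  ultimately have "\<exists>B. finite B \<and> B \<subseteq> N \<and> N \<subseteq> ZM.span B"
    by (intro int_submodule_finitely_generated[OF A])
  then obtain B where B: "finite B" "B \<subseteq> N" "N \<subseteq> ZM.span B" by auto
  have "\<exists>D. B \<subseteq> ZM.span (pw D)"
    using B(1,2)
  proof (induction rule: finite_induct)
    case (insert b B)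
    then obtain D E where "B \<subseteq> ZM.span (pw D)" "b \<in> ZM.span (pw E)" by (auto simp: N_def)
    then have "Set.insert b B \<subseteq> ZM.span (pw (max D E))"
      using mono[of D "max D E"] mono[of E "max D E"] by auto
    then show ?case by blast
  qed auto
  then obtain D where D: "B \<subseteq> ZM.span (pw D)" by blast
  have "z ^ D \<in> ZM.span (pw (Suc D))" unfolding pw_def by (intro ZM.span_base) auto
  then have "z ^ D \<in> ZM.span B" using B(3) by (auto simp: N_def)
  then have "z ^ D \<in> ZM.span (pw D)" using ZM.span_minimal[OF D ZM.subspace_span] by auto
  then obtain p where p: "\<forall>i. coeff p i \<in> \<int>" "\<forall>i\<ge>D. coeff p i = 0" "z ^ D = poly p z"
    using int_span_powers_poly unfolding pw_def by blast
  define q where "q = monom 1 D - p"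
  have "coeff q D = 1" "\<forall>i>D. coeff q i = 0" using p(2) by (auto simp: q_def)
  then have "degree q = D" by (intro antisym degree_le le_degree) auto
  then have "lead_coeff q = 1" using \<open>coeff q D = 1\<close> by simp
  moreover have "poly q z = 0"
    using p(3) by (simp add: q_def poly_monom)
  moreover have "\<forall>i. coeff q i \<in> \<int>"
    using p(1) by (auto simp: q_def)
  ultimately show ?thesis by (auto simp: algebraic_int.simps)
qed

lemma algebraic_int_power_relation:
  assumes "algebraic_int (x::complex)"
  obtains n and c :: "nat \<Rightarrow> int" where "n > 0" "x ^ n = (\<Sum>i<n. of_int (c i) * x ^ i)"
proof -
  obtain p where p: "poly p x = 0" "lead_coeff p = 1" "\<And>i. coeff p i \<in> \<int>"
    using assms unfolding algebraic_int.simps by blast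
  define n where "n = degree p"
  have "\<forall>i. \<exists>k. coeff p i = of_int k" using p(3) by (auto elim: Ints_cases)
  then obtain e where e: "\<And>i. coeff p i = of_int (e i)" by metis
  have "0 = (\<Sum>i\<le>n. of_int (e i) * x ^ i)"
    using p(1) by (simp add: poly_altdef n_def e)
  also have "\<dots> = (\<Sum>i<n. of_int (e i) * x ^ i) + x ^ n"
    using p(2) by (simp add: lessThan_Suc_atMost[symmetric] n_def e)
  finally have "x ^ n = (\<Sum>i<n. of_int (- e i) * x ^ i)"
    by (simp add: sum_negf eq_neg_iff_add_eq_0 add.commute)
  moreover from this have "n > 0" by (cases "n = 0") auto
  ultimately show ?thesis by (intro that)
qed

text \<open>The monomials \<open>x ^ i * y ^ j\<close> with exponents below the degrees of the two
  monic equations span a module that contains 1 and is stable under both \<open>x\<close> and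
  \<open>y\<close>, hence under their sum and product.\<close>

lemma
  fixes x y :: complex
  assumes "algebraic_int x" "algebraic_int y"
  shows algebraic_int_add: "algebraic_int (x + y)" and algebraic_int_mult: "algebraic_int (x * y)"
proof -
  obtain m c where x: "m > 0" "x ^ m = (\<Sum>i<m. of_int (c i) * x ^ i)"
    using algebraic_int_power_relation[OF assms(1)] by metis
  obtain n e where y: "n > 0" "y ^ n = (\<Sum>i<n. of_int (e i) * y ^ i)"
    using algebraic_int_power_relation[OF assms(2)] by metis
  define A where "A = (\<lambda>(i, j). x ^ i * y ^ j) ` ({..<m} \<times> {..<n})"
  have base: "x ^ i * y ^ j \<in> ZM.span A" if "i < m" "j < n" for i j
    using that by (intro ZM.span_base) (auto simp: A_def)
  have A: "finite A" by (simp add: A_def)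
  have one: "1 \<in> ZM.span A" using base[of 0 0] x(1) y(1) by simp
  have xA: "x * a \<in> ZM.span A" if aA: "a \<in> A" for a
  proof -
    obtain i j where ij: "a = x ^ i * y ^ j" "i < m" "j < n" using aA by (auto simp: A_def)
    show ?thesis
    proof (cases "Suc i < m")
      case True
      then show ?thesis using base[OF True ij(3)] by (simp add: ij(1) mult.assoc)
    next
      case False
      then have "x * a = x ^ m * y ^ j" using ij(1,2)
        by (metis Suc_lessI mult.assoc power_Suc)
      also have "\<dots> = (\<Sum>i<m. of_int (c i) * (x ^ i * y ^ j))"
        by (simp add: x(2) sum_distrib_right mult.assoc)
      also have "\<dots> \<in> ZM.span A" using ij(3) by (intro ZM.span_sum ZM.span_scale base) auto
      finally show ?thesis .
    qed
  qed
  have yA: "y * a \<in> ZM.span A" if aA: "a \<in> A" for a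
  proof -
    obtain i j where ij: "a = x ^ i * y ^ j" "i < m" "j < n" using aA by (auto simp: A_def)
    show ?thesis
    proof (cases "Suc j < n")
      case True
      then show ?thesis using base[OF ij(2) True] by (simp add: ij(1) mult.left_commute)
    next
      case False
      then have "y * a = x ^ i * y ^ n" using ij
        by (metis Suc_lessI mult.left_commute power_Suc)
      also have "\<dots> = (\<Sum>j<n. of_int (e j) * (x ^ i * y ^ j))"
        by (simp add: y(2) sum_distrib_left mult.left_commute)
      also have "\<dots> \<in> ZM.span A" using ij(2) by (intro ZM.span_sum ZM.span_scale base) auto
      finally show ?thesis .
    qed
  qed
  have yspan: "y * w \<in> ZM.span A" if "w \<in> ZM.span A" for w
    using that
  proof (induction rule: ZM.span_induct_alt)
    case (step c u v)
    have "y * (of_int c * u + v) = of_int c * (y * u) + y * v" by (simp add: algebra_simps)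
    then show ?case using ZM.span_add[OF ZM.span_scale[OF yA[OF step(1)]] step(2)] by (simp only:)
  qed (simp add: ZM.span_zero)
  show "algebraic_int (x + y)"
    by (rule algebraic_int_if_fin_gen_module[OF A one])
      (simp add: distrib_right ZM.span_add xA yA)
  have "x * y * a \<in> ZM.span A" if "a \<in> A" for a
    using yspan[OF xA[OF that]] by (simp add: mult.assoc mult.left_commute)
  then show "algebraic_int (x * y)"
    by (rule algebraic_int_if_fin_gen_module[OF A one])
qed

end

lemma algebraic_int_sqrt_of_square:
  assumes "algebraic_int ((x::complex)\<^sup>2)"
  shows "algebraic_int x"
  by (rule algebraic_int_root[OF assms, where p = "monom 1 2"])
     (auto simp: poly_monom degree_monom_eq)

lemma algebraic_int_of_int_complex: "algebraic_int (of_int n :: complex)"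
  by (rule int_imp_algebraic_int) auto

lemma algebraic_int_diff:
  "algebraic_int x \<Longrightarrow> algebraic_int y \<Longrightarrow> algebraic_int (x - y :: complex)"
  using algebraic_int_add[of x "- y"] by auto

lemma algebraic_int_power:
  "algebraic_int x \<Longrightarrow> algebraic_int (x ^ n :: complex)"
  by (induction n) (auto intro: algebraic_int_mult simp: algebraic_int_of_int_complex[of 1, simplified])

section \<open>Subfields of the complex numbers\<close>

lemma complex_field_simps [simp]:
  "carrier complex_field = UNIV" "mult complex_field x y = x * y" "one complex_field = 1"
  "ring.zero complex_field = 0" "ring.add complex_field x y = x + y"
  by (simp_all add: ring_of_type_algebra_def)

lemma field_complex_field: "field complex_field"
  by (rule field_from_type_algebra)

interpretation CF: cring complex_field
  by (rule cring_from_type_algebra)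

lemma complex_field_a_inv [simp]: "a_inv complex_field x = - x"
proof -
  have "x \<oplus>\<^bsub>complex_field\<^esub> a_inv complex_field x = \<zero>\<^bsub>complex_field\<^esub>"
    by (rule CF.r_neg) simp
  then show ?thesis by (simp add: add_eq_0_iff)
qed

lemma complex_field_m_inv [simp]: "x \<noteq> 0 \<Longrightarrow> m_inv complex_field x = inverse x"
proof -
  assume "x \<noteq> 0"
  then have "x \<in> Units complex_field"
    by (simp add: field.field_Units[OF field_complex_field])
  then have "x \<otimes>\<^bsub>complex_field\<^esub> m_inv complex_field x = \<one>\<^bsub>complex_field\<^esub>"
    by (rule CF.Units_r_inv)
  then show ?thesis by (simp add: inverse_unique)
qed

lemma subfield_complexI:
  assumes "0 \<in> K" "1 \<in> K" "\<And>x y. x \<in> K \<Longrightarrow> y \<in> K \<Longrightarrow> x + y \<in> K"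
    "\<And>x y. x \<in> K \<Longrightarrow> y \<in> K \<Longrightarrow> x * y \<in> K" "\<And>x. x \<in> K \<Longrightarrow> - x \<in> K"
    "\<And>x. x \<in> K \<Longrightarrow> inverse x \<in> K"
  shows "subfield K complex_field"
proof (rule field.subfieldI'[OF field_complex_field])
  show "subring K complex_field"
    using assms by (intro CF.subringI) auto
  show "inv\<^bsub>complex_field\<^esub> k \<in> K" if "k \<in> K - {\<zero>\<^bsub>complex_field\<^esub>}" for k
    using that assms by auto
qed

lemma subfield_complexD:
  assumes "subfield K complex_field"
  shows "0 \<in> K" "1 \<in> K" "\<And>x y. x \<in> K \<Longrightarrow> y \<in> K \<Longrightarrow> x + y \<in> K"
    "\<And>x y. x \<in> K \<Longrightarrow> y \<in> K \<Longrightarrow> x * y \<in> K" "\<And>x. x \<in> K \<Longrightarrow> - x \<in> K"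
    "\<And>x. x \<in> K \<Longrightarrow> inverse x \<in> K" "\<And>x y. x \<in> K \<Longrightarrow> y \<in> K \<Longrightarrow> x - y \<in> K"
    "\<And>x y. x \<in> K \<Longrightarrow> y \<in> K \<Longrightarrow> x / y \<in> K" "\<And>n. of_int n \<in> K"
    "\<And>x n. x \<in> K \<Longrightarrow> x ^ n \<in> K" "\<And>n. numeral n \<in> K" "\<rat> \<subseteq> K"
proof -
  have sr: "subring K complex_field" using assms by (rule subfieldE)
  show 0: "0 \<in> K" and 1: "1 \<in> K" using subringE(2,3)[OF sr] by auto
  show a: "\<And>x y. x \<in> K \<Longrightarrow> y \<in> K \<Longrightarrow> x + y \<in> K" using subringE(7)[OF sr] by auto
  show m: "\<And>x y. x \<in> K \<Longrightarrow> y \<in> K \<Longrightarrow> x * y \<in> K" using subringE(6)[OF sr] by auto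
  show n: "\<And>x. x \<in> K \<Longrightarrow> - x \<in> K" using subringE(5)[OF sr] by auto
  show i: "inverse x \<in> K" if x: "x \<in> K" for x
    using CF.subfield_m_inv(1)[OF assms, of x] x 0 by (cases "x = 0") auto
  show d: "\<And>x y. x \<in> K \<Longrightarrow> y \<in> K \<Longrightarrow> x - y \<in> K" using a[OF _ n] by simp
  show q: "\<And>x y. x \<in> K \<Longrightarrow> y \<in> K \<Longrightarrow> x / y \<in> K" using m[OF _ i] by (simp add: field_simps)
  have nat: "of_nat n \<in> K" for n by (induction n) (auto intro: 0 1 a)
  show int: "of_int n \<in> K" for n
    by (cases n rule: int_cases2) (auto intro: nat n)
  show "\<And>x n. x \<in> K \<Longrightarrow> x ^ n \<in> K" subgoal for x n by (induction n) (auto intro: 1 m) done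
  show "\<And>n. numeral n \<in> K" using nat[of "numeral _"] by simp
  show "\<rat> \<subseteq> K"
  proof
    fix x :: complex assume "x \<in> \<rat>"
    then obtain a b :: int where "x = of_int a / of_int b" by (metis Rats_cases')
    then show "x \<in> K" using int q by auto
  qed
qed

lemma subfield_Rats: "subfield \<rat> complex_field"
  by (rule subfield_complexI) auto

lemma combine_eq_sum:
  "length Ks = length Us \<Longrightarrow> CF.combine Ks Us = (\<Sum>i<length Us. Ks ! i * Us ! i)"
proof (induction Ks Us rule: list_induct2)
  case (Cons k Ks u Us)
  then show ?case by (simp add: sum.lessThan_Suc_shift del: sum.lessThan_Suc)
qed simp

lemma dimension_imp_relation:
  assumes K: "subfield K complex_field" and dim: "CF.dimension n K E"
    and m: "n < m" and f: "\<And>i. i < m \<Longrightarrow> f i \<in> E"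
  obtains q where "\<And>i. i < m \<Longrightarrow> q i \<in> K" "(\<Sum>i<m. q i * f i) = 0" "\<exists>i<m. q i \<noteq> 0"
proof -
  define Us where "Us = map f [0..<m]"
  have Us: "set Us \<subseteq> E" using f by (auto simp: Us_def)
  have "\<not> CF.independent K Us"
    using CF.independent_length_le_dimension[OF K dim _ Us] m by (auto simp: Us_def)
  then obtain Ks where Ks: "length Ks = length Us" "CF.combine Ks Us = 0" "set Ks \<subseteq> K" "set Ks \<noteq> {0}"
    using CF.dependent_imp_non_trivial_combine[OF K, of Us] by auto
  have nz: "\<exists>i<m. Ks ! i \<noteq> 0"
  proof (rule ccontr)
    assume "\<not> ?thesis"
    then have "set Ks \<subseteq> {0}" using Ks(1) by (auto simp: Us_def in_set_conv_nth)
    moreover have "set Ks \<noteq> {}" using Ks(1) m by (auto simp: Us_def)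
    ultimately have "set Ks = {0}" by (simp only: subset_singleton_iff) simp
    then show False using Ks(4) by simp
  qed
  show ?thesis
  proof (rule that[of "\<lambda>i. Ks ! i"])
    show "Ks ! i \<in> K" if "i < m" for i using that Ks(1,3) by (auto simp: Us_def)
    show "(\<Sum>i<m. Ks ! i * f i) = 0"
      using Ks(2) combine_eq_sum[OF Ks(1)] by (simp add: Us_def)
  qed (rule nz)
qed

text \<open>A substitute for an integral basis. One vector more than the dimension forces a rational
  relation; clearing denominators and dividing by the gcd of the coefficients makes it primitive, so
  no prime divides all coefficients. The number \<open>n\<close> depends neither on the elements nor
  on the prime.\<close>

lemma primitive_integer_relation:
  assumes "CF.finite_dimension \<rat> L"
  obtains n where "\<And>f l. (\<And>i. i < n \<Longrightarrow> f i \<in> L) \<Longrightarrow> Factorial_Ring.prime (l::int) \<Longrightarrow>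
    \<exists>c::nat \<Rightarrow> int. (\<Sum>i<n. of_int (c i) * f i) = 0 \<and> (\<exists>i<n. \<not> l dvd c i)"
proof -
  obtain n where n: "CF.dimension n \<rat> L" using assms by (rule CF.finite_dimensionE')
  show ?thesis
  proof (rule that[of "Suc n"])
    fix f :: "nat \<Rightarrow> complex" and l :: int
    assume f: "\<And>i. i < Suc n \<Longrightarrow> f i \<in> L" and l: "Factorial_Ring.prime l"
    obtain q where q: "\<And>i. i < Suc n \<Longrightarrow> q i \<in> \<rat>" "(\<Sum>i<Suc n. q i * f i) = 0" "\<exists>i<Suc n. q i \<noteq> 0"
      by (rule dimension_imp_relation[OF subfield_Rats n lessI, of f]) (use f in \<open>assumption | blast\<close>)+
    have "\<exists>a b. b \<noteq> 0 \<and> q i = of_int a / of_int b" if i: "i < Suc n" for i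
    proof -
      obtain a b where "b > 0" "q i = of_int a / of_int b"
        using q(1)[OF i] by (rule Rats_cases')
      then show ?thesis by (intro exI[of _ a] exI[of _ b]) auto
    qed
    then have "\<forall>i. \<exists>a b. i < Suc n \<longrightarrow> b \<noteq> 0 \<and> q i = of_int a / of_int b" by blast
    then obtain a b where ab: "\<And>i. i < Suc n \<Longrightarrow> b i \<noteq> 0 \<and> q i = of_int (a i) / of_int (b i)"
      by metis
    define D where "D = (\<Prod>i<Suc n. b i)"
    have D: "D \<noteq> 0" using ab by (auto simp: D_def)
    have "\<forall>i. \<exists>e. i < Suc n \<longrightarrow> of_int e = of_int D * q i"
    proof (intro allI)
      fix i show "\<exists>e. i < Suc n \<longrightarrow> of_int e = of_int D * q i"
      proof (cases "i < Suc n")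
        case True
        then have "b i dvd D" unfolding D_def by (intro dvd_prodI) auto
        then obtain k where "D = b i * k" ..
        with ab[OF True] show ?thesis by (intro exI[of _ "k * a i"]) auto
      qed auto
    qed
    then obtain e where e: "\<And>i. i < Suc n \<Longrightarrow> of_int (e i) = of_int D * q i" by metis
    define g where "g = Gcd (e ` {..<Suc n})"
    obtain j where j: "j < Suc n" "q j \<noteq> 0" using q(3) by blast
    then have "e j \<noteq> 0" using e[OF j(1)] D by auto
    then have g0: "g \<noteq> 0" using j(1) unfolding g_def Gcd_0_iff by auto
    have "\<forall>i. \<exists>c. i < Suc n \<longrightarrow> e i = g * c"
    proof (intro allI)
      fix i show "\<exists>c. i < Suc n \<longrightarrow> e i = g * c"
        using Gcd_dvd[of "e i" "e ` {..<Suc n}"] by (auto simp: g_def dvd_def)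
    qed
    then obtain c where c: "\<And>i. i < Suc n \<Longrightarrow> e i = g * c i" by metis
    have "of_int g * (\<Sum>i<Suc n. of_int (c i) * f i) = (\<Sum>i<Suc n. of_int (e i) * f i)"
      unfolding sum_distrib_left by (intro sum.cong) (auto simp: c)
    also have "\<dots> = of_int D * (\<Sum>i<Suc n. q i * f i)"
      unfolding sum_distrib_left by (intro sum.cong) (auto simp: e)
    finally have "(\<Sum>i<Suc n. of_int (c i) * f i) = 0" using q(2) g0 by auto
    moreover have "\<exists>i<Suc n. \<not> l dvd c i"
    proof (rule ccontr)
      assume "\<not> ?thesis"
      then have "g * l dvd e i" if "i < Suc n" for i using c[OF that] that by auto
      then have "g * l dvd g" unfolding g_def by (intro Gcd_greatest) auto
      then have "l dvd 1" using g0 by (metis dvd_times_left_cancel_iff mult.right_neutral)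
      then show False using l not_prime_unit by blast
    qed
    ultimately show "\<exists>c::nat \<Rightarrow> int. (\<Sum>i<Suc n. of_int (c i) * f i) = 0 \<and> (\<exists>i<Suc n. \<not> l dvd c i)"
      by blast
  qed
qed

section \<open>Ideals of rings of integers\<close>

lemma ring_of_integers_simps [simp]:
  "carrier (ring_of_integers L) = {x \<in> L. algebraic_int x}" "mult (ring_of_integers L) x y = x * y"
  "one (ring_of_integers L) = 1" "ring.zero (ring_of_integers L) = 0"
  "ring.add (ring_of_integers L) x y = x + y"
  by (simp_all add: ring_of_integers_def)

abbreviation int_ring_carrier ("\<O>") where "\<O> L \<equiv> carrier (ring_of_integers L)"

lemma cring_ring_of_integers:
  assumes "subfield L complex_field"
  shows "cring (ring_of_integers L)"
proof -
  have "subring {x \<in> L. algebraic_int x} complex_field"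
    using subfield_complexD[OF assms] algebraic_int_of_int_complex[of 1]
    by (intro CF.subringI) (auto intro: algebraic_int_add algebraic_int_mult)
  then have "ring (ring_of_integers L)"
    unfolding ring_of_integers_def by (rule CF.subring_is_ring)
  then show ?thesis
    by (intro cring.intro comm_monoidI) (auto simp: ring.ring_simprules intro: algebraic_int_mult 
      subfield_complexD[OF assms] algebraic_int_of_int_complex[of 1, simplified])
qed

lemma ring_of_integers_closed:
  assumes "subfield L complex_field"
  defines "A \<equiv> \<O> L"
  shows "x \<in> A \<Longrightarrow> y \<in> A \<Longrightarrow> x + y \<in> A" "x \<in> A \<Longrightarrow> y \<in> A \<Longrightarrow> x * y \<in> A"
    "x \<in> A \<Longrightarrow> y \<in> A \<Longrightarrow> x - y \<in> A" "x \<in> A \<Longrightarrow> - x \<in> A" "of_int n \<in> A" "0 \<in> A" "1 \<in> A"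
    "numeral k \<in> A" "x \<in> A \<Longrightarrow> x ^ m \<in> A"
  using subfield_complexD[OF assms(1)] algebraic_int_of_int_complex[of 1]
    algebraic_int_of_int_complex[of n] algebraic_int_of_int_complex[of "numeral k"]
  by (auto simp: A_def intro: algebraic_int_add algebraic_int_mult algebraic_int_diff algebraic_int_power)

lemma ideal_ring_of_integersI:
  assumes L: "subfield L complex_field" and "I \<subseteq> \<O> L" "0 \<in> I"
    "\<And>x y. x \<in> I \<Longrightarrow> y \<in> I \<Longrightarrow> x + y \<in> I"
    "\<And>a x. a \<in> \<O> L \<Longrightarrow> x \<in> I \<Longrightarrow> a * x \<in> I"
  shows "ideal I (ring_of_integers L)"
proof -
  interpret R: cring "ring_of_integers L" by (rule cring_ring_of_integers[OF L])
  have inv: "\<ominus>\<^bsub>ring_of_integers L\<^esub> x = - x" if "x \<in> \<O> L" for x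
    using R.r_neg[OF that] by (simp add: add_eq_0_iff)
  have neg: "- x \<in> I" if "x \<in> I" for x
    using assms(5)[of "-1" x] that ring_of_integers_closed(4,7)[OF L] by simp
  show ?thesis
  proof (rule idealI[OF R.ring_axioms])
    show "subgroup I (add_monoid (ring_of_integers L))"
    proof (rule R.add.subgroupI)
      show "\<ominus>\<^bsub>ring_of_integers L\<^esub> x \<in> I" if "x \<in> I" for x
        using neg[OF that] inv that assms(2) by (metis subsetD)
    qed (use assms in auto)
    show "a \<otimes>\<^bsub>ring_of_integers L\<^esub> x \<in> I" "x \<otimes>\<^bsub>ring_of_integers L\<^esub> a \<in> I"
      if "a \<in> I" "x \<in> \<O> L" for a x
      using assms(5)[OF that(2,1)] by (simp_all add: mult.commute)
  qed
qed

lemma ideal_ring_of_integersD: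
  assumes L: "subfield L complex_field" and I: "ideal I (ring_of_integers L)"
  shows "I \<subseteq> \<O> L" "0 \<in> I" "\<And>x y. x \<in> I \<Longrightarrow> y \<in> I \<Longrightarrow> x + y \<in> I"
    "\<And>a x. a \<in> \<O> L \<Longrightarrow> x \<in> I \<Longrightarrow> a * x \<in> I"
    "\<And>a x. a \<in> \<O> L \<Longrightarrow> x \<in> I \<Longrightarrow> x * a \<in> I"
    "\<And>x. x \<in> I \<Longrightarrow> - x \<in> I" "\<And>x y. x \<in> I \<Longrightarrow> y \<in> I \<Longrightarrow> x - y \<in> I"
proof -
  interpret R: cring "ring_of_integers L" by (rule cring_ring_of_integers[OF L])
  interpret I: ideal I "ring_of_integers L" by (rule I)
  show "I \<subseteq> \<O> L" using I.Icarr by blast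
  show "0 \<in> I" using I.zero_closed by simp
  show add: "\<And>x y. x \<in> I \<Longrightarrow> y \<in> I \<Longrightarrow> x + y \<in> I" using I.a_closed by simp
  show mult: "\<And>a x. a \<in> \<O> L \<Longrightarrow> x \<in> I \<Longrightarrow> a * x \<in> I"
    using I.I_l_closed by simp
  then show "\<And>a x. a \<in> \<O> L \<Longrightarrow> x \<in> I \<Longrightarrow> x * a \<in> I"
    by (simp add: mult.commute)
  show neg: "\<And>x. x \<in> I \<Longrightarrow> - x \<in> I"
    using mult[of "-1"] ring_of_integers_closed(4,7)[OF L] by simp
  show "\<And>x y. x \<in> I \<Longrightarrow> y \<in> I \<Longrightarrow> x - y \<in> I" using add[OF _ neg] by simp
qed

text \<open>Zorn's lemma among the ideals that contain \<open>x\<close> and \<open>y\<close> but not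
  1. Two generators are allowed so that a prime above \<open>l\<close> can also be made to contain a
  prescribed conjugate.\<close>

lemma maximal_ideal_containing:
  assumes L: "subfield L complex_field" and xy: "x \<in> \<O> L" "y \<in> \<O> L"
    and proper: "\<And>a b. a \<in> \<O> L \<Longrightarrow> b \<in> \<O> L \<Longrightarrow> a * x + b * y \<noteq> 1"
  obtains Q where "maximalideal Q (ring_of_integers L)" "x \<in> Q" "y \<in> Q"
proof -
  define R where "R = ring_of_integers L"
  note cl = ring_of_integers_closed[OF L, folded R_def]
  note idI = ideal_ring_of_integersI[OF L, folded R_def]
  note idD = ideal_ring_of_integersD[OF L, folded R_def]
  define A where "A = {I. ideal I R \<and> x \<in> I \<and> y \<in> I \<and> 1 \<notin> I}"
  define I0 where "I0 = {a * x + b * y | a b. a \<in> carrier R \<and> b \<in> carrier R}"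
  have "I0 \<in> A"
  proof -
    have "ideal I0 R"
    proof (rule idI)
      show "I0 \<subseteq> carrier R" using xy[folded R_def] by (auto simp: I0_def simp del: ring_of_integers_simps intro!: cl)
      show "0 \<in> I0" using cl(6) by (force simp: I0_def)
      show "u + v \<in> I0" if uv: "u \<in> I0" "v \<in> I0" for u v
      proof -
        obtain a b a' b' where "a \<in> carrier R" "b \<in> carrier R" "a' \<in> carrier R" "b' \<in> carrier R"
          "u = a * x + b * y" "v = a' * x + b' * y" using uv by (auto simp: I0_def)
        then show ?thesis unfolding I0_def
          by (intro CollectI exI[of _ "a + a'"] exI[of _ "b + b'"]) (auto intro: cl simp: algebra_simps)
      qed
      show "c * u \<in> I0" if cu: "c \<in> carrier R" "u \<in> I0" for c u
      proof -
        obtain a b where "a \<in> carrier R" "b \<in> carrier R"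
          "u = a * x + b * y" using cu by (auto simp: I0_def)
        then show ?thesis unfolding I0_def using cu
          by (intro CollectI exI[of _ "c * a"] exI[of _ "c * b"]) (auto intro: cl simp: algebra_simps)
      qed
    qed
    moreover have "x \<in> I0" unfolding I0_def using cl(6,7) by (intro CollectI exI[of _ 1] exI[of _ 0]) auto
    moreover have "y \<in> I0" unfolding I0_def using cl(6,7) by (intro CollectI exI[of _ 0] exI[of _ 1]) auto
    moreover have "1 \<notin> I0"
    proof
      assume "1 \<in> I0"
      then obtain a b where "a \<in> carrier R" "b \<in> carrier R" "1 = a * x + b * y"
        by (auto simp: I0_def)
      then show False using proper[folded R_def, of a b] by simp
    qed
    ultimately show ?thesis by (simp add: A_def)
  qed
  have "\<exists>M\<in>A. \<forall>Y\<in>A. M \<subseteq> Y \<longrightarrow> Y = M"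
  proof (rule subset_Zorn_nonempty)
    show "A \<noteq> {}" using \<open>I0 \<in> A\<close> by blast
    fix C assume C: "C \<noteq> {}" "subset.chain A C"
    have sub: "I \<in> A" if "I \<in> C" for I using C(2) that by (auto simp: subset.chain_def)
    have "ideal (\<Union> C) R"
    proof (rule idI)
      show "\<Union> C \<subseteq> carrier R" using sub idD(1) by (auto simp: A_def simp del: ring_of_integers_simps)
      show "0 \<in> \<Union> C" using C(1) sub idD(2) by (auto simp: A_def)
      show "u + v \<in> \<Union> C" if uv: "u \<in> \<Union> C" "v \<in> \<Union> C" for u v
      proof -
        obtain I J where IJ: "I \<in> C" "J \<in> C" "u \<in> I" "v \<in> J" using uv by auto
        then have "I \<subseteq> J \<or> J \<subseteq> I" using C(2) by (auto simp: subset.chain_def)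
        then obtain K where "K \<in> C" "u \<in> K" "v \<in> K" using IJ by blast
        then show ?thesis using sub[of K] idD(3) by (auto simp: A_def)
      qed
      show "c * u \<in> \<Union> C" if cu: "c \<in> carrier R" "u \<in> \<Union> C" for c u
      proof -
        obtain I where I: "I \<in> C" "u \<in> I" using cu by auto
        then have "c * u \<in> I" using sub[of I] cu(1) idD(4)[of I c u] by (simp add: A_def)
        then show ?thesis using I(1) by blast
      qed
    qed
    then show "\<Union> C \<in> A" using C(1) sub by (auto simp: A_def)
  qed
  then obtain Q where Q: "Q \<in> A" "\<And>Y. Y \<in> A \<Longrightarrow> Q \<subseteq> Y \<Longrightarrow> Y = Q" by blast
  have "maximalideal Q R"
  proof (rule maximalidealI)
    show "ideal Q R" using Q(1) by (simp add: A_def)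
    show "carrier R \<noteq> Q" using Q(1) cl(7) by (auto simp: A_def)
    show "J = Q \<or> J = carrier R" if J: "ideal J R" "Q \<subseteq> J" "J \<subseteq> carrier R" for J
    proof (cases "1 \<in> J")
      case True
      then have "a \<in> J" if "a \<in> carrier R" for a using idD(4)[OF J(1) that True] by simp
      then show ?thesis using J(3) by blast
    next
      case False
      then have "J \<in> A" using J Q(1) by (auto simp: A_def)
      then show ?thesis using Q(2) J(2) by blast
    qed
  qed
  then show ?thesis using that Q(1) by (auto simp: A_def R_def)
qed

lemma maximalideal_inverse_mod:
  assumes L: "subfield L complex_field" and Q: "maximalideal Q (ring_of_integers L)"
    and u: "u \<in> \<O> L" "u \<notin> Q"
  obtains v where "v \<in> \<O> L" "u * v - 1 \<in> Q"
proof -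
  define R where "R = ring_of_integers L"
  note cl = ring_of_integers_closed[OF L, folded R_def]
  note idI = ideal_ring_of_integersI[OF L, folded R_def]
  have idQ: "ideal Q R" using Q by (simp add: R_def maximalideal_def)
  note idD = ideal_ring_of_integersD[OF L, folded R_def, OF idQ]
  define J where "J = {u * a + q | a q. a \<in> carrier R \<and> q \<in> Q}"
  note u = u[folded R_def]
  have "ideal J R"
  proof (rule idI)
    show "J \<subseteq> carrier R" using u(1) idD(1) by (auto simp: J_def simp del: ring_of_integers_simps intro!: cl)
    show "0 \<in> J" using cl(6) idD(2) by (force simp: J_def)
    show "x + y \<in> J" if xy: "x \<in> J" "y \<in> J" for x y
    proof -
      obtain a q a' q' where "a \<in> carrier R" "q \<in> Q" "a' \<in> carrier R" "q' \<in> Q"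
        "x = u * a + q" "y = u * a' + q'" using xy by (auto simp: J_def)
      then show ?thesis unfolding J_def
        by (intro CollectI exI[of _ "a + a'"] exI[of _ "q + q'"]) (auto intro: cl idD simp: algebra_simps)
    qed
    show "c * x \<in> J" if cx: "c \<in> carrier R" "x \<in> J" for c x
    proof -
      obtain a q where "a \<in> carrier R" "q \<in> Q" "x = u * a + q" using cx by (auto simp: J_def)
      then show ?thesis unfolding J_def using cx
        by (intro CollectI exI[of _ "c * a"] exI[of _ "c * q"]) (auto intro: cl idD simp: algebra_simps)
    qed
  qed
  moreover have "Q \<subseteq> J" using cl(6) unfolding J_def by force
  moreover have "J \<subseteq> carrier R" using u(1) idD(1) by (auto simp: J_def simp del: ring_of_integers_simps intro!: cl)
  moreover have "u \<in> J" unfolding J_def using cl(7) idD(2)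
    by (intro CollectI exI[of _ 1] exI[of _ 0]) auto
  ultimately have "J = carrier R"
    using maximalideal.I_maximal[OF Q, folded R_def, of J] u(2) by auto
  then have "1 \<in> J" using cl(7) by simp
  then obtain a q where a: "a \<in> carrier R" "q \<in> Q" "1 = u * a + q" by (auto simp: J_def)
  have "u * a - 1 = - q" using a(3) by (simp add: algebra_simps)
  then have "u * a - 1 \<in> Q" using idD(6)[OF a(2)] by simp
  then show ?thesis using that a(1) by (simp add: R_def)
qed

section \<open>Powers of a prime ideal\<close>

lemma prime_bezout:
  fixes l c :: int
  assumes "Factorial_Ring.prime l" "\<not> l dvd c"
  obtains u v where "u * c + v * l = 1" "(of_int u * of_int c + of_int v * of_int l :: complex) = 1"
proof -
  have "Rings.coprime l c" using assms by (simp add: prime_imp_coprime)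
  then have "gcd c l = 1" by (metis coprime_imp_gcd_eq_1 gcd.commute)
  moreover obtain u v where "u * c + v * l = gcd c l" using bezout_int[of c l] by blast
  ultimately have uv: "u * c + v * l = 1" by simp
  then have "of_int (u * c + v * l) = (1 :: complex)" by (simp only: of_int_1)
  then show ?thesis by (intro that[OF uv]) (simp only: of_int_add of_int_mult)
qed

lemma sum_in_additively_closed:
  assumes "0 \<in> J" "\<And>x y. x \<in> J \<Longrightarrow> y \<in> J \<Longrightarrow> x + y \<in> J" "\<And>i. i \<in> A \<Longrightarrow> f i \<in> J"
  shows "sum f A \<in> J"
  using assms(3) by (induction A rule: infinite_finite_induct) (auto intro: assms(1,2))

lemma ideal_power_simps:
  "ideal_power R I 0 = carrier R" "ideal_power R I (Suc n) = ideal_prod R I (ideal_power R I n)"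
  by (simp_all add: ideal_power_def)

lemma ideal_ideal_power:
  assumes "cring R" "ideal I R"
  shows "ideal (ideal_power R I n) R"
proof -
  interpret cring R by fact
  show ?thesis
    by (induction n) (auto simp: ideal_power_simps oneideal intro: ideal_prod_is_ideal assms)
qed

lemma ideal_power_antimono:
  assumes "cring R" "ideal I R" "m \<le> n"
  shows "ideal_power R I n \<subseteq> ideal_power R I m"
  using assms(3)
proof (induction n rule: dec_induct)
  case (step k)
  interpret cring R by fact
  have "ideal_power R I (Suc k) \<subseteq> ideal_power R I k"
    using ideal_prod_inter[OF assms(2) ideal_ideal_power[OF assms(1,2)]] by (auto simp: ideal_power_simps)
  then show ?case using step by blast
qed simp

text \<open>Nakayama's lemma for \<open>I = Q I\<close>, localised at \<open>Q\<close>: generators are eliminated one at a time, at the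
  cost of enlarging the multiplier \<open>s\<close>.\<close>

lemma zero_if_ideal_prod_absorbs:
  fixes g :: "nat \<Rightarrow> complex"
  assumes L: "subfield L complex_field" and Q: "maximalideal Q (ring_of_integers L)"
    and I: "ideal I (ring_of_integers L)" and absorb: "I \<subseteq> ideal_prod (ring_of_integers L) Q I"
    and g: "\<And>i. i < k \<Longrightarrow> g i \<in> I"
    and s: "s \<in> \<O> L" "s \<notin> Q"
    and gen: "\<And>x. x \<in> I \<Longrightarrow> \<exists>a. (\<forall>i<k. a i \<in> \<O> L) \<and> s * x = (\<Sum>i<k. a i * g i)"
  shows "I \<subseteq> {0}"
  using g s gen
proof (induction k arbitrary: s)
  case 0
  define R where "R = ring_of_integers L"
  have idQ: "ideal Q R" using Q by (simp add: R_def maximalideal_def)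
  have "s \<noteq> 0" using 0 ideal_ring_of_integersD(2)[OF L idQ[unfolded R_def]] by auto
  then show ?case using 0(4) by auto
next
  case (Suc k)
  define R where "R = ring_of_integers L"
  note cl = ring_of_integers_closed[OF L, folded R_def]
  have idQ: "ideal Q R" using Q by (simp add: R_def maximalideal_def)
  note QD = ideal_ring_of_integersD[OF L, folded R_def, OF idQ]
  interpret R: cring R unfolding R_def by (rule cring_ring_of_integers[OF L])
  have prime: "primeideal Q R" using R.maximalideal_prime Q by (simp add: R_def)
  note s = Suc.prems(2,3)[folded R_def]
  note gen = Suc.prems(4)[folded R_def]
  have *: "\<exists>q. (\<forall>i<Suc k. q i \<in> Q) \<and> s * x = (\<Sum>i<Suc k. q i * g i)" if "x \<in> ideal_prod R Q I" for x
    using that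
  proof (induction rule: ideal_prod.induct)
    case (prod i j)
    obtain a where a: "\<forall>i<Suc k. a i \<in> carrier R" "s * j = (\<Sum>i<Suc k. a i * g i)"
      using gen[OF prod(2)] by blast
    have "s * (i * j) = (\<Sum>l<Suc k. (i * a l) * g l)"
      using a(2) by (simp add: sum_distrib_left algebra_simps del: sum.lessThan_Suc)
    then show ?case using a(1) QD(5) prod(1) by (intro exI[of _ "\<lambda>l. i * a l"]) (simp add: R_def)
  next
    case (sum u v)
    obtain p where p: "\<forall>i<Suc k. p i \<in> Q" "s * u = (\<Sum>i<Suc k. p i * g i)"
      using sum.IH(1) by blast
    obtain q where q: "\<forall>i<Suc k. q i \<in> Q" "s * v = (\<Sum>i<Suc k. q i * g i)"
      using sum.IH(2) by blast
    have "s * (u + v) = (\<Sum>l<Suc k. (p l + q l) * g l)"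
      using p(2) q(2) by (simp add: sum.distrib distrib_right distrib_left del: sum.lessThan_Suc)
    then show ?case using p(1) q(1) QD(3) by (intro exI[of _ "\<lambda>l. p l + q l"]) (simp add: R_def)
  qed
  obtain q where q: "\<forall>i<Suc k. q i \<in> Q" "s * g k = (\<Sum>i<Suc k. q i * g i)"
    using *[of "g k"] absorb Suc.prems(1)[of k] by (auto simp: R_def)
  \<comment> \<open>Moving the term with \<open>g k\<close> to the left leaves the multiplier
    \<open>t\<close>, which stays outside \<open>Q\<close> because \<open>q k\<close> lies in
    \<open>Q\<close>. Multiplying by \<open>t\<close> therefore replaces \<open>g k\<close> by the
    remaining generators.\<close>
  define t where "t = s - q k"
  have t: "t \<in> carrier R" unfolding t_def using s(1) q(1) QD(1) by (intro cl) auto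
  have "t \<notin> Q"
  proof
    assume "t \<in> Q"
    then have "t + q k \<in> Q" using q(1) QD(3) by auto
    then show False using s(2) by (simp add: t_def)
  qed
  have tg: "t * g k = (\<Sum>i<k. q i * g i)" using q(2) by (simp add: t_def algebra_simps)
  show ?case
  proof (rule Suc.IH[of "s * t"])
    show "\<And>i. i < k \<Longrightarrow> g i \<in> I" using Suc.prems(1) by simp
    show "s * t \<in> \<O> L" using cl(2)[OF s(1) t] by (simp add: R_def)
    show "s * t \<notin> Q"
      using primeideal.I_prime[OF prime s(1) t] s(2) \<open>t \<notin> Q\<close> by (auto simp: R_def)
    fix x assume "x \<in> I"
    then obtain a where a: "\<forall>i<Suc k. a i \<in> carrier R" "s * x = (\<Sum>i<Suc k. a i * g i)"
      using gen by blast
    have "s * t * x = t * (\<Sum>i<Suc k. a i * g i)" using a(2) by simp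
    also have "\<dots> = t * (\<Sum>i<k. a i * g i) + a k * (t * g k)" by (simp add: algebra_simps)
    also have "\<dots> = (\<Sum>i<k. (t * a i + a k * q i) * g i)"
      unfolding tg by (simp add: sum_distrib_left sum.distrib algebra_simps)
    finally have e: "s * t * x = (\<Sum>i<k. (t * a i + a k * q i) * g i)" .
    have "\<forall>i<k. t * a i + a k * q i \<in> carrier R"
      using a(1) t q(1) QD(1) by (auto simp del: ring_of_integers_simps intro!: cl(1,2))
    then show "\<exists>a. (\<forall>i<k. a i \<in> \<O> L) \<and> s * t * x = (\<Sum>i<k. a i * g i)"
      unfolding R_def by (intro exI[of _ "\<lambda>i. t * a i + a k * q i"] conjI e)
  qed
qed

text \<open>Keeps the set in \<^const>\<open>ramification_index\<close> finite, so that its \<^const>\<open>Max\<close> is meaningful.\<close>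

lemma prime_not_in_high_ideal_power:
  fixes l :: int
  assumes L: "subfield L complex_field" and fd: "CF.finite_dimension \<rat> L"
    and Q: "maximalideal Q (ring_of_integers L)"
    and l: "Factorial_Ring.prime l"
  obtains e where "of_int l \<notin> ideal_power (ring_of_integers L) Q e"
proof (rule ccontr)
  define R where "R = ring_of_integers L"
  note cl = ring_of_integers_closed[OF L, folded R_def]
  have R: "cring R" unfolding R_def by (rule cring_ring_of_integers[OF L])
  interpret R: cring R by (rule R)
  have idQ: "ideal Q R" using Q by (simp add: R_def maximalideal_def)
  note QD = ideal_ring_of_integersD[OF L, folded R_def, OF idQ]
  define J where "J = ideal_power R Q"
  have idJ: "ideal (J e) R" for e unfolding J_def by (rule ideal_ideal_power[OF R idQ])
  note JD = ideal_ring_of_integersD[OF L, folded R_def, OF idJ]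
  assume "\<not> thesis"
  then have lJ: "of_int l \<in> J e" for e using that by (auto simp: J_def R_def)
  obtain n where rel: "\<And>f l. (\<And>i. i < n \<Longrightarrow> f i \<in> L) \<Longrightarrow> Factorial_Ring.prime (l::int) \<Longrightarrow>
      \<exists>c::nat \<Rightarrow> int. (\<Sum>i<n. of_int (c i) * f i) = 0 \<and> (\<exists>i<n. \<not> l dvd c i)"
    using primitive_integer_relation[OF fd] by blast
  have inL: "x \<in> L" if "x \<in> J e" for x e using JD(1)[of e] that by (auto simp: R_def)
  \<comment> \<open>Since \<open>l\<close> lies in \<open>J e\<close> by assumption, an integer
    prime to \<open>l\<close> acts invertibly modulo \<open>J e\<close>.\<close>
  have unit: "x \<in> J e" if x: "x \<in> carrier R" and c: "of_int c * x \<in> J e" "\<not> l dvd c" for c x e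
  proof -
    obtain u v where "(of_int u * of_int c + of_int v * of_int l :: complex) = 1"
      using prime_bezout[OF l c(2)] by metis
    then have "x = (of_int u * of_int c + of_int v * of_int l) * x" by (simp only: mult_1_left)
    also have "\<dots> = of_int u * (of_int c * x) + (of_int v * x) * of_int l"
      by (simp add: algebra_simps)
    also have "\<dots> \<in> J e"
      by (rule JD(3)[OF JD(4)[OF cl(5) c(1)] JD(4)[OF cl(2)[OF cl(5) x] lJ]])
    finally show ?thesis .
  qed
  \<comment> \<open>The powers of \<open>Q\<close> cannot keep shrinking: witnesses of
    \<open>n\<close> strict inclusions would satisfy a primitive integer relation.\<close>
  have "\<exists>m. J m \<subseteq> J (Suc m)"
  proof (rule ccontr)
    assume "\<not> ?thesis"
    then have "\<forall>m. \<exists>x. x \<in> J m \<and> x \<notin> J (Suc m)" by blast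
    then obtain x where x: "\<And>m. x m \<in> J m" "\<And>m. x m \<notin> J (Suc m)" by metis
    obtain c where c: "(\<Sum>i<n. of_int (c i) * x i) = 0" "\<exists>i<n. \<not> l dvd c i"
      using rel[of x, OF inL[OF x(1)] l] by blast
    \<comment> \<open>The first index whose coefficient is prime to \<open>l\<close>. Earlier terms
      lie in \<open>J (Suc e)\<close> because they are multiples of \<open>l\<close>, later ones
      because their witnesses lie in higher powers; so the term at \<open>e\<close> lies there too,
      and its coefficient can be removed.\<close>
    define e where "e = (LEAST i. i < n \<and> \<not> l dvd c i)"
    have e: "e < n" "\<not> l dvd c e" using LeastI_ex[OF c(2)] by (auto simp: e_def)
    have e_min: "l dvd c i" if "i < e" for i
      using not_less_Least[OF that[unfolded e_def]] that e(1) by auto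
    have "of_int (c i) * x i \<in> J (Suc e)" if i: "i < n" "i \<noteq> e" for i
    proof (cases "i < e")
      case True
      then obtain k where "c i = l * k" using e_min by (auto simp: dvd_def)
      moreover have "of_int l * (of_int k * x i) \<in> J (Suc e)"
        by (rule JD(5)[OF cl(2)[OF cl(5) subsetD[OF JD(1) x(1)]] lJ])
      ultimately show ?thesis by (simp only: of_int_mult mult.assoc)
    next
      case False
      then have "J i \<subseteq> J (Suc e)" using i(2) ideal_power_antimono[OF R idQ, of "Suc e" i] by (simp add: J_def)
      then show ?thesis by (rule JD(4)[OF cl(5) subsetD[OF _ x(1)]])
    qed
    then have "(\<Sum>i\<in>{..<n} - {e}. of_int (c i) * x i) \<in> J (Suc e)"
      using JD(2,3) by (intro sum_in_additively_closed) auto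
    moreover have "of_int (c e) * x e = - (\<Sum>i\<in>{..<n} - {e}. of_int (c i) * x i)"
      using c(1) e(1) by (simp add: sum.remove[of "{..<n}" e] eq_neg_iff_add_eq_0)
    ultimately have "of_int (c e) * x e \<in> J (Suc e)" using JD(6) by simp
    then show False using unit[of "x e" "c e" "Suc e"] x[of e] JD(1) e(2) by auto
  qed
  then obtain m where m: "J m \<subseteq> J (Suc m)" by blast
  define I where "I = J m"
  have absorb: "I \<subseteq> ideal_prod R Q I" using m by (simp add: I_def J_def ideal_power_simps)
  \<comment> \<open>Linear independence modulo \<open>l\<close> times the full ring of integers, for
    elements of \<open>I\<close>. Taking \<open>h = 0\<close> in the condition bounds the length of
    such a family, so a longest one exists.\<close>
  define indep where "indep = (\<lambda>(k::nat) g. (\<forall>i<k. g i \<in> I) \<and>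
    (\<forall>c h. h \<in> L \<longrightarrow> algebraic_int h \<longrightarrow> (\<Sum>i<k. of_int (c i) * g i) = of_int l * h \<longrightarrow> (\<forall>i<k. l dvd c i)))"
  have bound: "k < n" if kg: "indep k g" for k g
  proof (rule ccontr)
    assume "\<not> k < n"
    have gL: "g i \<in> L" if "i < n" for i
      using kg inL[of "g i" m] that \<open>\<not> k < n\<close> by (auto simp: indep_def I_def)
    obtain c where c: "(\<Sum>i<n. of_int (c i) * g i) = 0" "\<exists>i<n. \<not> l dvd c i"
      using rel[of g, OF gL l] by blast
    define c' where "c' = (\<lambda>i. if i < n then c i else 0)"
    have "(\<Sum>i<k. of_int (c' i) * g i) = (\<Sum>i<n. of_int (c' i) * g i)"
      using \<open>\<not> k < n\<close> by (intro sum.mono_neutral_right) (auto simp: c'_def)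
    also have "\<dots> = of_int l * 0" using c(1) by (simp add: c'_def)
    finally have "\<forall>i<k. l dvd c' i" using kg subfield_complexD(1)[OF L] unfolding indep_def by blast
    then have "l dvd c i" if "i < n" for i using that \<open>\<not> k < n\<close> by (auto simp: c'_def dest: spec[of _ i])
    then show False using c(2) by blast
  qed
  define k where "k = (GREATEST k. \<exists>g. indep k g)"
  have ex0: "\<exists>g. indep 0 g" by (auto simp: indep_def)
  have le: "\<And>k. \<exists>g. indep k g \<Longrightarrow> k \<le> n" using bound by (meson less_imp_le)
  have k: "\<exists>g. indep k g"
    unfolding k_def by (rule GreatestI_nat[where P = "\<lambda>k. \<exists>g. indep k g", OF ex0 le])
  have k_max: "j \<le> k" if "\<exists>g. indep j g" for j
    unfolding k_def by (rule Greatest_le_nat[where P = "\<lambda>k. \<exists>g. indep k g", OF that le])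
  from k obtain g where g: "indep k g" by blast
  \<comment> \<open>A longest family need not generate \<open>I\<close> by itself, as the relations
    hold only modulo multiples of \<open>l\<close>; adjoining \<open>l\<close>, itself an element of
    \<open>I\<close>, absorbs these. The relation for \<open>x\<close> has a coefficient prime to
    \<open>l\<close> at \<open>x\<close>, so Bezout solves it for \<open>x\<close>.\<close>
  define g' where "g' = g(k := of_int l)"
  have "I \<subseteq> {0}"
  proof (rule zero_if_ideal_prod_absorbs[OF L Q, of I "Suc k" g' 1])
    show "ideal I (ring_of_integers L)" using idJ by (simp add: I_def R_def)
    show "I \<subseteq> ideal_prod (ring_of_integers L) Q I" using absorb by (simp add: R_def)
    show "g' i \<in> I" if "i < Suc k" for i using that g lJ by (auto simp: g'_def indep_def I_def less_Suc_eq)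
    show "1 \<in> \<O> L" using cl(7) by (simp add: R_def)
    show "1 \<notin> Q"
    proof
      assume "1 \<in> Q"
      then have "a \<in> Q" if "a \<in> carrier R" for a using QD(4)[OF that, of 1] by simp
      then show False using maximalideal.I_notcarr[OF Q] QD(1) by (auto simp: R_def)
    qed
    fix x assume x: "x \<in> I"
    define gx where "gx = g(k := x)"
    have "\<not> indep (Suc k) gx" using k_max[of "Suc k"] by auto
    moreover have "\<forall>i<Suc k. gx i \<in> I" using g x by (auto simp: gx_def indep_def less_Suc_eq)
    ultimately obtain c h where ch: "h \<in> L" "algebraic_int h"
      "(\<Sum>i<Suc k. of_int (c i) * gx i) = of_int l * h" "\<not> (\<forall>i<Suc k. l dvd c i)"
      unfolding indep_def by blast
    have sg: "(\<Sum>i<k. of_int (c i) * gx i) = (\<Sum>i<k. of_int (c i) * g i)"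
      by (intro sum.cong) (auto simp: gx_def)
    have eq: "(\<Sum>i<k. of_int (c i) * g i) + of_int (c k) * x = of_int l * h"
      using ch(3) sg by (simp add: gx_def)
    have "x \<in> L" "algebraic_int x" using x JD(1)[of m] by (auto simp: I_def R_def)
    have "\<not> l dvd c k"
    proof
      assume "l dvd c k"
      then obtain q where "c k = l * q" ..
      then have "(\<Sum>i<k. of_int (c i) * g i) = of_int l * (h - of_int q * x)"
        using eq by (simp add: algebra_simps)
      moreover have "h - of_int q * x \<in> carrier R"
        using ch(1,2) \<open>x \<in> L\<close> \<open>algebraic_int x\<close> by (intro cl) (auto simp: R_def)
      ultimately have "\<forall>i<k. l dvd c i" using g unfolding indep_def by (auto simp: R_def)
      then show False using ch(4) \<open>l dvd c k\<close> by (auto simp: less_Suc_eq)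
    qed
    then obtain u v where uv: "(of_int u * of_int (c k) + of_int v * of_int l :: complex) = 1"
      using prime_bezout[OF l] by metis
    define a where "a = (\<lambda>i. if i < k then - of_int (u * c i) else of_int u * h + of_int v * x)"
    have "x = (of_int u * of_int (c k) + of_int v * of_int l) * x" using uv by (simp only: mult_1_left)
    also have "\<dots> = of_int u * (of_int (c k) * x) + of_int v * of_int l * x"
      by (simp add: algebra_simps)
    also have "of_int (c k) * x = of_int l * h - (\<Sum>i<k. of_int (c i) * g i)"
      using eq by (simp add: algebra_simps)
    finally have "x = (\<Sum>i<k. - of_int (u * c i) * g i) + (of_int u * h + of_int v * x) * of_int l"
      by (simp add: algebra_simps sum_distrib_left sum_negf)
    also have "\<dots> = (\<Sum>i<Suc k. a i * g' i)" by (simp add: a_def g'_def)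
    finally have "1 * x = (\<Sum>i<Suc k. a i * g' i)" by simp
    moreover have "\<forall>i<Suc k. a i \<in> carrier R"
      using ch(1,2) \<open>x \<in> L\<close> \<open>algebraic_int x\<close> unfolding a_def
      by (auto simp del: ring_of_integers_simps intro!: cl(1-5)) (auto simp: R_def)
    ultimately show "\<exists>a. (\<forall>i<Suc k. a i \<in> \<O> L) \<and> 1 * x = (\<Sum>i<Suc k. a i * g' i)"
      by (auto simp: R_def simp del: ring_of_integers_simps)
  qed
  then show False using lJ[of m] l by (auto simp: I_def)
qed

section \<open>Ramification index and residue degree one\<close>

text \<open>The assumption \<open>unif\<close> says that \<open>w\<close> generates the prime below \<open>Q\<close> locally.\<close>

lemma unramified_no_odd_valuation:
  fixes l :: int
  assumes L: "subfield L complex_field" and fd: "CF.finite_dimension \<rat> L" and K: "subfield K complex_field"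
    and Q: "maximalideal Q (ring_of_integers L)"
    and l: "Factorial_Ring.prime l" "of_int l \<in> Q"
    and unram: "ramification_index K L Q = 1"
    and w: "w \<in> Q"
    and unif: "\<And>x. x \<in> prime_below K Q \<Longrightarrow>
      \<exists>t z. t \<in> \<O> L \<and> t \<notin> Q \<and> z \<in> \<O> L \<and> t * x = z * w"
    and u: "u1 \<in> \<O> L" "u1 \<notin> Q" "u2 \<in> \<O> L" "u2 \<notin> Q"
    and delta: "\<delta> \<in> L" "u1 * \<delta>\<^sup>2 = u2 * w"
  shows False
proof -
  define R where "R = ring_of_integers L"
  note cl = ring_of_integers_closed[OF L, folded R_def]
  have R: "cring R" unfolding R_def by (rule cring_ring_of_integers[OF L])
  interpret R: cring R by (rule R)
  have idQ: "ideal Q R" using Q by (simp add: R_def maximalideal_def)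
  note QD = ideal_ring_of_integersD[OF L, folded R_def, OF idQ]
  have prime: "primeideal Q R" using R.maximalideal_prime Q by (simp add: R_def)
  note u = u[folded R_def]
  define Q2 where "Q2 = ideal_power R Q 2"
  have idQ2: "ideal Q2 R" unfolding Q2_def by (rule ideal_ideal_power[OF R idQ])
  note Q2D = ideal_ring_of_integersD[OF L, folded R_def, OF idQ2]
  have Q2: "x * y \<in> Q2" if xy: "x \<in> Q" "y \<in> Q" for x y
  proof -
    have "y * 1 \<in> ideal_prod R Q (carrier R)"
      using ideal_prod.prod[OF xy(2) cl(7), of R] by (simp add: R_def)
    from ideal_prod.prod[OF xy(1) this, of R] show ?thesis
      by (simp add: Q2_def numeral_2_eq_2 ideal_power_simps R_def)
  qed
  \<comment> \<open>Elements outside \<open>Q\<close> can be cancelled modulo \<open>Q2\<close>: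
    with \<open>v\<close> inverse to \<open>t\<close> modulo \<open>Q\<close>, the element
    \<open>x\<close> is \<open>v * (t * x)\<close> minus \<open>(t * v - 1) * x\<close>, and the
    latter is a product of two elements of \<open>Q\<close>.\<close>
  have inQ2: "x \<in> Q2" if x: "x \<in> Q" "t \<in> carrier R" "t \<notin> Q" "t * x \<in> Q2" for t x
  proof -
    obtain v where v: "v \<in> carrier R" "t * v - 1 \<in> Q"
      using maximalideal_inverse_mod[OF L Q, of t] x(2,3) by (auto simp: R_def simp del: ring_of_integers_simps)
    have "v * (t * x) - (t * v - 1) * x \<in> Q2"
      using Q2D(4)[OF v(1) x(4)] Q2[OF v(2) x(1)] by (rule Q2D(7))
    then show ?thesis by (simp add: algebra_simps)
  qed
  \<comment> \<open>Scaling by \<open>u1\<close> makes the square equal to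
    \<open>u1 * u2 * w\<close>, which is integral even when \<open>\<delta>\<close> is not. Hence
    \<open>\<eta>\<close> lies in the ring of integers, and then in \<open>Q\<close>.\<close>
  define \<eta> where "\<eta> = u1 * \<delta>"
  have "\<eta>\<^sup>2 = u1 * (u1 * \<delta>\<^sup>2)" by (simp add: \<eta>_def power2_eq_square)
  then have sq: "\<eta>\<^sup>2 = (u1 * u2) * w" by (simp only: delta(2) mult.assoc)
  have w': "w \<in> carrier R" using w QD(1) by blast
  have "(u1 * u2) * w \<in> carrier R" using u(1,3) w' by (intro cl)
  then have "algebraic_int (\<eta>\<^sup>2)" by (simp add: sq R_def)
  then have "\<eta> \<in> carrier R"
    using algebraic_int_sqrt_of_square delta(1) u(1) subfield_complexD(4)[OF L] by (auto simp: \<eta>_def R_def)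
  moreover have "\<eta> * \<eta> \<in> Q"
    using QD(4)[OF cl(2)[OF u(1,3)] w] sq by (simp add: power2_eq_square)
  ultimately have eta: "\<eta> \<in> Q" using primeideal.I_prime[OF prime, of \<eta> \<eta>] by (auto simp: R_def)
  have "u1 * u2 \<notin> Q" using primeideal.I_prime[OF prime u(1,3)] u(2,4) by (auto simp: R_def)
  moreover have "(u1 * u2) * w \<in> Q2" using Q2[OF eta eta] sq by (simp add: power2_eq_square)
  ultimately have w2: "w \<in> Q2" using inQ2[OF w cl(2)[OF u(1,3)]] by blast
  have P2: "prime_below K Q \<subseteq> Q2"
  proof
    fix x assume x: "x \<in> prime_below K Q"
    then obtain t z where "t \<in> carrier R" "t \<notin> Q" "z \<in> carrier R" "t * x = z * w"
      using unif[folded R_def] by blast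
    moreover have "x \<in> Q" using x by (simp add: prime_below_def)
    ultimately show "x \<in> Q2" using inQ2[of x t] Q2D(4)[OF _ w2] by simp
  qed
  \<comment> \<open>The prime below \<open>Q\<close> contains \<open>l\<close>, and \<open>l\<close>
    is missing from some power of \<open>Q\<close>; so \<open>E\<close> is bounded and its maximum
    is at least 2.\<close>
  define E where "E = {e. genideal R (prime_below K Q) \<subseteq> ideal_power R Q e}"
  have "2 \<in> E" unfolding E_def using R.genideal_minimal[OF idQ2 P2] by (simp add: Q2_def)
  moreover obtain e0 where e0: "of_int l \<notin> ideal_power R Q e0"
    using prime_not_in_high_ideal_power[OF L fd Q l(1)] by (auto simp: R_def)
  have "e < e0" if "e \<in> E" for e
  proof (rule ccontr)
    assume "\<not> e < e0"
    then have "ideal_power R Q e \<subseteq> ideal_power R Q e0" by (intro ideal_power_antimono R idQ) auto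
    moreover have "prime_below K Q \<subseteq> genideal R (prime_below K Q)"
      using QD(1) by (intro R.genideal_self) (auto simp: prime_below_def simp del: ring_of_integers_simps)
    moreover have "of_int l \<in> prime_below K Q"
      using l(2) ring_of_integers_closed(5)[OF K] by (simp add: prime_below_def del: ring_of_integers_simps)
    ultimately show False using that e0 by (auto simp: E_def)
  qed
  then have "finite E" by (auto intro: finite_subset[of _ "{..<e0}"])
  ultimately have "2 \<le> Max E" by (intro Max_ge)
  then show False using unram by (simp add: ramification_index_def E_def R_def)
qed

text \<open>The subfield over which the dimension is taken is the image of the ordinary integers,
  because these are the algebraic integers in \<rat>. Dimension one then makes this image the whole
  residue field, so every class has an integer representative.\<close>

lemma residue_degree_one_int:
  fixes l :: int
  assumes L: "subfield L complex_field" and fd: "CF.finite_dimension \<rat> L"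
    and Q: "maximalideal Q (ring_of_integers L)"
    and l: "Factorial_Ring.prime l" "of_int l \<in> Q"
    and deg: "residue_degree \<rat> L Q = 1"
    and x: "x \<in> \<O> L"
  obtains k :: int where "x - of_int k \<in> Q"
proof -
  define R where "R = ring_of_integers L"
  note cl = ring_of_integers_closed[OF L, folded R_def]
  have R: "cring R" unfolding R_def by (rule cring_ring_of_integers[OF L])
  interpret R: cring R by (rule R)
  have idQ: "ideal Q R" using Q by (simp add: R_def maximalideal_def)
  note QD = ideal_ring_of_integersD[OF L, folded R_def, OF idQ]
  define F where "F = R Quot Q"
  define h where "h = (\<lambda>x. Q +>\<^bsub>R\<^esub> x)"
  have fieldF: "field F" unfolding F_def using maximalideal.quotient_is_field[of Q R] Q R by (simp add: R_def)
  have cringF: "cring F" using fieldF by (simp add: field_def domain_def)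
  interpret F: cring F by (rule cringF)
  have hom: "ring_hom_ring R F h"
    unfolding F_def h_def using ideal.rcos_ring_hom_ring[OF idQ] by simp
  interpret h: ring_hom_ring R F h by (rule hom)
  have one_notin: "1 \<notin> Q"
  proof
    assume "1 \<in> Q"
    then have "a \<in> Q" if "a \<in> carrier R" for a using QD(4)[OF that, of 1] by simp
    then show False using maximalideal.I_notcarr[OF Q] QD(1) by (auto simp: R_def)
  qed
  have Rsimps: "mult R a b = a * b" "add R a b = a + b" "one R = 1" "ring.zero R = 0" for a b
    by (simp_all add: R_def)
  have Rinv: "a_inv R b = - b" if "b \<in> carrier R" for b
    using R.r_neg[OF that] by (simp add: Rsimps add_eq_0_iff)
  have h_eq: "h a = h b \<longleftrightarrow> a - b \<in> Q" if "a \<in> carrier R" "b \<in> carrier R" for a b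
    using R.quotient_eq_iff_same_a_r_cos[OF idQ that] that
    by (simp add: h_def a_minus_def Rsimps Rinv)
  have h_zero: "h 0 = \<zero>\<^bsub>F\<^esub>" and h_one: "h 1 = \<one>\<^bsub>F\<^esub>"
    using h.hom_zero h.hom_one by (simp_all add: Rsimps)
  have h_add: "h (a + b) = h a \<oplus>\<^bsub>F\<^esub> h b" and h_mult: "h (a * b) = h a \<otimes>\<^bsub>F\<^esub> h b"
    if "a \<in> carrier R" "b \<in> carrier R" for a b
    using h.hom_add[OF that] h.hom_mult[OF that] by (simp_all add: Rsimps)
  have carF: "carrier F = h ` carrier R"
    by (auto simp: F_def FactRing_def A_RCOSETS_def' h_def)
  define Z where "Z = \<O> \<rat>"
  have Z: "Z = range of_int"
    using rational_algebraic_int_is_int by (auto simp: Z_def Ints_def algebraic_int_of_int_complex)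
  define K where "K = h ` Z"
  have K: "K = range (\<lambda>n::int. h (of_int n))" by (auto simp: K_def Z)
  have memK: "h (of_int n) \<in> K" for n by (auto simp: K)
  \<comment> \<open>The integers meet \<open>Q\<close> exactly in the multiples of \<open>l\<close>,
    so the image \<open>K\<close> of the integers is the field with \<open>l\<close>
    elements.\<close>
  have hint: "h (of_int n) = \<zero>\<^bsub>F\<^esub> \<longleftrightarrow> l dvd n" for n
  proof
    assume "l dvd n"
    then obtain k where "n = l * k" ..
    then have "of_int n - 0 \<in> Q" using QD(5)[OF cl(5)[of k] l(2)] by (simp add: mult.commute)
    then show "h (of_int n) = \<zero>\<^bsub>F\<^esub>" using h_eq[OF cl(5,6)] h_zero by simp
  next
    assume "h (of_int n) = \<zero>\<^bsub>F\<^esub>"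
    then have nQ: "of_int n \<in> Q" using h_eq[OF cl(5,6), of n] h_zero by simp
    show "l dvd n"
    proof (rule ccontr)
      assume "\<not> l dvd n"
      then obtain a b where ab: "(of_int a * of_int n + of_int b * of_int l :: complex) = 1"
        using prime_bezout[OF l(1)] by metis
      have "of_int a * of_int n + of_int b * of_int l \<in> Q"
        by (rule QD(3)[OF QD(4)[OF cl(5) nQ] QD(4)[OF cl(5) l(2)]])
      then show False using one_notin ab by (simp only:)
    qed
  qed
  have subK: "subfield K F"
  proof (rule field.subfieldI'[OF fieldF])
    show "subring K F"
    proof (rule F.subringI)
      show "K \<subseteq> carrier F" using cl(5) by (auto simp: K carF)
      show "\<one>\<^bsub>F\<^esub> \<in> K" using memK[of 1] h_one by (simp only: of_int_1)
      show "\<ominus>\<^bsub>F\<^esub> a \<in> K" if aK: "a \<in> K" for a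
      proof -
        obtain n where n: "a = h (of_int n)" using aK by (auto simp: K)
        have "\<ominus>\<^bsub>F\<^esub> a = h (\<ominus>\<^bsub>R\<^esub> (of_int n))" using h.hom_a_inv[OF cl(5)[of n]] by (simp add: n)
        also have "\<dots> = h (of_int (- n))" using Rinv[OF cl(5)[of n]] by simp
        finally show ?thesis using memK[of "- n"] by (simp only:)
      qed
      show "a \<otimes>\<^bsub>F\<^esub> b \<in> K" "a \<oplus>\<^bsub>F\<^esub> b \<in> K" if ab: "a \<in> K" "b \<in> K" for a b
      proof -
        obtain m n where mn: "a = h (of_int m)" "b = h (of_int n)" using ab by (auto simp: K)
        have "a \<otimes>\<^bsub>F\<^esub> b = h (of_int (m * n))" "a \<oplus>\<^bsub>F\<^esub> b = h (of_int (m + n))"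
          using h_add[OF cl(5,5), of m n] h_mult[OF cl(5,5), of m n] by (simp_all add: mn)
        then show "a \<otimes>\<^bsub>F\<^esub> b \<in> K" "a \<oplus>\<^bsub>F\<^esub> b \<in> K" using memK[of "m * n"] memK[of "m + n"] by (simp_all only:)
      qed
    qed
    show "inv\<^bsub>F\<^esub> a \<in> K" if a: "a \<in> K - {\<zero>\<^bsub>F\<^esub>}" for a
    proof -
      obtain n where n: "a = h (of_int n)" "\<not> l dvd n" using a hint by (auto simp: K)
      obtain u v where uv: "(of_int u * of_int n + of_int v * of_int l :: complex) = 1"
        using prime_bezout[OF l(1) n(2)] by metis
      have "of_int n * of_int u - 1 = of_int (- v) * (of_int l :: complex)"
        using uv by (simp add: algebra_simps eq_neg_iff_add_eq_0)
      then have "of_int n * of_int u - 1 \<in> Q" using QD(4)[OF cl(5) l(2)] by (simp only:)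
      then have "h (of_int n * of_int u) = h 1" using h_eq[OF cl(2)[OF cl(5,5)] cl(7)] by blast
      then have "h (of_int n) \<otimes>\<^bsub>F\<^esub> h (of_int u) = \<one>\<^bsub>F\<^esub>"
        using h_mult[OF cl(5,5), of n u] h_one by simp
      moreover have "h (of_int n) \<in> carrier F" "h (of_int u) \<in> carrier F" using cl(5) by (auto simp: carF)
      ultimately have "inv\<^bsub>F\<^esub> a = h (of_int u)" unfolding n(1) by (intro F.comm_inv_char)
      then show ?thesis by (auto simp: K)
    qed
  qed
  have comb: "F.combine (map (\<lambda>n. h (of_int n)) cs) (map h xs) = h (CF.combine (map of_int cs) xs)
      \<and> CF.combine (map of_int cs) xs \<in> carrier R"
    if "length cs = length xs" "set xs \<subseteq> carrier R" for cs :: "int list" and xs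
    using that
  proof (induction cs xs rule: list_induct2)
    case Nil
    then show ?case using h_zero cl(6) by simp
  next
    case (Cons c cs x xs)
    then have IH: "F.combine (map (\<lambda>n. h (of_int n)) cs) (map h xs) = h (CF.combine (map of_int cs) xs)"
      "CF.combine (map of_int cs) xs \<in> carrier R" and x: "x \<in> carrier R" by auto
    have cx: "of_int c * x \<in> carrier R" by (rule cl(2)[OF cl(5) x])
    show ?case using IH h_add[OF cx IH(2)] h_mult[OF cl(5) x, of c] cl(1)[OF cx IH(2)] by simp
  qed
  obtain n where rel: "\<And>f l. (\<And>i. i < n \<Longrightarrow> f i \<in> L) \<Longrightarrow> Factorial_Ring.prime (l::int) \<Longrightarrow>
      \<exists>c::nat \<Rightarrow> int. (\<Sum>i<n. of_int (c i) * f i) = 0 \<and> (\<exists>i<n. \<not> l dvd c i)"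
    using primitive_integer_relation[OF fd] by blast
  \<comment> \<open>No independent list has length \<open>n\<close>, so the residue field is finite-dimensional over \<open>K\<close> and
    \<^term>\<open>F.dim\<close> is not a junk value.\<close>
  have bound: "length Us \<noteq> n" if ind: "F.independent K Us" for Us
  proof
    assume len: "length Us = n"
    have "set Us \<subseteq> h ` carrier R" using F.independent_in_carrier[OF ind] by (simp add: carF)
    then have inv: "inv_into (carrier R) h u \<in> carrier R" "h (inv_into (carrier R) h u) = u" if "u \<in> set Us" for u
    proof -
      have "u \<in> h ` carrier R" using that \<open>set Us \<subseteq> h ` carrier R\<close> by blast
      then show "inv_into (carrier R) h u \<in> carrier R" "h (inv_into (carrier R) h u) = u"
        by (rule inv_into_into, rule f_inv_into_f)
    qed
    define xs where "xs = map (inv_into (carrier R) h) Us"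
    have xs: "Us = map h xs" "set xs \<subseteq> carrier R" using inv by (auto simp: xs_def map_idI)
    have lenx: "length xs = n" using xs(1) len by simp
    have "xs ! i \<in> L" if "i < n" for i
    proof -
      have "xs ! i \<in> set xs" using that lenx by simp
      then show ?thesis using xs(2) by (auto simp: R_def)
    qed
    then obtain c where c: "(\<Sum>i<n. of_int (c i) * (xs ! i)) = 0" "\<exists>i<n. \<not> l dvd c i"
      using rel[of "\<lambda>i. xs ! i" l] l(1) by blast
    define cs where "cs = map c [0..<n]"
    have lencs: "length cs = length xs" by (simp add: cs_def lenx)
    have "CF.combine (map of_int cs) xs = 0"
      using combine_eq_sum[of "map of_int cs" xs] c(1) lenx by (simp add: cs_def)
    then have "F.combine (map (\<lambda>n. h (of_int n)) cs) Us = \<zero>\<^bsub>F\<^esub>"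
      using comb[OF lencs xs(2)] h_zero xs(1) by simp
    then have "set (take (length Us) (map (\<lambda>n. h (of_int n)) cs)) \<subseteq> {\<zero>\<^bsub>F\<^esub>}"
      by (intro F.independent_imp_trivial_combine[OF subK ind]) (auto simp: K)
    then have "(\<lambda>i. h (of_int (c i))) ` {0..<n} \<subseteq> {\<zero>\<^bsub>F\<^esub>}"
      using len by (simp add: cs_def)
    then have "h (of_int (c i)) = \<zero>\<^bsub>F\<^esub>" if "i < n" for i
      using that by (simp add: image_subset_iff)
    then show False using c(2) hint by blast
  qed
  \<comment> \<open>The least length that no independent list has. It is not 0, since the empty list
    is independent; a list of length \<open>m - 1\<close> exists and must span, for otherwise it
    could be extended to length \<open>m\<close>.\<close>
  define m where "m = (LEAST k. \<not> (\<exists>Us. F.independent K Us \<and> length Us = k))"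
  have "\<not> (\<exists>Us. F.independent K Us \<and> length Us = n)" using bound by blast
  then have m: "\<not> (\<exists>Us. F.independent K Us \<and> length Us = m)"
    unfolding m_def by (rule LeastI)
  have "m \<noteq> 0" using m by (metis F.li_Nil list.size(3))
  then obtain k where k: "m = Suc k" by (cases m) auto
  then obtain Us where Us: "F.independent K Us" "length Us = k"
    using not_less_Least[of k "\<lambda>k. \<not> (\<exists>Us. F.independent K Us \<and> length Us = k)"] by (auto simp: m_def)
  have span: "F.Span K Us = carrier F"
  proof
    show "F.Span K Us \<subseteq> carrier F"
      using F.Span_in_carrier[of K Us] F.independent_in_carrier[OF Us(1)] subfieldE(3)[OF subK] by auto
    show "carrier F \<subseteq> F.Span K Us"
    proof (rule ccontr)
      assume "\<not> ?thesis"
      then obtain u where "u \<in> carrier F" "u \<notin> F.Span K Us" by blast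
      then have "F.independent K (u # Us)" using Us(1) by (intro F.li_Cons)
      then show False using m k Us(2) by (metis length_Cons)
    qed
  qed
  have dimk: "F.dimension k K (carrier F)" using F.dimensionI[OF subK Us(1) span] Us(2) by simp
  have "F.dim K (carrier F) = 1"
    using deg by (simp add: residue_degree_def F_def K_def Z_def R_def h_def Let_def del: ring_of_integers_simps)
  then have "k = 1" using F.dimI[OF subK dimk] by (simp add: over_def)
  then have dim1: "F.dimension 1 K (carrier F)" using dimk by simp
  have one0: "\<one>\<^bsub>F\<^esub> \<noteq> \<zero>\<^bsub>F\<^esub>" using h_eq[OF cl(7,6)] h_one h_zero one_notin by auto
  have "F.independent K [\<one>\<^bsub>F\<^esub>]"
    using one0 by (intro F.li_Cons) auto
  then have sp1: "F.Span K [\<one>\<^bsub>F\<^esub>] = carrier F"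
    using F.independent_length_eq_dimension[OF subK dim1, of "[\<one>\<^bsub>F\<^esub>]"] by auto
  have "h x \<in> F.Span K [\<one>\<^bsub>F\<^esub>]" unfolding sp1 using x by (simp add: carF R_def del: ring_of_integers_simps)
  then obtain Ks where Ks: "set Ks \<subseteq> K" "length Ks = length [\<one>\<^bsub>F\<^esub>]" "h x = F.combine Ks [\<one>\<^bsub>F\<^esub>]"
    using F.Span_mem_iff_length_version[OF subK, of "[\<one>\<^bsub>F\<^esub>]" "h x"] by auto
  then obtain a where a: "Ks = [a]" "a \<in> K" by (auto simp: length_Suc_conv)
  then obtain j where j: "a = h (of_int j)" by (auto simp: K)
  have "a \<in> carrier F" using a(2) cl(5) by (auto simp: K carF)
  then have "h x = h (of_int j)" using Ks(3) a(1) j by simp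
  then have "x - of_int j \<in> Q" using h_eq[of x "of_int j"] x cl(5) by (simp add: R_def del: ring_of_integers_simps)
  then show ?thesis by (rule that)
qed

section \<open>Cyclic quartic extensions\<close>

lemma subfield_quadratic_extension:
  assumes K: "subfield K complex_field" and t: "t\<^sup>2 \<in> K"
  shows "subfield {a + b * t | a b. a \<in> K \<and> b \<in> K} complex_field" (is "subfield ?M _")
proof -
  note cl = subfield_complexD[OF K]
  have mem: "a + b * t \<in> ?M" if "a \<in> K" "b \<in> K" for a b using that by blast
  show ?thesis
  proof (rule subfield_complexI)
    show "0 \<in> ?M" using mem[OF cl(1,1)] by simp
    show "1 \<in> ?M" using mem[OF cl(2,1)] by simp
    show "x + y \<in> ?M" if xy: "x \<in> ?M" "y \<in> ?M" for x y
    proof -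
      obtain a b c e where *: "x = a + b * t" "y = c + e * t" "a \<in> K" "b \<in> K" "c \<in> K" "e \<in> K"
        using xy by blast
      then have "x + y = (a + c) + (b + e) * t" by (simp add: algebra_simps)
      then show ?thesis using mem[OF cl(3)[OF *(3,5)] cl(3)[OF *(4,6)]] by (simp only:)
    qed
    show "x * y \<in> ?M" if xy: "x \<in> ?M" "y \<in> ?M" for x y
    proof -
      obtain a b c e where *: "x = a + b * t" "y = c + e * t" "a \<in> K" "b \<in> K" "c \<in> K" "e \<in> K"
        using xy by blast
      have "x * y = (a * c + b * e * t\<^sup>2) + (a * e + b * c) * t"
        by (simp add: * power2_eq_square algebra_simps)
      moreover have "a * c + b * e * t\<^sup>2 \<in> K" by (intro cl(3) cl(4) *(3-6) t)
      moreover have "a * e + b * c \<in> K" by (intro cl(3) cl(4) *(3-6))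
      ultimately show ?thesis using mem by (simp only:)
    qed
    show "- x \<in> ?M" if x: "x \<in> ?M" for x
    proof -
      obtain a b where *: "x = a + b * t" "a \<in> K" "b \<in> K" using x by blast
      then have "- x = - a + (- b) * t" by simp
      then show ?thesis using mem[OF cl(5)[OF *(2)] cl(5)[OF *(3)]] by (simp only:)
    qed
    show "inverse x \<in> ?M" if x: "x \<in> ?M" for x
    proof -
      obtain a b where *: "x = a + b * t" "a \<in> K" "b \<in> K" using x by blast
      show ?thesis
      \<comment> \<open>If \<open>t\<close> lies in \<open>K\<close>, the conjugate
        \<open>a - b * t\<close> can vanish for a nonzero \<open>x\<close>, so rationalising the
        denominator is reserved for the other case.\<close>
      proof (cases "t \<in> K")
        case True
        then have "x \<in> K" using * by (auto intro!: cl(3,4))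
        then show ?thesis using mem[OF cl(6) cl(1), of x] by simp
      next
        case False
        show ?thesis
        proof (cases "x = 0")
          case True
          then show ?thesis using mem[OF cl(1,1)] by simp
        next
          case x0: False
          define N where "N = a\<^sup>2 - b\<^sup>2 * t\<^sup>2"
          have NK: "N \<in> K" unfolding N_def using * t by (auto intro!: cl(7,4,10))
          have Nx: "N = x * (a - b * t)" by (simp add: N_def * power2_eq_square algebra_simps)
          have "a - b * t \<noteq> 0"
          proof
            assume 0: "a - b * t = 0"
            then have "b \<noteq> 0" using x0 * by auto
            then have "t = a / b" using 0 by (simp add: field_simps)
            then show False using False * cl(8) by simp
          qed
          then have "inverse x = (a - b * t) / N" unfolding Nx by (simp add: inverse_eq_divide)
          then have "inverse x = a / N + (- b / N) * t" by (simp add: diff_divide_distrib)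
          moreover have "a / N \<in> K" "- b / N \<in> K" using * NK cl by simp_all
          ultimately show ?thesis using mem by (simp only:)
        qed
      qed
    qed
  qed
qed

lemma generate_quadratic_field:
  assumes "t\<^sup>2 \<in> \<rat>"
  shows "generate_field complex_field {t} = {a + b * t | a b. a \<in> \<rat> \<and> b \<in> \<rat>}" (is "_ = ?M")
    and "subfield (generate_field complex_field {t}) complex_field"
proof -
  show S: "subfield (generate_field complex_field {t}) complex_field"
    by (rule field.generate_field_is_subfield[OF field_complex_field]) simp
  have "t \<in> generate_field complex_field {t}" by (rule generate_field.incl) simp
  then have "?M \<subseteq> generate_field complex_field {t}"
    using subfield_complexD(3,4,12)[OF S] by blast
  moreover have "t \<in> ?M"
    by (intro CollectI exI[of _ 0] exI[of _ 1]) auto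
  then have "generate_field complex_field {t} \<subseteq> ?M"
    by (intro field.generate_field_min_subfield1[OF field_complex_field]
        subfield_quadratic_extension subfield_Rats assms) auto
  ultimately show "generate_field complex_field {t} = ?M" by blast
qed

section \<open>Galois groups as groups of bijections\<close>

lemma galois_groupD:
  assumes "f \<in> carrier (galois_group K L)"
  shows "f \<in> Bij L" "\<And>x. x \<in> K \<Longrightarrow> f x = x" "\<And>x. x \<in> L \<Longrightarrow> f x \<in> L" "f 1 = 1"
    "\<And>x y. x \<in> L \<Longrightarrow> y \<in> L \<Longrightarrow> f (x + y) = f x + f y"
    "\<And>x y. x \<in> L \<Longrightarrow> y \<in> L \<Longrightarrow> f (x * y) = f x * f y"
    "inj_on f L" "f ` L = L"
  using assms by (auto simp: galois_group_def ring_hom_def Bij_def bij_betw_def)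

lemma galois_groupI:
  assumes "f \<in> Bij L" "\<And>x. x \<in> K \<Longrightarrow> f x = x" "f 1 = 1"
    "\<And>x y. x \<in> L \<Longrightarrow> y \<in> L \<Longrightarrow> f (x + y) = f x + f y"
    "\<And>x y. x \<in> L \<Longrightarrow> y \<in> L \<Longrightarrow> f (x * y) = f x * f y"
  shows "f \<in> carrier (galois_group K L)"
proof -
  have "f x \<in> L" if "x \<in> L" for x using assms(1) that by (auto simp: Bij_def bij_betw_def)
  then show ?thesis using assms by (auto simp: galois_group_def ring_hom_def)
qed

text \<open>Supplies the group structure, so that inverses in the Galois group may be computed as
  inverse bijections.\<close>

lemma subgroup_galois_group:
  assumes "subfield L complex_field" "K \<subseteq> L"
  shows "subgroup (carrier (galois_group K L)) (BijGroup L)"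
proof -
  interpret B: group "BijGroup L" by (rule group_BijGroup)
  note cl = subfield_complexD[OF assms(1)]
  show ?thesis
  proof (rule B.subgroupI)
    show "carrier (galois_group K L) \<subseteq> carrier (BijGroup L)"
      by (auto simp: galois_group_def BijGroup_def)
    have "(\<lambda>x\<in>L. x) \<in> carrier (galois_group K L)"
      using assms(2) cl by (intro galois_groupI id_Bij) auto
    then show "carrier (galois_group K L) \<noteq> {}" by blast
    show "f \<otimes>\<^bsub>BijGroup L\<^esub> g \<in> carrier (galois_group K L)"
      if f: "f \<in> carrier (galois_group K L)" and g: "g \<in> carrier (galois_group K L)" for f g
    proof -
      note F = galois_groupD[OF f] and H = galois_groupD[OF g]
      have "compose L f g \<in> carrier (galois_group K L)"
        using assms(2) cl by (intro galois_groupI compose_Bij F(1) H(1)) (auto simp: compose_def F H)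
      then show ?thesis using F(1) H(1) by (simp add: BijGroup_def)
    qed
    show "inv\<^bsub>BijGroup L\<^esub> f \<in> carrier (galois_group K L)"
      if f: "f \<in> carrier (galois_group K L)" for f
    proof -
      note F = galois_groupD[OF f]
      have r: "inv_into L f (f x) = x" if "x \<in> L" for x using F(7) that by simp
      have ex: "\<exists>u\<in>L. x = f u" if "x \<in> L" for x using F(8) that by auto
      have "(\<lambda>x\<in>L. inv_into L f x) \<in> carrier (galois_group K L)"
      proof (rule galois_groupI)
        show "restrict (inv_into L f) L \<in> Bij L" by (rule restrict_inv_into_Bij[OF F(1)])
        show "restrict (inv_into L f) L x = x" if "x \<in> K" for x
          using r[of x] F(2)[OF that] that assms(2) by auto
        show "restrict (inv_into L f) L 1 = 1" using r[of 1] F(4) cl(2) by simp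
        fix x y assume xy: "x \<in> L" "y \<in> L"
        obtain u v where uv: "u \<in> L" "v \<in> L" "x = f u" "y = f v" using ex[OF xy(1)] ex[OF xy(2)] by blast
        show "restrict (inv_into L f) L (x + y) = restrict (inv_into L f) L x + restrict (inv_into L f) L y"
          using xy uv r[of "u + v"] r[of u] r[of v] cl(3) F(5)[of u v] by simp
        show "restrict (inv_into L f) L (x * y) = restrict (inv_into L f) L x * restrict (inv_into L f) L y"
          using xy uv r[of "u * v"] r[of u] r[of v] cl(4) F(6)[of u v] by simp
      qed
      then show ?thesis using inv_BijGroup[OF F(1)] by simp
    qed
  qed
qed

text \<open>What a generator fixes is fixed by its inverse and by all products, hence by the whole
  group, whose fixed field is \<open>K\<close>.\<close>

lemma cyclic_extension_generator:
  assumes "cyclic_extension K L"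
  obtains f where "f \<in> carrier (galois_group K L)" "\<And>x. x \<in> L \<Longrightarrow> f x = x \<Longrightarrow> x \<in> K"
proof -
  have L: "subfield L complex_field" and KL: "K \<subseteq> L"
    and fixed: "{x \<in> L. \<forall>\<sigma>\<in>carrier (galois_group K L). \<sigma> x = x} = K"
    using assms by (auto simp: cyclic_extension_def galois_extension_def finite_extension_def)
  define G where "G = galois_group K L"
  have sub: "subgroup (carrier G) (BijGroup L)" unfolding G_def by (rule subgroup_galois_group[OF L KL])
  have GB: "(BijGroup L)\<lparr>carrier := carrier G\<rparr> = G" by (simp add: G_def galois_group_def)
  obtain f where f: "f \<in> carrier G" "subgroup_generated G {f} = G"
    using assms by (auto simp: cyclic_extension_def cyclic_group_def G_def)
  note F = galois_groupD[OF f(1)[unfolded G_def]]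
  have gen: "carrier G = generate G {f}"
    using carrier_subgroup_generated[of G "{f}"] f by (metis Int_insert_right_if1 inf_bot_right)
  have inv: "inv\<^bsub>G\<^esub> f = (\<lambda>x\<in>L. inv_into L f x)"
    using group.m_inv_consistent[OF group_BijGroup sub f(1)] inv_BijGroup[OF F(1)] unfolding GB by simp
  show ?thesis
  proof (rule that[of f])
    show "f \<in> carrier (galois_group K L)" using f(1) by (simp add: G_def)
    fix x assume x: "x \<in> L" "f x = x"
    have "g x = x" if "g \<in> generate G {f}" for g
      using that
    proof induction
      case one
      then show ?case using x by (simp add: G_def galois_group_def BijGroup_def)
    next
      case (incl h)
      then show ?case using x by simp
    next
      case (inv h)
      then show ?case using x \<open>inv\<^bsub>G\<^esub> f = _\<close> F(7) inv_into_f_f[of f L x] by simp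
    next
      case (eng h1 h2)
      have "h1 \<in> Bij L" "h2 \<in> Bij L"
        using eng(1,2) gen galois_groupD(1) by (auto simp: G_def)
      then show ?case using eng x by (simp add: G_def galois_group_def BijGroup_def compose_def)
    qed
    then have "\<forall>g\<in>carrier (galois_group K L). g x = x" using gen by (simp add: G_def)
    then show "x \<in> K" using fixed x(1) by blast
  qed
qed

text \<open>With \<open>M = K(s)\<close> and \<open>\<delta>\<^sup>2 \<in> M\<close>, a generator \<open>f\<close> maps \<open>\<delta>\<close> to \<open>v \<delta>\<close> where \<open>v f(v) = - 1\<close>. Also
  \<open>s - 1\<close> has norm \<open>- 1\<close>, so Hilbert 90 for \<open>M / K\<close> rescales \<open>\<delta>\<close> to make \<open>v = s - 1\<close>; then
  \<open>\<delta>\<^sup>2 / (2 + s)\<close> is fixed by \<open>f\<close>.\<close>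

lemma cyclic_quartic_radical:
  assumes cyc: "cyclic_extension K L" and deg: "ext_degree K L = 4"
    and s: "s \<in> L" "s \<notin> K" "s\<^sup>2 = 2"
  obtains \<delta> r where "\<delta> \<in> L" "r \<in> K" "r \<noteq> 0" "\<delta>\<^sup>2 = r * (2 + s)"
proof -
  have K: "subfield K complex_field" and L: "subfield L complex_field" and KL: "K \<subseteq> L"
    and fd: "CF.finite_dimension K L"
    using cyc by (auto simp: cyclic_extension_def galois_extension_def finite_extension_def)
  note Kcl = subfield_complexD[OF K] and Lcl = subfield_complexD[OF L]
  have dim: "CF.dimension 4 K L"
    using CF.finite_dimensionE[OF K fd] deg by (simp add: ext_degree_def over_def)
  obtain f where f: "f \<in> carrier (galois_group K L)" and fix_f: "\<And>x. x \<in> L \<Longrightarrow> f x = x \<Longrightarrow> x \<in> K"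
    using cyclic_extension_generator[OF cyc] by blast
  note F = galois_groupD[OF f]
  have f0: "f 0 = 0" using F(2)[OF Kcl(1)] .
  have f_neg: "f (- x) = - f x" if "x \<in> L" for x
    using F(5)[OF that Lcl(5)[OF that]] f0 by (simp add: add_eq_0_iff)
  have f_diff: "f (x - y) = f x - f y" if "x \<in> L" "y \<in> L" for x y
    using F(5)[OF that(1) Lcl(5)[OF that(2)]] f_neg[OF that(2)] by simp
  have f_nz: "f x \<noteq> 0" if "x \<in> L" "x \<noteq> 0" for x
    using inj_onD[OF F(7), of x 0] that f0 Lcl(1) by auto
  have f_div: "f (x / y) = f x / f y" if "x \<in> L" "y \<in> L" "y \<noteq> 0" for x y
  proof -
    have "f (x / y) * f y = f x" using F(6)[OF Lcl(8)[OF that(1,2)] that(2)] that(3) by simp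
    then show ?thesis using f_nz[OF that(2,3)] by (simp add: field_simps)
  qed
  have s0: "s \<noteq> 0" using s(3) by auto
  have "(f s)\<^sup>2 = s\<^sup>2" using F(6)[OF s(1,1)] F(2)[OF Kcl(11), of "num.Bit0 num.One"] s(3)
    by (simp add: power2_eq_square)
  then have fs: "f s = - s" using fix_f[OF s(1)] s(2) by (auto simp: power2_eq_iff)
  define M where "M = {a + b * s | a b. a \<in> K \<and> b \<in> K}"
  have M: "subfield M complex_field"
    unfolding M_def using s(3) Kcl(11) by (intro subfield_quadratic_extension K) simp
  note Mcl = subfield_complexD[OF M]
  have KM: "K \<subseteq> M"
  proof
    fix x assume "x \<in> K"
    then show "x \<in> M" unfolding M_def by (intro CollectI exI[of _ x] exI[of _ 0]) (use Kcl(1) in auto)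
  qed
  have sM: "s \<in> M" unfolding M_def by (intro CollectI exI[of _ 0] exI[of _ 1]) (use Kcl(1,2) in auto)
  have M_sub: "M \<subseteq> L" using KL s(1) by (auto simp: M_def intro!: Lcl(3,4))
  have fM: "f x \<in> M" "f (f x) = x" if xM: "x \<in> M" for x
  proof -
    obtain a b where ab: "x = a + b * s" "a \<in> K" "b \<in> K" using xM by (auto simp: M_def)
    have fx: "f (a + b * s) = a + (- b) * s" if "a \<in> K" "b \<in> K" for a b
    proof -
      have L': "a \<in> L" "b \<in> L" using that KL by auto
      have "f (a + b * s) = f a + f b * f s" using F(5)[OF L'(1) Lcl(4)[OF L'(2) s(1)]] F(6)[OF L'(2) s(1)] by simp
      then show ?thesis using F(2) that fs by simp
    qed
    have "f x = a + (- b) * s" using fx[OF ab(2,3)] ab(1) by simp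
    then show "f x \<in> M" unfolding M_def using ab Kcl(5) by blast
    show "f (f x) = x" using fx[OF ab(2,3)] fx[OF ab(2) Kcl(5)[OF ab(3)]] ab(1) by simp
  qed
  have s_lin: "a = 0 \<and> b = 0" if "a \<in> K" "b \<in> K" "a + b * s = 0" for a b
  proof (cases "b = 0")
    case False
    then have "s = - a / b" using that(3) by (simp add: field_simps eq_neg_iff_add_eq_0 add.commute)
    then show ?thesis using s(2) that(1,2) Kcl(5,8) by simp
  qed (use that in simp)
  \<comment> \<open>\<open>L\<close> has degree 2 over \<open>M\<close>: in dimension 4 over
    \<open>K\<close> the five elements 1, \<open>s\<close>, \<open>w\<close>, \<open>s * w\<close>,
    \<open>x\<close> are dependent, and \<open>x\<close> must occur in the relation because
    \<open>w\<close> is not in \<open>M\<close> and \<open>s\<close> is not in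
    \<open>K\<close>.\<close>
  have decomp: "\<exists>u v. u \<in> M \<and> v \<in> M \<and> x = u + v * w" if w: "w \<in> L" "w \<notin> M" and x: "x \<in> L" for w x
  proof -
    define g where "g = (\<lambda>i::nat. [1, s, w, s * w, x] ! i)"
    have gL: "g i \<in> L" if "i < 5" for i
    proof -
      have "set [1, s, w, s * w, x] \<subseteq> L" using Lcl s(1) w(1) x by simp
      then show ?thesis unfolding g_def using that nth_mem[of i "[1, s, w, s * w, x]"] by auto
    qed
    obtain q where q: "\<And>i. i < 5 \<Longrightarrow> q i \<in> K" "(\<Sum>i<5. q i * g i) = 0" "\<exists>i<5. q i \<noteq> 0"
      by (rule dimension_imp_relation[OF K dim, of 5 g]) (use gL in \<open>simp | blast\<close>)+
    have qK: "q 0 \<in> K" "q 1 \<in> K" "q 2 \<in> K" "q 3 \<in> K" "q 4 \<in> K" using q(1) by simp_all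
    have "(\<Sum>i<5. q i * g i) = q 0 + q 1 * s + (q 2 + q 3 * s) * w + q 4 * x"
      by (simp add: g_def eval_nat_numeral algebra_simps)
    then have rel: "(q 0 + q 1 * s) + (q 2 + q 3 * s) * w + q 4 * x = 0" using q(2) by simp
    have A: "q 0 + q 1 * s \<in> M" and B: "q 2 + q 3 * s \<in> M" using qK by (auto simp: M_def)
    have q4: "q 4 \<noteq> 0"
    proof
      assume q4: "q 4 = 0"
      have B0: "q 2 + q 3 * s = 0"
      proof (rule ccontr)
        assume nz: "q 2 + q 3 * s \<noteq> 0"
        then have "w = - (q 0 + q 1 * s) / (q 2 + q 3 * s)"
          using rel q4 by (simp add: field_simps eq_neg_iff_add_eq_0)
        then show False using w(2) Mcl(8)[OF Mcl(5)[OF A] B] by simp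
      qed
      then have "q 0 + q 1 * s = 0" using rel q4 by simp
      then have "q 0 = 0" "q 1 = 0" "q 2 = 0" "q 3 = 0" using s_lin qK B0 by blast+
      then have "q i = 0" if "i < 5" for i
        using that q4 by (auto simp: less_Suc_eq eval_nat_numeral)
      then show False using q(3) by blast
    qed
    have q4M: "q 4 \<in> M" using qK(5) KM by blast
    have "x = - (q 0 + q 1 * s) / q 4 + (- (q 2 + q 3 * s) / q 4) * w"
    proof -
      have "q 4 * x = - (q 0 + q 1 * s) - (q 2 + q 3 * s) * w" using rel by (simp add: algebra_simps eq_neg_iff_add_eq_0)
      then have "x = (- (q 0 + q 1 * s) - (q 2 + q 3 * s) * w) / q 4" using q4 by (metis nonzero_mult_div_cancel_left)
      also have "\<dots> = - (q 0 + q 1 * s) / q 4 + (- (q 2 + q 3 * s) / q 4) * w"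
        using q4 by (simp add: divide_simps) (simp add: algebra_simps)
      finally show ?thesis .
    qed
    moreover have "- (q 0 + q 1 * s) / q 4 \<in> M" "- (q 2 + q 3 * s) / q 4 \<in> M"
      using Mcl(8)[OF Mcl(5)[OF A] q4M] Mcl(8)[OF Mcl(5)[OF B] q4M] by simp_all
    ultimately show ?thesis by blast
  qed
  \<comment> \<open>\<open>M\<close> has dimension 2 over \<open>K\<close> with basis
    \<open>s\<close>, 1, against 4 for \<open>L\<close>.\<close>
  have "L \<noteq> M"
  proof
    assume "L = M"
    have ind1: "CF.independent K [1]" by (rule CF.li_Cons) auto
    have "CF.independent K [s, 1]"
    proof (rule CF.li_Cons)
      show "s \<notin> CF.Span K [1]"
      proof
        assume "s \<in> CF.Span K [1]"
        then obtain Ks where "set Ks \<subseteq> K" "length Ks = length [1::complex]" "s = CF.combine Ks [1]"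
          using CF.Span_mem_iff_length_version[OF K, of "[1]" s] by auto
        then have "s \<in> K" by (auto simp: length_Suc_conv)
        then show False using s(2) by simp
      qed
    qed (use ind1 in auto)
    then have "CF.dimension (length [s, 1]) K (CF.Span K [s, 1])" by (intro CF.dimension_independent)
    moreover have "CF.Span K [s, 1] = M"
    proof (rule Set.set_eqI)
      fix x
      have "x \<in> CF.Span K [s, 1] \<longleftrightarrow> (\<exists>Ks. set Ks \<subseteq> K \<and> length Ks = length [s, 1] \<and> x = CF.combine Ks [s, 1])"
        by (rule CF.Span_mem_iff_length_version[OF K]) simp
      also have "\<dots> \<longleftrightarrow> (\<exists>b a. b \<in> K \<and> a \<in> K \<and> x = b * s + a)"
      proof
        assume "\<exists>Ks. set Ks \<subseteq> K \<and> length Ks = length [s, 1] \<and> x = CF.combine Ks [s, 1]"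
        then show "\<exists>b a. b \<in> K \<and> a \<in> K \<and> x = b * s + a" by (auto simp: length_Suc_conv)
      next
        assume "\<exists>b a. b \<in> K \<and> a \<in> K \<and> x = b * s + a"
        then obtain b a where "b \<in> K" "a \<in> K" "x = b * s + a" by blast
        then show "\<exists>Ks. set Ks \<subseteq> K \<and> length Ks = length [s, 1] \<and> x = CF.combine Ks [s, 1]"
          by (intro exI[of _ "[b, a]"]) simp
      qed
      also have "\<dots> \<longleftrightarrow> x \<in> M" by (auto simp: M_def add.commute)
      finally show "x \<in> CF.Span K [s, 1] \<longleftrightarrow> x \<in> M" .
    qed
    ultimately have "CF.dimension 2 K L" using \<open>L = M\<close> by (simp add: numeral_2_eq_2)
    then show False using CF.dimension_is_inj[OF K dim] by fastforce
  qed
  then obtain w where w: "w \<in> L" "w \<notin> M" using M_sub by blast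
  obtain u v where uv: "u \<in> M" "v \<in> M" "w\<^sup>2 = u + v * w" using decomp[OF w Lcl(10)[OF w(1), of 2]] by blast
  \<comment> \<open>Completing the square in the quadratic equation of \<open>w\<close> over
    \<open>M\<close>.\<close>
  define \<delta> where "\<delta> = w - v / 2"
  have v2: "v / 2 \<in> M" using Mcl(8)[OF uv(2) Mcl(11)] by simp
  have dL: "\<delta> \<in> L" using w(1) v2 M_sub Lcl(7) by (auto simp: \<delta>_def)
  have dM: "\<delta> \<notin> M"
  proof
    assume "\<delta> \<in> M"
    then have "\<delta> + v / 2 \<in> M" using v2 by (rule Mcl(3))
    then show False using w(2) by (simp add: \<delta>_def)
  qed
  have "\<delta>\<^sup>2 = w\<^sup>2 - v * w + (v / 2)\<^sup>2" by (simp add: \<delta>_def power2_eq_square field_simps)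
  also have "\<dots> = u + (v / 2)\<^sup>2" using uv(3) by simp
  finally have d2: "\<delta>\<^sup>2 \<in> M" using uv(1) v2 Mcl(3,10) by simp
  have f2: "f (x\<^sup>2) = (f x)\<^sup>2" if "x \<in> L" for x using F(6)[OF that that] by (simp add: power2_eq_square)
  obtain u v where uv: "u \<in> M" "v \<in> M" "f \<delta> = u + v * \<delta>" using decomp[OF dL dM F(3)[OF dL]] by blast
  have "(u + v * \<delta>)\<^sup>2 = f (\<delta>\<^sup>2)" using f2[OF dL] uv(3) by simp
  then have "2 * u * v * \<delta> = f (\<delta>\<^sup>2) - u\<^sup>2 - v\<^sup>2 * \<delta>\<^sup>2"
    by (simp add: power2_eq_square algebra_simps)
  moreover have "f (\<delta>\<^sup>2) - u\<^sup>2 - v\<^sup>2 * \<delta>\<^sup>2 \<in> M"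
    by (rule Mcl(7)[OF Mcl(7)[OF fM(1)[OF d2] Mcl(10)[OF uv(1)]] Mcl(4)[OF Mcl(10)[OF uv(2)] d2]])
  ultimately have uvd: "2 * u * v * \<delta> \<in> M" by simp
  \<comment> \<open>Squaring \<open>f \<delta> = u + v * \<delta>\<close> puts the cross term into
    \<open>M\<close>, while \<open>\<delta>\<close> is outside \<open>M\<close>. With
    \<open>v\<close> nonzero, only \<open>f \<delta> = v * \<delta>\<close> remains.\<close>
  have uv0: "2 * u * v = 0"
  proof (rule ccontr)
    assume nz: "2 * u * v \<noteq> 0"
    have "2 * u * v \<in> M" using uv(1,2) Mcl(11) by (intro Mcl(4))
    from Mcl(8)[OF uvd this] have "\<delta> \<in> M" using nz by simp
    then show False using dM by simp
  qed
  have "v \<noteq> 0"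
  proof
    assume "v = 0"
    then have "f \<delta> \<in> M" using uv by simp
    then have "f \<delta> = f (f (f \<delta>))" using fM(2) by simp
    then have "\<delta> = f (f \<delta>)" using inj_onD[OF F(7)] dL F(3) by blast
    then show False using fM(1)[OF \<open>f \<delta> \<in> M\<close>] dM by simp
  qed
  then have fd': "f \<delta> = v * \<delta>" using uv uv0 by simp
  have vL: "v \<in> L" and fvM: "f v \<in> M" using uv(2) M_sub fM(1) by auto
  have d0: "\<delta> \<noteq> 0" using dM Mcl(1) by auto
  have ffd: "f (f \<delta>) = f v * v * \<delta>" using fd' F(6)[OF vL dL] by simp
  have "(f (f \<delta>))\<^sup>2 = \<delta>\<^sup>2" using f2[OF F(3)[OF dL]] f2[OF dL] fM(2)[OF d2] by simp
  then have "(f v * v)\<^sup>2 = 1" using d0 unfolding ffd by (simp add: power_mult_distrib)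
  then have "f v * v = 1 \<or> f v * v = - 1" using power2_eq_iff[of "f v * v" 1] by simp
  \<comment> \<open>The value 1 would give \<open>f\<close> order 2 on \<open>\<delta>\<close>. Then
    the sum of \<open>\<delta>\<close> and \<open>f \<delta>\<close>, and \<open>s\<close> times
    their difference, would be fixed and so lie in \<open>K\<close>, putting \<open>\<delta>\<close>
    into \<open>M\<close>.\<close>
  moreover have "f v * v \<noteq> 1"
  proof
    assume "f v * v = 1"
    then have ffd: "f (f \<delta>) = \<delta>" using ffd by simp
    have 1: "\<delta> + f \<delta> \<in> K"
      using F(5)[OF dL F(3)[OF dL]] ffd by (intro fix_f Lcl(3) dL F(3)) (simp add: add.commute)
    have 2: "s * (\<delta> - f \<delta>) \<in> K"
    proof (rule fix_f)
      show "s * (\<delta> - f \<delta>) \<in> L" by (intro Lcl(4) Lcl(7) s(1) dL F(3))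
      show "f (s * (\<delta> - f \<delta>)) = s * (\<delta> - f \<delta>)"
        using F(6)[OF s(1) Lcl(7)[OF dL F(3)[OF dL]]] f_diff[OF dL F(3)[OF dL]] ffd fs
        by (simp add: algebra_simps)
    qed
    have "((\<delta> + f \<delta>) + (s * (\<delta> - f \<delta>)) / s) / 2 \<in> M"
      by (rule Mcl(8)[OF Mcl(3)[OF subsetD[OF KM 1] Mcl(8)[OF subsetD[OF KM 2] sM]] Mcl(11)])
    moreover have "((\<delta> + f \<delta>) + (s * (\<delta> - f \<delta>)) / s) / 2 = \<delta>" using s0 by (simp add: field_simps)
    ultimately show False using dM by (simp only:)
  qed
  ultimately have vv: "f v * v = - 1" by blast
  \<comment> \<open>A unit of norm -1 whose square carries \<open>2 + s\<close> to its conjugate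
    \<open>2 - s\<close>; this is where the factor \<open>2 + s\<close> of the radicand comes
    from.\<close>
  define v0 where "v0 = s - 1"
  have v0M: "v0 \<in> M" unfolding v0_def using sM Mcl(2,7) by simp
  have fv0: "f v0 = - s - 1" unfolding v0_def using f_diff[OF s(1) Lcl(2)] F(4) fs by simp
  have vv0: "f v0 * v0 = - 1" unfolding fv0 using s(3) by (simp add: v0_def power2_eq_square algebra_simps)
  then have v00: "v0 \<noteq> 0" by auto
  define t where "t = v / v0"
  have tM: "t \<in> M" unfolding t_def by (rule Mcl(8)[OF uv(2) v0M])
  have "f t * t = (f v * v) / (f v0 * v0)"
    unfolding t_def using f_div[OF vL subsetD[OF M_sub v0M] v00] by simp
  then have ft: "f t * t = 1" using vv vv0 by simp
  \<comment> \<open>Hilbert 90 made explicit: \<open>1 + f t\<close> is mapped to \<open>t\<close>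
    times itself because \<open>f t * t = 1\<close>. It vanishes exactly for \<open>t = - 1\<close>,
    where \<open>s\<close> serves instead.\<close>
  obtain k where k: "k \<in> M" "k \<noteq> 0" "f k = t * k"
  proof (cases "t = - 1")
    case True
    then show ?thesis using that[OF sM s0] fs by simp
  next
    case False
    have tL: "t \<in> L" "f t \<in> L" using tM M_sub F(3) by auto
    have "f (1 + f t) = 1 + t" using F(5)[OF Lcl(2) tL(2)] F(4) fM(2)[OF tM] by simp
    moreover have "t * (1 + f t) = 1 + t" using ft by (simp add: algebra_simps)
    moreover have "1 + f t \<noteq> 0"
    proof
      assume "1 + f t = 0"
      then have "f t = - 1" by (simp add: add_eq_0_iff)
      then have "- t = 1" using ft by simp
      then show False using False by (metis minus_minus)
    qed
    ultimately show ?thesis using that[of "1 + f t"] Mcl(3)[OF Mcl(2) fM(1)[OF tM]] by simp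
  qed
  have kL: "k \<in> L" using k(1) M_sub by auto
  define \<eta> where "\<eta> = \<delta> / k"
  have eL: "\<eta> \<in> L" unfolding \<eta>_def by (rule Lcl(8)[OF dL kL])
  have t0: "t \<noteq> 0" using ft by auto
  have fe: "f \<eta> = v0 * \<eta>"
    unfolding \<eta>_def using f_div[OF dL kL k(2)] fd' k(2,3) v00 t0
    by (simp add: t_def field_simps)
  have ns: "2 + s \<noteq> 0"
  proof
    assume "2 + s = 0"
    then have "s = - 2" by (simp add: add_eq_0_iff)
    then show False using s(3) by simp
  qed
  define r where "r = \<eta>\<^sup>2 / (2 + s)"
  have sL: "2 + s \<in> L" using Lcl(3)[OF Lcl(11) s(1)] .
  have "f (2 + s) = 2 - s" using F(5)[OF Lcl(11) s(1)] F(2)[OF Kcl(11)] fs by simp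
  also have "\<dots> = v0\<^sup>2 * (2 + s)" using s(3) by (simp add: v0_def power2_eq_square algebra_simps)
  finally have "f r = r"
    unfolding r_def using f_div[OF Lcl(10)[OF eL, of 2] sL ns] f2[OF eL] fe v00 by (simp add: power_mult_distrib)
  then have "r \<in> K" unfolding r_def by (intro fix_f Lcl(8) Lcl(10) eL sL) 
  moreover have "r \<noteq> 0" using d0 k(2) ns by (simp add: r_def \<eta>_def)
  moreover have "\<eta>\<^sup>2 = r * (2 + s)" using ns by (simp add: r_def)
  ultimately show ?thesis using that eL by blast
qed

section \<open>Imaginary quadratic fields\<close>

text \<open>An integer prime to \<open>l\<close> inside \<open>Q\<close> would, by Bezout with
  \<open>l\<close>, put 1 into \<open>Q\<close>.\<close>

lemma of_int_mem_maximalideal_iff: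
  fixes l n :: int
  assumes L: "subfield L complex_field" and Q: "maximalideal Q (ring_of_integers L)"
    and l: "Factorial_Ring.prime l" "of_int l \<in> Q"
  shows "of_int n \<in> Q \<longleftrightarrow> l dvd n"
proof
  have idQ: "ideal Q (ring_of_integers L)" using Q by (simp add: maximalideal_def)
  note cl = ring_of_integers_closed[OF L] and QD = ideal_ring_of_integersD[OF L idQ]
  show "of_int n \<in> Q" if ln: "l dvd n"
  proof -
    obtain k where "n = l * k" using ln ..
    then show ?thesis using QD(5)[OF cl(5)[of k] l(2)] by (simp only: of_int_mult)
  qed
  show "l dvd n" if n: "of_int n \<in> Q"
  proof (rule ccontr)
    assume "\<not> l dvd n"
    then obtain a b where ab: "(of_int a * of_int n + of_int b * of_int l :: complex) = 1"
      using prime_bezout[OF l(1)] by metis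
    have "of_int a * of_int n + of_int b * of_int l \<in> Q"
      by (rule QD(3)[OF QD(4)[OF cl(5) n] QD(4)[OF cl(5) l(2)]])
    then have "1 \<in> Q" by (simp only: ab)
    then have "a \<in> Q" if "a \<in> \<O> L" for a using QD(4)[OF that, of 1] by simp
    then show False using maximalideal.I_notcarr[OF Q] QD(1) by blast
  qed
qed

lemma maximalideal_mult_notin:
  assumes L: "subfield L complex_field" and Q: "maximalideal Q (ring_of_integers L)"
    and "x \<in> \<O> L" "y \<in> \<O> L" "x \<notin> Q" "y \<notin> Q"
  shows "x * y \<notin> Q"
proof -
  have "primeideal Q (ring_of_integers L)"
    using cring.maximalideal_prime[OF cring_ring_of_integers[OF L] Q] .
  then show ?thesis using primeideal.I_prime[of Q "ring_of_integers L" x y] assms(3-6) by auto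
qed

text \<open>The ideal generated by \<open>l\<close> is proper because \<open>1 / l\<close> is
  rational but not an integer, hence not an algebraic integer.\<close>

lemma exists_maximalideal_over_prime:
  fixes l :: int
  assumes L: "subfield L complex_field" and l: "Factorial_Ring.prime l"
  obtains Q where "maximalideal Q (ring_of_integers L)" "of_int l \<in> Q"
proof -
  note cl = ring_of_integers_closed[OF L]
  have "a * of_int l + b * of_int l \<noteq> 1"
    if "a \<in> \<O> L" "b \<in> \<O> L" for a b
  proof
    assume eq: "a * of_int l + b * of_int l = 1"
    have "l \<noteq> 0" using l by auto
    then have ab: "a + b = 1 / of_int l" using eq by (simp add: field_simps)
    have "algebraic_int (a + b)" using cl(1)[OF that] by simp
    moreover have "a + b \<in> \<rat>" unfolding ab by simp
    ultimately have "a + b \<in> \<int>" by (rule rational_algebraic_int_is_int)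
    then obtain k where "a + b = of_int k" by (rule Ints_cases)
    then have "of_int (k * l) = (1 :: complex)" using eq by (simp add: distrib_right[symmetric])
    then have "k * l = 1" by (metis of_int_eq_1_iff)
    then have "l dvd 1" by (metis dvd_triv_right)
    then show False using l not_prime_unit by blast
  qed
  then show ?thesis using maximal_ideal_containing[OF L cl(5,5), of l l] that by blast
qed

section \<open>Squarefree integers and rationality\<close>

lemma squarefree_dvd_square:
  fixes n w :: int
  assumes "squarefree n" "n dvd w\<^sup>2"
  shows "n dvd w"
proof (cases "w = 0")
  case False
  define g where "g = gcd n w"
  have g0: "g \<noteq> 0" using False by (simp add: g_def)
  obtain n' where n': "n = gcd n w * n'" by (rule dvdE[OF gcd_dvd1])
  obtain w' where w': "w = gcd n w * w'" by (rule dvdE[OF gcd_dvd2])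
  have cop: "Rings.coprime n' w'"
  proof (rule gcd_coprime)
    show "gcd n w \<noteq> 0" using False by simp
    show "n = n' * gcd n w" by (subst mult.commute) (rule n')
    show "w = w' * gcd n w" by (subst mult.commute) (rule w')
  qed
  have nw: "n = g * n'" "w = g * w'" unfolding g_def by (rule n', rule w')
  have "g * n' dvd g * (g * w'\<^sup>2)" using assms(2) by (simp add: nw power2_eq_square ac_simps)
  then have "n' dvd g * w'\<^sup>2" using g0 by simp
  then have "n' dvd g" using cop by (simp add: coprime_dvd_mult_left_iff)
  \<comment> \<open>As the cofactor \<open>n'\<close> also divides the gcd, its square divides the
    squarefree \<open>n\<close>; so \<open>n'\<close> is a unit.\<close>
  then have "n'\<^sup>2 dvd n" by (simp add: nw(1) power2_eq_square mult_dvd_mono)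
  then have "is_unit n'" using assms(1) squarefreeD by blast
  then have "n dvd g" unfolding nw(1) by (metis mult_unit_dvd_iff dvd_refl)
  then show ?thesis using nw(2) by (metis dvd_mult2)
qed simp

lemma squarefree_prime_cofactor:
  fixes n l :: int
  assumes "squarefree n" "Factorial_Ring.prime l" "l dvd n"
  obtains m where "n = l * m" "\<not> l dvd m"
proof -
  obtain m where m: "n = l * m" using assms(3) ..
  moreover have "\<not> l dvd m"
  proof
    assume "l dvd m"
    then have "l\<^sup>2 dvd n" by (simp add: m power2_eq_square)
    then show False using assms(1,2) squarefreeD not_prime_unit by blast
  qed
  ultimately show ?thesis by (rule that)
qed

lemma Rats_complex_of_real:
  assumes "z \<in> (\<rat> :: complex set)"
  obtains t where "z = complex_of_real t"
proof -
  obtain a b where "b > 0" "z = of_int a / of_int b" using assms by (rule Rats_cases')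
  then have "z = complex_of_real (of_int a / of_int b)" by simp
  then show ?thesis by (rule that)
qed

lemma csqrt_2_irrational: "csqrt 2 \<notin> \<rat>"
proof
  assume "csqrt 2 \<in> \<rat>"
  moreover have "algebraic_int (csqrt 2)" using algebraic_int_of_int_complex[of 2] by auto
  ultimately have "csqrt 2 \<in> \<int>" using rational_algebraic_int_is_int by blast
  then obtain k where k: "csqrt 2 = of_int k" by (rule Ints_cases)
  have "of_int (k\<^sup>2) = (csqrt 2)\<^sup>2" by (simp add: k)
  then have "of_int (k\<^sup>2) = (of_int 2 :: complex)" by (simp only: power2_csqrt of_int_numeral)
  then have k2: "k\<^sup>2 = 2" by (metis of_int_eq_iff)
  then have "even (k\<^sup>2)" by simp
  then have "even k" by simp
  then obtain m where "k = 2 * m" ..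
  then have "2 * m\<^sup>2 = 1" using k2 by (simp add: power2_eq_square)
  then show False by presburger
qed

section \<open>The field \<open>S\<close>, its integers and its primes\<close>

locale imaginary_quadratic =
  fixes d :: int
  assumes d_pos: "d > 0" and d_odd: "odd d" and d_squarefree: "squarefree d"
begin

definition \<theta> :: complex where "\<theta> = csqrt (of_int (- 2 * d))"

definition s :: complex where "s = csqrt 2"

text \<open>A square root of \<open>- d\<close>, formed as a quotient so that its sign is tied to
  those of \<open>\<theta>\<close> and \<open>s\<close>: \<open>\<theta> = \<kappa> * s\<close>
  holds exactly.\<close>

definition \<kappa> :: complex where "\<kappa> = \<theta> / s"

definition S :: "complex set" where "S = generate_field complex_field {\<theta>}"

lemma theta_sq: "\<theta>\<^sup>2 = - 2 * of_int d" by (simp add: \<theta>_def)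

lemma theta_theta: "\<theta> * \<theta> = - 2 * of_int d" using theta_sq by (simp add: power2_eq_square)

lemma s_sq: "s\<^sup>2 = 2" unfolding s_def by (rule power2_csqrt)

lemma s_s: "s * s = 2" using s_sq by (simp add: power2_eq_square)

lemma s_nz: "s \<noteq> 0" and theta_nz: "\<theta> \<noteq> 0"
  using s_sq theta_sq d_pos by auto

lemma kappa_s: "\<kappa> * s = \<theta>" using s_nz by (simp add: \<kappa>_def)

lemma kappa_sq: "\<kappa>\<^sup>2 = - of_int d"
  by (simp add: \<kappa>_def power_divide theta_sq s_sq)

lemma theta_cnj: "cnj \<theta> = - \<theta>"
proof -
  have "\<theta> = \<i> * sqrt \<bar>Re (of_int (- 2 * d))\<bar>"
    unfolding \<theta>_def using d_pos by (intro csqrt_of_real_nonpos) auto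
  then show ?thesis by simp
qed

lemma subfield_S: "subfield S complex_field"
  and S_eq: "S = {a + b * \<theta> | a b. a \<in> \<rat> \<and> b \<in> \<rat>}"
  unfolding S_def using theta_sq by (auto intro!: generate_quadratic_field)

lemma theta_in_S: "\<theta> \<in> S" unfolding S_def by (rule generate_field.incl) simp

lemma theta_not_real: "\<theta> \<noteq> complex_of_real t"
proof
  assume "\<theta> = complex_of_real t"
  then have "complex_of_real (t\<^sup>2) = of_real (- 2 * of_int d)" using theta_sq by simp
  then have "t\<^sup>2 = - 2 * of_int d" by (simp only: of_real_eq_iff)
  moreover have "t\<^sup>2 \<ge> 0" by simp
  ultimately show False using d_pos by simp
qed

lemma theta_lin_Rats:
  assumes "a \<in> \<rat>" "b \<in> \<rat>" "a + b * \<theta> = 0"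
  shows "a = 0 \<and> b = 0"
proof (cases "b = 0")
  case False
  then have "\<theta> = - a / b" using assms(3) by (simp add: field_simps eq_neg_iff_add_eq_0 add.commute)
  then have "\<theta> \<in> \<rat>" using assms(1,2) by simp
  then show ?thesis using Rats_complex_of_real theta_not_real by metis
qed (use assms in simp)

lemma theta_lin: "of_int a + of_int b * \<theta> = 0 \<Longrightarrow> a = 0 \<and> b = 0"
  using theta_lin_Rats[of "of_int a" "of_int b"] by auto

lemma s_notin_S: "s \<notin> S"
proof
  assume "s \<in> S"
  then obtain p q where pq: "s = p + q * \<theta>" "p \<in> \<rat>" "q \<in> \<rat>" unfolding S_eq by blast
  have "2 = p\<^sup>2 + 2 * p * q * \<theta> + q\<^sup>2 * \<theta>\<^sup>2"
    using s_sq unfolding pq(1) by (simp add: power2_eq_square algebra_simps)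
  then have "(p\<^sup>2 - 2 * of_int d * q\<^sup>2 - 2) + (2 * p * q) * \<theta> = 0"
    unfolding theta_sq by (simp add: algebra_simps)
  then have *: "p\<^sup>2 - 2 * of_int d * q\<^sup>2 - 2 = 0" "2 * p * q = 0"
    using theta_lin_Rats[of "p\<^sup>2 - 2 * of_int d * q\<^sup>2 - 2" "2 * p * q"] pq(2,3) by auto
  show False
  proof (cases "q = 0")
    case True
    then show False using pq csqrt_2_irrational by (simp add: s_def)
  next
    case False
    then have "- 2 * of_int d * q\<^sup>2 = 2" using * by simp
    moreover obtain t where t: "q = complex_of_real t" using Rats_complex_of_real[OF pq(3)] .
    ultimately have "complex_of_real (- 2 * of_int d * t\<^sup>2) = of_real 2" by simp
    then have "- 2 * of_int d * t\<^sup>2 = 2" by (simp only: of_real_eq_iff)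
    moreover have "of_int d * t\<^sup>2 \<ge> 0" using d_pos by simp
    ultimately show False by linarith
  qed
qed

lemma squarefree_2d: "squarefree (2 * d)"
proof (rule squarefree_mult_coprime)
  show "Rings.coprime 2 d" using d_odd by simp
  show "squarefree (2 :: int)" by (rule squarefree_prime) simp
qed (rule d_squarefree)

text \<open>The radicand \<open>- 2 * d\<close> is squarefree and congruent to 2 modulo 4, so
  half-integers do not occur. Trace and norm give integrality of twice the coefficients, and the
  relation \<open>2 * d * R^2 = 4 * N - P^2\<close> then forces \<open>P\<close> and
  \<open>R\<close> to be even.\<close>

lemma ring_of_integers_S:
  assumes "x \<in> S" "algebraic_int x"
  obtains f g :: int where "x = of_int f + of_int g * \<theta>"
proof -
  obtain p q where pq: "x = p + q * \<theta>" "p \<in> \<rat>" "q \<in> \<rat>" using assms(1) unfolding S_eq by blast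
  have "cnj p = p" "cnj q = q" using pq(2,3) by (metis Rats_complex_of_real complex_cnj_complex_of_real)+
  then have cnj_x: "cnj x = p - q * \<theta>"
    unfolding pq(1) complex_cnj_add complex_cnj_mult theta_cnj by simp
  have ax: "algebraic_int (cnj x)" using assms(2) by auto
  have "algebraic_int (x + cnj x)" by (rule algebraic_int_add[OF assms(2) ax])
  moreover have xx: "x + cnj x = 2 * p" unfolding cnj_x by (simp add: pq(1))
  ultimately have "2 * p \<in> \<int>" using pq(2) by (intro rational_algebraic_int_is_int) auto
  then obtain P where P: "2 * p = of_int P" by (rule Ints_cases)
  have "algebraic_int (x * cnj x)" by (rule algebraic_int_mult[OF assms(2) ax])
  moreover have xx: "x * cnj x = p\<^sup>2 + 2 * of_int d * q\<^sup>2"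
  proof -
    have "x * cnj x = p\<^sup>2 - q\<^sup>2 * \<theta>\<^sup>2"
      unfolding cnj_x by (simp add: pq(1) power2_eq_square algebra_simps)
    then show ?thesis unfolding theta_sq by simp
  qed
  ultimately have "p\<^sup>2 + 2 * of_int d * q\<^sup>2 \<in> \<int>" using pq(2,3) by (intro rational_algebraic_int_is_int) auto
  then obtain N where N: "p\<^sup>2 + 2 * of_int d * q\<^sup>2 = of_int N" by (rule Ints_cases)
  \<comment> \<open>The square of \<open>w\<close> is \<open>2 * d\<close> times an integer, so
    \<open>w\<close> is an integer whose square is divisible by the squarefree \<open>2 * d\<close>.
    Hence \<open>w\<close> itself is divisible by \<open>2 * d\<close>, which means that
    \<open>2 * q\<close> is an integer.\<close>
  define w where "w = 2 * of_int d * (2 * q)"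
  have "2 * of_int d * (2 * q)\<^sup>2 = 4 * (p\<^sup>2 + 2 * of_int d * q\<^sup>2) - (2 * p)\<^sup>2"
    by (simp add: power2_eq_square algebra_simps)
  also have "\<dots> = of_int (4 * N - P\<^sup>2)" unfolding P N by simp
  finally have m: "2 * of_int d * (2 * q)\<^sup>2 = of_int (4 * N - P\<^sup>2)" .
  have w2: "w\<^sup>2 = of_int (2 * d * (4 * N - P\<^sup>2))"
  proof -
    have "w\<^sup>2 = 2 * of_int d * (2 * of_int d * (2 * q)\<^sup>2)" by (simp add: w_def power2_eq_square)
    then show ?thesis unfolding m by simp
  qed
  have "algebraic_int (w\<^sup>2)" unfolding w2 by (rule algebraic_int_of_int_complex)
  then have "algebraic_int w" by (rule algebraic_int_sqrt_of_square)
  moreover have "w \<in> \<rat>" using pq(3) by (simp add: w_def)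
  ultimately have "w \<in> \<int>" by (intro rational_algebraic_int_is_int)
  then obtain W where W: "w = of_int W" by (rule Ints_cases)
  have "of_int (W\<^sup>2) = w\<^sup>2" by (simp add: W)
  then have "(of_int (W\<^sup>2) :: complex) = of_int (2 * d * (4 * N - P\<^sup>2))" by (simp only: w2)
  then have "W\<^sup>2 = 2 * d * (4 * N - P\<^sup>2)" by (simp only: of_int_eq_iff)
  then have "2 * d dvd W\<^sup>2" by simp
  then have "2 * d dvd W" by (rule squarefree_dvd_square[OF squarefree_2d])
  then obtain R where R: "W = 2 * d * R" ..
  have "2 * of_int d * (2 * q) = 2 * of_int d * of_int R" using W unfolding w_def R by simp
  then have q: "2 * q = of_int R" using d_pos by simp
  have "(of_int (2 * d * R\<^sup>2) :: complex) = 2 * of_int d * (2 * q)\<^sup>2" unfolding q by simp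
  then have "(of_int (2 * d * R\<^sup>2) :: complex) = of_int (4 * N - P\<^sup>2)" by (simp only: m)
  then have rel: "2 * d * R\<^sup>2 = 4 * N - P\<^sup>2" by (simp only: of_int_eq_iff)
  then have "P\<^sup>2 = 2 * (2 * N - d * R\<^sup>2)" by simp
  then have "even (P\<^sup>2)" by (metis dvd_triv_left)
  then obtain P' where P': "P = 2 * P'" by auto
  have "d * R\<^sup>2 = 2 * (N - P'\<^sup>2)" using rel P' by (simp add: power2_eq_square)
  then have "even (d * R\<^sup>2)" by (metis dvd_triv_left)
  then have "even R" using d_odd by simp
  then obtain R' where R': "R = 2 * R'" ..
  have "p = of_int P'" "q = of_int R'" using P P' q R' by simp_all
  then show ?thesis using that pq(1) by simp
qed

lemma theta_mem_ring:
  assumes "subfield L complex_field" "\<theta> \<in> L"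
  shows "\<theta> \<in> \<O> L"
  using assms algebraic_int_of_int_complex[of "- 2 * d"] by (auto simp: \<theta>_def)

lemma s_mem_ring:
  assumes "subfield L complex_field" "s \<in> L"
  shows "s \<in> \<O> L"
  using assms algebraic_int_of_int_complex[of 2] by (auto simp: s_def)

lemma kappa_mem_ring:
  assumes "subfield L complex_field" "\<theta> \<in> L" "s \<in> L"
  shows "\<kappa> \<in> \<O> L"
proof -
  have "algebraic_int (\<kappa>\<^sup>2)" unfolding kappa_sq using algebraic_int_of_int_complex[of "- d"] by simp
  then have "algebraic_int \<kappa>" by (rule algebraic_int_sqrt_of_square)
  moreover have "\<kappa> \<in> L" unfolding \<kappa>_def by (rule subfield_complexD(8)[OF assms])
  ultimately show ?thesis by simp
qed

lemma lin_mem_ring: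
  assumes "subfield L complex_field" "\<theta> \<in> L"
  shows "of_int a + of_int b * \<theta> \<in> \<O> L"
    "of_int a - of_int b * \<theta> \<in> \<O> L"
  using ring_of_integers_closed[OF assms(1)] theta_mem_ring[OF assms] by (simp_all del: ring_of_integers_simps)

lemma norm_lin:
  "(of_int a + of_int b * \<theta>) * (of_int a - of_int b * \<theta>) = of_int (a\<^sup>2 + 2 * d * b\<^sup>2)"
proof -
  have "(of_int a + of_int b * \<theta>) * (of_int a - of_int b * \<theta>) = (of_int a)\<^sup>2 - (of_int b)\<^sup>2 * \<theta>\<^sup>2"
    by (simp add: power2_eq_square algebra_simps)
  then show ?thesis unfolding theta_sq by simp
qed

text \<open>If \<open>l\<close> does not divide the norm, every prime above \<open>l\<close> works.
  Otherwise a prime containing the conjugate \<open>y\<close> is taken; if it also contained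
  \<open>x\<close>, then \<open>l\<close> would divide \<open>2 * a\<close> and, through the norm,
  both \<open>a\<close> and \<open>b\<close>.\<close>

lemma maximalideal_avoiding:
  fixes l a b :: int
  assumes L: "subfield L complex_field" "\<theta> \<in> L"
    and l: "Factorial_Ring.prime l" "\<not> l dvd 2 * d" and ab: "Rings.coprime a b"
  obtains Q where "maximalideal Q (ring_of_integers L)" "of_int l \<in> Q" "of_int a + of_int b * \<theta> \<notin> Q"
proof -
  define R where "R = ring_of_integers L"
  note cl = ring_of_integers_closed[OF L(1), folded R_def]
  define x where "x = of_int a + of_int b * \<theta>"
  define y where "y = of_int a - of_int b * \<theta>"
  define N where "N = a\<^sup>2 + 2 * d * b\<^sup>2"
  have xy: "x * y = of_int N" unfolding x_def y_def N_def by (rule norm_lin)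
  have x: "x \<in> carrier R" and y: "y \<in> carrier R"
    unfolding x_def y_def R_def by (rule lin_mem_ring[OF L])+
  have l0: "l \<noteq> 0" using l(1) by auto
  have ab_l: False if "l dvd a" "l dvd b" using ab that l(1) by (metis coprime_common_divisor not_prime_unit)
  show ?thesis
  proof (cases "l dvd N")
    case False
    obtain Q where Q: "maximalideal Q R" "of_int l \<in> Q"
      using exists_maximalideal_over_prime[OF L(1) l(1)] by (auto simp: R_def)
    have idQ: "ideal Q R" using Q by (simp add: maximalideal_def)
    have "x \<notin> Q"
    proof
      assume "x \<in> Q"
      then have "x * y \<in> Q" using ideal_ring_of_integersD(5)[OF L(1), folded R_def, OF idQ y] by simp
      then have "of_int N \<in> Q" by (simp only: xy)
      then show False
        using False of_int_mem_maximalideal_iff[OF L(1) Q(1)[unfolded R_def] l(1) Q(2)] by blast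
    qed
    then show ?thesis using that[of Q] Q by (simp add: x_def R_def)
  next
    case True
    then obtain N' where N': "N = l * N'" ..
    \<comment> \<open>Properness of the ideal generated by \<open>l\<close> and \<open>y\<close>:
      multiplying by \<open>x\<close> a representation of 1 would make \<open>x / l\<close>
      integral, so \<open>l\<close> would divide both coprime coefficients.\<close>
    have "u * of_int l + v * y \<noteq> 1" if uv: "u \<in> carrier R" "v \<in> carrier R" for u v
    proof
      assume "u * of_int l + v * y = 1"
      then have "x = (u * of_int l + v * y) * x" by simp
      also have "\<dots> = of_int l * (u * x) + v * (x * y)" by (simp add: algebra_simps)
      also have "\<dots> = of_int l * (u * x + v * of_int N')" unfolding xy N' by (simp add: algebra_simps)
      finally have xl: "x / of_int l = u * x + v * of_int N'" using l0 by (simp add: field_simps)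
      have "u * x + v * of_int N' \<in> carrier R" by (rule cl(1)[OF cl(2)[OF uv(1) x] cl(2)[OF uv(2) cl(5)]])
      then have int: "algebraic_int (x / of_int l)" unfolding xl by (simp add: R_def)
      have "x / of_int l \<in> S"
        using subfield_complexD(3,4,8,9)[OF subfield_S] theta_in_S by (auto simp: x_def)
      then obtain f g where "x / of_int l = of_int f + of_int g * \<theta>" using ring_of_integers_S[OF _ int] by blast
      then have "x = of_int (l * f) + of_int (l * g) * \<theta>" using l0 by (simp add: field_simps)
      then have "of_int (a - l * f) + of_int (b - l * g) * \<theta> = 0" by (simp add: x_def algebra_simps)
      then have "a - l * f = 0 \<and> b - l * g = 0" by (rule theta_lin)
      then show False using ab_l by auto
    qed
    then obtain Q where Q: "maximalideal Q R" "of_int l \<in> Q" "y \<in> Q"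
      using maximal_ideal_containing[OF L(1), of "of_int l" y] cl(5) y by (auto simp: R_def simp del: ring_of_integers_simps)
    have idQ: "ideal Q R" using Q by (simp add: maximalideal_def)
    note iff = of_int_mem_maximalideal_iff[OF L(1) Q(1)[unfolded R_def] l(1) Q(2)]
    have l2: "\<not> l dvd 2" using l(2) by (meson dvd_mult2)
    have "x \<notin> Q"
    proof
      assume "x \<in> Q"
      then have "x + y \<in> Q" using ideal_ring_of_integersD(3)[OF L(1), folded R_def, OF idQ _ Q(3)] by simp
      then have "of_int (2 * a) \<in> Q" by (simp add: x_def y_def)
      then have "l dvd 2 * a" using iff by blast
      then have la: "l dvd a" using l(1) l2 by (simp add: prime_dvd_mult_iff)
      then have "l dvd N - a * a" using True by simp
      then have "l dvd (2 * d) * (b * b)" by (simp add: N_def power2_eq_square)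
      then have "l dvd b" using l by (simp add: prime_dvd_mult_iff)
      then show False using ab_l la by blast
    qed
    then show ?thesis using that[of Q] Q by (simp add: x_def R_def)
  qed
qed

text \<open>Here \<open>l\<close> itself generates the prime of \<open>S\<close> locally. For
  \<open>x\<close> in that prime with conjugate outside \<open>Q\<close>, the norm is a multiple of
  \<open>l\<close> and the conjugate a local unit; if the conjugate is in \<open>Q\<close> too, then
  \<open>l\<close> divides \<open>x\<close>.\<close>

lemma no_odd_valuation_unramified_prime:
  fixes l :: int
  assumes L: "subfield L complex_field" "\<theta> \<in> L" and fd: "CF.finite_dimension \<rat> L"
    and Q: "maximalideal Q (ring_of_integers L)" and l: "Factorial_Ring.prime l" "of_int l \<in> Q" "\<not> l dvd 2 * d"
    and unram: "ramification_index S L Q = 1"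
    and u: "u1 \<in> \<O> L" "u1 \<notin> Q" "u2 \<in> \<O> L" "u2 \<notin> Q"
    and delta: "\<delta> \<in> L" "u1 * \<delta>\<^sup>2 = u2 * of_int l"
  shows False
proof (rule unramified_no_odd_valuation[OF L(1) fd subfield_S Q l(1,2) unram l(2) _ u delta])
  define R where "R = ring_of_integers L"
  note cl = ring_of_integers_closed[OF L(1), folded R_def]
  have idQ: "ideal Q R" using Q by (simp add: maximalideal_def R_def)
  note QD = ideal_ring_of_integersD[OF L(1), folded R_def, OF idQ]
  note iff = of_int_mem_maximalideal_iff[OF L(1) Q l(1,2)]
  fix x assume "x \<in> prime_below S Q"
  then have x: "x \<in> S" "algebraic_int x" "x \<in> Q" by (auto simp: prime_below_def)
  obtain f g where fg: "x = of_int f + of_int g * \<theta>" using ring_of_integers_S[OF x(1,2)] .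
  define y where "y = of_int f - of_int g * \<theta>"
  have y: "y \<in> carrier R" unfolding y_def R_def by (rule lin_mem_ring[OF L])
  have xy: "x * y = of_int (f\<^sup>2 + 2 * d * g\<^sup>2)" unfolding fg y_def by (rule norm_lin)
  have "x * y \<in> Q" by (rule QD(5)[OF y x(3)])
  then have "of_int (f\<^sup>2 + 2 * d * g\<^sup>2) \<in> Q" by (simp only: xy)
  then have lN: "l dvd f\<^sup>2 + 2 * d * g\<^sup>2" using iff by blast
  then obtain N' where N': "f\<^sup>2 + 2 * d * g\<^sup>2 = l * N'" ..
  have l2: "\<not> l dvd 2" using l(3) by (meson dvd_mult2)
  show "\<exists>t z. t \<in> \<O> L \<and> t \<notin> Q \<and> z \<in> \<O> L \<and> t * x = z * of_int l"
  proof (cases "y \<in> Q")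
    case False
    have "x * y = of_int (l * N')" using xy by (simp only: N')
    then have "y * x = of_int N' * of_int l" by (simp only: of_int_mult mult.commute)
    then show ?thesis using y False cl(5)[of N'] unfolding R_def by blast
  next
    case True
    then have "x + y \<in> Q" using x(3) by (intro QD(3))
    then have "of_int (2 * f) \<in> Q" by (simp add: fg y_def)
    then have "l dvd 2 * f" using iff by blast
    then have lf: "l dvd f" using l(1) l2 by (simp add: prime_dvd_mult_iff)
    then have "l dvd (f\<^sup>2 + 2 * d * g\<^sup>2) - f * f" using lN by simp
    then have "l dvd (2 * d) * (g * g)" by (simp add: power2_eq_square)
    then have "l dvd g" using l(1,3) by (simp add: prime_dvd_mult_iff)
    then obtain f' g' where fg': "f = l * f'" "g = l * g'" using lf by (auto simp: dvd_def)
    have "1 * x = (of_int f' + of_int g' * \<theta>) * of_int l" by (simp add: fg fg' algebra_simps)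
    moreover have "1 \<notin> Q" using iff[of 1] l(1) not_prime_unit[of l] by auto
    ultimately show ?thesis using cl(7) lin_mem_ring(1)[OF L, of f' g'] unfolding R_def by blast
  qed
qed

text \<open>Here \<open>\<theta>\<close> is the local generator: its square is
  \<open>- 2 * d\<close>, which contains \<open>l\<close> exactly once, so \<open>l\<close> is the
  square of \<open>\<theta>\<close> up to the unit \<open>- m\<close>.\<close>

lemma no_odd_valuation_ramified_prime:
  fixes l :: int
  assumes L: "subfield L complex_field" "\<theta> \<in> L" and fd: "CF.finite_dimension \<rat> L"
    and Q: "maximalideal Q (ring_of_integers L)" and l: "Factorial_Ring.prime l" "of_int l \<in> Q" "l dvd 2 * d"
    and unram: "ramification_index S L Q = 1"
    and u: "u1 \<in> \<O> L" "u1 \<notin> Q" "u2 \<in> \<O> L" "u2 \<notin> Q"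
    and delta: "\<delta> \<in> L" "u1 * \<delta>\<^sup>2 = u2 * \<theta>"
  shows False
proof -
  define R where "R = ring_of_integers L"
  note cl = ring_of_integers_closed[OF L(1), folded R_def]
  have idQ: "ideal Q R" using Q by (simp add: maximalideal_def R_def)
  note QD = ideal_ring_of_integersD[OF L(1), folded R_def, OF idQ]
  note iff = of_int_mem_maximalideal_iff[OF L(1) Q l(1,2)]
  obtain m where m: "2 * d = l * m" "\<not> l dvd m" using squarefree_prime_cofactor[OF squarefree_2d l(1,3)] .
  have th: "\<theta> \<in> carrier R" unfolding R_def by (rule theta_mem_ring[OF L])
  have "\<theta> * \<theta> = of_int (- (2 * d))" using theta_theta by simp
  moreover have "of_int (- (2 * d)) \<in> Q" using iff[of "- (2 * d)"] l(3) by (simp only: dvd_minus_iff)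
  ultimately have "\<theta> * \<theta> \<in> Q" by simp
  then have thQ: "\<theta> \<in> Q" using maximalideal_mult_notin[OF L(1) Q th[unfolded R_def] th[unfolded R_def]] by blast
  show False
  proof (rule unramified_no_odd_valuation[OF L(1) fd subfield_S Q l(1,2) unram thQ _ u delta])
    fix x assume "x \<in> prime_below S Q"
    then have x: "x \<in> S" "algebraic_int x" "x \<in> Q" by (auto simp: prime_below_def)
    obtain f g where fg: "x = of_int f + of_int g * \<theta>" using ring_of_integers_S[OF x(1,2)] .
    have "x - of_int g * \<theta> \<in> Q" by (rule QD(7)[OF x(3) QD(4)[OF cl(5) thQ]])
    then have "l dvd f" using iff[of f] by (simp add: fg)
    then obtain f' where f': "f = l * f'" ..
    have "of_int m * of_int f = - of_int f' * (\<theta> * \<theta>)"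
    proof -
      have "m * f = (2 * d) * f'" by (simp add: f' m(1))
      then have "(of_int (m * f) :: complex) = of_int ((2 * d) * f')" by (simp only:)
      then show ?thesis unfolding theta_theta by simp
    qed
    moreover have "of_int m * x = of_int m * of_int f + of_int (m * g) * \<theta>"
      by (simp add: fg algebra_simps)
    moreover have "- of_int f' * (\<theta> * \<theta>) + of_int (m * g) * \<theta> = (of_int (m * g) - of_int f' * \<theta>) * \<theta>"
      by (simp add: algebra_simps)
    ultimately have "of_int m * x = (of_int (m * g) - of_int f' * \<theta>) * \<theta>" by (simp only:)
    moreover have "of_int m \<notin> Q" using iff m(2) by blast
    ultimately show "\<exists>t z. t \<in> \<O> L \<and> t \<notin> Q \<and> z \<in> \<O> L \<and> t * x = z * \<theta>"
      using cl(5)[of m] lin_mem_ring(2)[OF L, of "m * g" f'] unfolding R_def by blast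
  qed
qed

end

section \<open>Quadratic reciprocity modulo 8\<close>

text \<open>On odd integers this is the Kronecker symbol (2/n), which does not change with the sign
  of \<open>n\<close>. For even \<open>n\<close> the value -1 is a mere default.\<close>

definition chi8 :: "int \<Rightarrow> int" where
  "chi8 n = (if n mod 8 = 1 \<or> n mod 8 = 7 then 1 else - 1)"

lemma chi8_mult:
  assumes "odd a" "odd b"
  shows "chi8 (a * b) = chi8 a * chi8 b"
proof -
  have *: "n mod 8 = 1 \<or> n mod 8 = 3 \<or> n mod 8 = 5 \<or> n mod 8 = 7" if "odd n" for n :: int
    using that by presburger
  have "(a * b) mod 8 = ((a mod 8) * (b mod 8)) mod 8" by (simp add: mod_mult_eq)
  then show ?thesis using *[OF assms(1)] *[OF assms(2)] by (elim disjE) (simp_all add: chi8_def)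
qed

lemma chi8_unit: "is_unit (u::int) \<Longrightarrow> chi8 u = 1"
  by (cases "u = 1 \<or> u = - 1") (auto simp: chi8_def)

text \<open>Gauss's lemma: doubling 1, ..., \<open>m\<close> does not wrap around modulo
  \<open>p = 2 m + 1\<close>, so the residues counted in \<open>E\<close> are the doubles of the
  numbers above \<open>m div 2\<close>. The parity of their number is read off from \<open>p\<close>
  modulo 8.\<close>

lemma Legendre_2:
  assumes "Factorial_Ring.prime (p::nat)" "p > 2"
  shows "Legendre 2 (int p) = chi8 (int p)"
proof -
  interpret GAUSS p 2
  proof
    show "[2 \<noteq> 0] (mod int p)" using assms(2) zdvd_imp_le[of "int p" 2] by (auto simp: cong_0_iff)
  qed (use assms in auto)
  define m where "m = (int p - 1) div 2"
  have m: "int p = 2 * m + 1" using p_eq2 by (simp add: m_def)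
  have "E = (\<lambda>x. x * 2) ` {m div 2<..m}"
  proof -
    have C_eq: "C = (\<lambda>x. x * 2) ` {0<..m}"
      unfolding C_def B_def A_def image_image m_def[symmetric]
      by (intro image_cong) (auto simp: m)
    show ?thesis
      unfolding E_def m_def[symmetric] C_eq using m assms(2) by auto
  qed
  moreover have "inj_on (\<lambda>x. x * 2) {m div 2<..m}" by (auto simp: inj_on_def)
  ultimately have "card E = nat (m - m div 2)" by (simp add: card_image)
  then have leg: "Legendre 2 (int p) = (- 1) ^ nat (m - m div 2)" using gauss_lemma by simp
  have "m - m div 2 \<ge> 0" using m assms(2) by linarith
  then have "even (nat (m - m div 2)) \<longleftrightarrow> even (m - m div 2)" by (simp add: even_nat_iff)
  also have "\<dots> \<longleftrightarrow> (2 * m + 1) mod 8 = 1 \<or> (2 * m + 1) mod 8 = 7" by presburger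
  finally show ?thesis using leg by (simp add: chi8_def m)
qed

lemma Legendre_cong:
  assumes "[a = b] (mod p)"
  shows "Legendre a p = Legendre b p"
proof -
  have "[a = 0] (mod p) \<longleftrightarrow> [b = 0] (mod p)" using assms cong_trans cong_sym by blast
  moreover have "QuadRes p a \<longleftrightarrow> QuadRes p b" unfolding QuadRes_def using assms cong_trans cong_sym by meson
  ultimately show ?thesis by (simp add: Legendre_def)
qed

lemma Legendre_values: "Legendre a p = 0 \<or> Legendre a p = 1 \<or> Legendre a p = - 1"
  by (simp add: Legendre_def)

text \<open>Euler's criterion gives the identity modulo \<open>p\<close>; both sides lie between -1
  and 1, and \<open>p > 2\<close> turns the congruence into equality.\<close>

lemma Legendre_mult_int:
  fixes p :: int
  assumes "Factorial_Ring.prime p" "p > 2"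
  shows "Legendre (a * b) p = Legendre a p * Legendre b p"
proof -
  define q where "q = nat p"
  have q: "p = int q" "Factorial_Ring.prime q" "2 < q" using assms by (auto simp: q_def)
  have "[Legendre (a * b) p = (a * b) ^ ((q - 1) div 2)] (mod p)"
    unfolding q(1) by (rule euler_criterion[OF q(2,3)])
  moreover have "[Legendre a p * Legendre b p = a ^ ((q - 1) div 2) * b ^ ((q - 1) div 2)] (mod p)"
    unfolding q(1) by (intro cong_mult euler_criterion[OF q(2,3)])
  ultimately have "[Legendre (a * b) p = Legendre a p * Legendre b p] (mod p)"
    by (metis cong_sym cong_trans power_mult_distrib)
  then have "p dvd Legendre (a * b) p - Legendre a p * Legendre b p" by (simp add: cong_iff_dvd_diff)
  moreover have "\<bar>Legendre (a * b) p - Legendre a p * Legendre b p\<bar> \<le> 2"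
    using Legendre_values[of "a * b" p] Legendre_values[of a p] Legendre_values[of b p] by auto
  ultimately show ?thesis using assms(2) zdvd_imp_le[of p "\<bar>Legendre (a * b) p - Legendre a p * Legendre b p\<bar>"]
    by (cases "Legendre (a * b) p - Legendre a p * Legendre b p = 0") auto
qed

lemma Legendre_eq_1I:
  fixes p :: int
  assumes "p dvd k\<^sup>2 - a" "\<not> p dvd a"
  shows "Legendre a p = 1"
proof -
  have "QuadRes p a" unfolding QuadRes_def using assms(1) by (auto simp: cong_iff_dvd_diff)
  then show ?thesis using assms(2) by (simp add: Legendre_def cong_0_iff)
qed

lemma Legendre_square_mult:
  fixes p :: int
  assumes "Factorial_Ring.prime p" "p > 2" "\<not> p dvd b"
  shows "Legendre (b\<^sup>2 * a) p = Legendre a p"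
proof -
  have "\<not> p dvd b\<^sup>2" using assms(1,3) prime_dvd_power by blast
  then have "Legendre (b\<^sup>2) p = 1" by (intro Legendre_eq_1I[of _ b]) auto
  then show ?thesis using Legendre_mult_int[OF assms(1,2)] by simp
qed

lemma Legendre_one_mod_4_reciprocity:
  fixes G q :: int
  assumes G: "Factorial_Ring.prime G" "G mod 4 = 1" and q: "Factorial_Ring.prime q" "odd q" "q \<noteq> G"
  shows "Legendre q G = Legendre G q"
proof -
  have G2: "G > 2" using prime_ge_2_int[OF G(1)] G(2) by (cases "G = 2") auto
  have q2: "q > 2" using prime_ge_2_int[OF q(1)] q(2) by (cases "q = 2") auto
  have "even ((G - 1) div 2)" using G(2) by presburger
  moreover have "(G - 1) div 2 \<ge> 0" "(q - 1) div 2 \<ge> 0" using G2 q2 by auto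
  ultimately have ev: "even (nat ((q - 1) div 2 * ((G - 1) div 2)))" by (simp add: even_nat_iff)
  have "Legendre q G * Legendre G q = (-1) ^ nat ((q - 1) div 2 * ((G - 1) div 2))"
    using G q q2 G2 by (intro Quadratic_Reciprocity_int) auto
  then have "Legendre q G * Legendre G q = 1" using ev by simp
  then show ?thesis by (auto simp: Legendre_def split: if_splits)
qed

lemma Legendre_minus_one:
  fixes G :: int
  assumes "Factorial_Ring.prime G" "G mod 4 = 1"
  shows "Legendre (- 1) G = 1"
proof -
  have G2: "G > 2" using prime_ge_2_int[OF assms(1)] assms(2) by (cases "G = 2") auto
  define q where "q = nat G"
  have q: "G = int q" "Factorial_Ring.prime q" "2 < q" using assms G2 by (auto simp: q_def)
  have "q mod 4 = 1" using assms(2) q(1) by presburger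
  then have "even ((q - 1) div 2)" by presburger
  then have "[Legendre (- 1) G = 1] (mod G)"
    unfolding q(1) using euler_criterion[OF q(2,3), of "-1"] by simp
  then have "G dvd Legendre (- 1) G - 1" by (simp add: cong_iff_dvd_diff)
  moreover have "\<bar>Legendre (- 1) G - 1\<bar> \<le> 2" using Legendre_values[of "- 1" G] by auto
  ultimately show ?thesis using G2 zdvd_imp_le[of G "\<bar>Legendre (- 1) G - 1\<bar>"]
    by (cases "Legendre (- 1) G - 1 = 0") auto
qed

lemma Legendre_unit:
  fixes G :: int
  assumes "Factorial_Ring.prime G" "G mod 4 = 1" "is_unit u"
  shows "Legendre u G = 1"
proof (cases "u = - 1")
  case False
  then have "u = 1" using assms(3) by auto
  moreover have "\<not> G dvd 1" using assms(1) not_prime_unit by blast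
  ultimately show ?thesis by (intro Legendre_eq_1I[of _ 1]) auto
qed (use Legendre_minus_one[OF assms(1,2)] in simp)

text \<open>Both sides are multiplicative. Negative \<open>A\<close> is allowed, because -1 is a
  square modulo \<open>G\<close> and \<open>chi8\<close> ignores signs.\<close>

lemma Legendre_eq_chi8:
  fixes G A :: int
  assumes G: "Factorial_Ring.prime G" "G mod 4 = 1"
  shows "odd A \<Longrightarrow> (\<And>q. Factorial_Ring.prime q \<Longrightarrow> q dvd A \<Longrightarrow> Legendre q G = chi8 q) \<Longrightarrow>
    Legendre A G = chi8 A"
proof (induction A rule: prime_divisors_induct)
  case (unit u)
  then show ?case using Legendre_unit[OF G unit(1)] chi8_unit by simp
next
  case (factor q x)
  have G2: "G > 2" using prime_ge_2_int[OF G(1)] G(2) by (cases "G = 2") auto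
  have "odd q" "odd x" using factor.prems(1) by auto
  have "Legendre x G = chi8 x" using factor.prems(2) \<open>odd x\<close> by (intro factor.IH) auto
  moreover have "Legendre q G = chi8 q" using factor by auto
  ultimately show ?case
    using chi8_mult[OF \<open>odd q\<close> \<open>odd x\<close>] Legendre_mult_int[OF G(1) G2] by simp
qed auto

text \<open>Reciprocity flips the symbols of the odd prime divisors, and the prime 2 is a square
  modulo \<open>G\<close> because \<open>G\<close> is 1 modulo 8.\<close>

lemma Legendre_eq_1_by_prime_divisors:
  fixes G A :: int
  assumes G: "Factorial_Ring.prime G" "G mod 8 = 1"
  shows "A \<noteq> 0 \<Longrightarrow> \<not> G dvd A \<Longrightarrow>
    (\<And>q. Factorial_Ring.prime q \<Longrightarrow> odd q \<Longrightarrow> q dvd A \<Longrightarrow> Legendre G q = 1) \<Longrightarrow> Legendre A G = 1"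
proof (induction A rule: prime_divisors_induct)
  case (unit u)
  have "G mod 4 = 1" using G(2) by presburger
  then show ?case using Legendre_unit[OF G(1)] unit(1) by simp
next
  case (factor q x)
  have G4: "G mod 4 = 1" using G(2) by presburger
  have G2: "G > 2" using prime_ge_2_int[OF G(1)] G(2) by (cases "G = 2") auto
  have "Legendre x G = 1" using factor.prems by (intro factor.IH) auto
  moreover have "Legendre q G = 1"
  proof (cases "odd q")
    case True
    have "q \<noteq> G" using factor.prems(2) by auto
    then show ?thesis
      using Legendre_one_mod_4_reciprocity[OF G(1) G4 factor.hyps True] factor.prems(3)[OF factor.hyps True] by simp
  next
    case False
    then have "2 dvd q" by simp
    then have "q = 2" using factor.hyps by (metis primes_dvd_imp_eq two_is_prime_nat prime_int_numeral_eq)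
    then show ?thesis using Legendre_2[of "nat G"] G G2 by (simp add: chi8_def)
  qed
  ultimately show ?case using Legendre_mult_int[OF G(1) G2] by simp
qed auto

lemma chi8_eq_1_by_prime_divisors:
  "odd b \<Longrightarrow> (\<And>q. Factorial_Ring.prime q \<Longrightarrow> q dvd b \<Longrightarrow> chi8 q = 1) \<Longrightarrow> chi8 b = 1"
proof (induction b rule: prime_divisors_induct)
  case (unit u)
  then show ?case by (simp add: chi8_unit)
next
  case (factor q x)
  have "odd q" "odd x" using factor.prems(1) by auto
  have "chi8 x = 1" using factor.prems(2) \<open>odd x\<close> by (intro factor.IH) auto
  then show ?case using factor chi8_mult[OF \<open>odd q\<close> \<open>odd x\<close>] by simp
qed auto

section \<open>Primes represented by the form x^2 + d y^2\<close>

lemma prime_dvd_square_iff: "Factorial_Ring.prime q \<Longrightarrow> q dvd (x::int)\<^sup>2 \<longleftrightarrow> q dvd x"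
  by (rule prime_dvd_power_iff) auto

lemma odd_prime_gt_2: "Factorial_Ring.prime q \<Longrightarrow> odd q \<Longrightarrow> (q::int) > 2"
  using prime_ge_2_int[of q] by (cases "q = 2") auto

text \<open>Modulo \<open>q\<close> the number 2 is the square of \<open>n / a\<close>. This is
  applied to prime divisors of \<open>b\<close>, where
  \<open>d * b^2 = n^2 - 2 * a^2\<close>.\<close>

lemma chi8_eq_1_if_dvd_square_minus_double_square:
  fixes q :: int
  assumes q: "Factorial_Ring.prime q" "odd q" "q dvd n\<^sup>2 - 2 * a\<^sup>2" "\<not> q dvd a"
  shows "chi8 q = 1"
proof -
  have q2: "q > 2" by (rule odd_prime_gt_2[OF q(1,2)])
  have nq: "\<not> q dvd 2" using q2 zdvd_imp_le[of q 2] by auto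
  have "\<not> q dvd a\<^sup>2" using q(1,4) prime_dvd_power by blast
  then have "\<not> q dvd a\<^sup>2 * 2" using q(1) nq by (simp add: prime_dvd_mult_iff)
  then have "Legendre (a\<^sup>2 * 2) q = 1"
    using q(3) by (intro Legendre_eq_1I[of _ n]) (simp_all add: mult.commute)
  then have "Legendre 2 q = 1" using Legendre_square_mult[OF q(1) q2 q(4), of 2] by simp
  then show ?thesis using Legendre_2[of "nat q"] q q2 by simp
qed

text \<open>Squares modulo 8 are 0, 1, 4, and x^2 + 7 y^2 \<equiv> 1 leaves only y^2 \<equiv> 0, so
  4 divides \<open>y\<close>. Then 16 divides \<open>y^2\<close>, so x^2 \<equiv> 1 modulo 16, which
  is what pins \<open>x\<close> down to 1 or 7 modulo 8.\<close>

lemma square_plus_7_mod_8: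
  fixes G d x y :: int
  assumes "G mod 16 = 1" "d mod 8 = 7" "G = x\<^sup>2 + d * y\<^sup>2"
  obtains z where "y = 4 * z" "x mod 8 = 1 \<or> x mod 8 = 7"
proof -
  obtain e where e: "d = 8 * e + 7" using assms(2) by (metis mult_div_mod_eq)
  have sq: "w\<^sup>2 mod 8 = (if odd w then 1 else if 4 dvd w then 0 else 4)" for w :: int
  proof -
    have "w\<^sup>2 mod 8 = ((w mod 8) * (w mod 8)) mod 8" by (simp add: power2_eq_square mod_mult_eq)
    moreover have "w mod 8 = 0 \<or> w mod 8 = 1 \<or> w mod 8 = 2 \<or> w mod 8 = 3 \<or> w mod 8 = 4 \<or>
      w mod 8 = 5 \<or> w mod 8 = 6 \<or> w mod 8 = 7" by presburger
    moreover have "odd w = odd (w mod 8)" "4 dvd w \<longleftrightarrow> 4 dvd w mod 8" by presburger+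
    ultimately show ?thesis by (elim disjE) simp_all
  qed
  have G8: "(x\<^sup>2 + 7 * y\<^sup>2) mod 8 = 1"
  proof -
    have "x\<^sup>2 + 7 * y\<^sup>2 = G - 8 * (e * y\<^sup>2)" using assms(3) e by (simp add: algebra_simps)
    moreover have "(g - 8 * t) mod 8 = 1" if "g mod 16 = 1" for g t :: int using that by presburger
    ultimately show ?thesis using assms(1) by simp
  qed
  have add: False if "(u + 7 * v) mod 8 = 1" "u mod 8 = 0 \<or> u mod 8 = 1 \<or> u mod 8 = 4" "v mod 8 = 1 \<or> v mod 8 = 4"
    for u v :: int using that by presburger
  have add': "u mod 8 = 1" if "(u + 7 * v) mod 8 = 1" "v mod 8 = 0" for u v :: int using that by presburger
  have X: "x\<^sup>2 mod 8 = 0 \<or> x\<^sup>2 mod 8 = 1 \<or> x\<^sup>2 mod 8 = 4" using sq[of x] by simp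
  have xy: "odd x" "4 dvd y"
  proof -
    show y: "4 dvd y"
    proof (rule ccontr)
      assume "\<not> 4 dvd y"
      then have "y\<^sup>2 mod 8 = 1 \<or> y\<^sup>2 mod 8 = 4" using sq[of y] by simp
      then show False using add[OF G8 X] by blast
    qed
    then have "even y" by presburger
    then have "y\<^sup>2 mod 8 = 0" using sq[of y] y by simp
    then have "x\<^sup>2 mod 8 = 1" by (rule add'[OF G8])
    then show "odd x" using sq[of x] by (simp split: if_splits)
  qed
  obtain z where z: "y = 4 * z" using xy(2) ..
  have "x\<^sup>2 = G - 16 * (d * z\<^sup>2)" using assms(3) z by (simp add: power2_eq_square)
  moreover have "(g - 16 * t) mod 16 = 1" if "g mod 16 = 1" for g t :: int using that by presburger
  ultimately have "x\<^sup>2 mod 16 = 1" using assms(1) by simp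
  moreover have "x mod 16 = 1 \<or> x mod 16 = 3 \<or> x mod 16 = 5 \<or> x mod 16 = 7 \<or> x mod 16 = 9 \<or> x mod 16 = 11 \<or>
    x mod 16 = 13 \<or> x mod 16 = 15" using xy(1) by presburger
  moreover have "x\<^sup>2 mod 16 = ((x mod 16) * (x mod 16)) mod 16" by (simp add: power2_eq_square mod_mult_eq)
  ultimately have "x mod 16 = 1 \<or> x mod 16 = 7 \<or> x mod 16 = 9 \<or> x mod 16 = 15"
    by (elim disjE) simp_all
  moreover have "x mod 8 = (x mod 16) mod 8" by (simp add: mod_mod_cancel)
  ultimately have "x mod 8 = 1 \<or> x mod 8 = 7" by (elim disjE) simp_all
  then show ?thesis using that z by blast
qed

text \<open>If \<open>G\<close> divided \<open>d\<close>, it would divide \<open>x\<close> as well,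
  and cancelling \<open>G\<close> would write 1 as \<open>G * x1^2 + d1 * y^2\<close>. The second
  term is a positive multiple of 16.\<close>

lemma prime_not_dvd_form_coefficient:
  fixes G d x y :: int
  assumes G: "Factorial_Ring.prime G" "G mod 16 = 1" "G = x\<^sup>2 + d * y\<^sup>2"
    and d: "d mod 8 = 7" "d > 0" and "y \<noteq> 0"
  shows "\<not> G dvd d"
proof
  assume Gd: "G dvd d"
  obtain z where z: "y = 4 * z" using square_plus_7_mod_8[OF G(2) d(1) G(3)] by blast
  have G2: "G > 0" using prime_gt_0_int[OF G(1)] .
  from Gd have "G dvd G - d * y\<^sup>2" by simp
  then have "G dvd x\<^sup>2" by (simp add: G(3))
  then have "G dvd x" using prime_dvd_square_iff[OF G(1)] by blast
  then obtain x1 where x1: "x = G * x1" ..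
  obtain d1 where d1: "d = G * d1" using Gd ..
  have "G * 1 = G * (G * x1\<^sup>2 + d1 * y\<^sup>2)"
    using G(3) by (simp add: x1 d1 power2_eq_square algebra_simps)
  then have one: "G * x1\<^sup>2 + d1 * y\<^sup>2 = 1" using G2 by (subst (asm) mult_cancel_left) auto
  have "d1 > 0" using d(2) d1 G2 by (simp add: zero_less_mult_iff)
  moreover have "z\<^sup>2 > 0" using \<open>y \<noteq> 0\<close> z by simp
  ultimately have "d1 * z\<^sup>2 > 0" by simp
  moreover have "d1 * y\<^sup>2 = 16 * (d1 * z\<^sup>2)" by (simp add: z power2_eq_square)
  moreover have "G * x1\<^sup>2 \<ge> 0" using G2 by simp
  ultimately show False using one by linarith
qed

text \<open>The symbol of \<open>A = e * y - b * x'\<close> at \<open>G\<close> is evaluated twice: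
  the square condition makes it 1, reciprocity at the prime divisors of \<open>A\<close> makes it
  \<open>chi8 A\<close>. So \<open>A\<close> is 1 or 7 modulo 8. Here \<open>\<kappa>\<close> is an
  integer root of \<open>- d\<close> modulo \<open>G\<close>, and \<open>a\<close> is half the
  coefficient of the radicand.\<close>

lemma eight_dvd_if_square:
  fixes G d x y n a b c k \<kappa> :: int
  assumes G: "Factorial_Ring.prime G" "G mod 16 = 1" "G = x\<^sup>2 + d * y\<^sup>2"
    and d: "d mod 8 = 7" "d > 0"
    and nab: "d * b\<^sup>2 = n\<^sup>2 - 2 * a\<^sup>2" "Rings.coprime a b" "odd b" "\<not> G dvd n + a"
    and kappa: "G dvd \<kappa>\<^sup>2 + d"
    and sq: "G dvd k\<^sup>2 - 4 * c * (n + 2 * a + b * \<kappa>)"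
    and c: "c \<noteq> 0" "\<And>q. Factorial_Ring.prime q \<Longrightarrow> odd q \<Longrightarrow> q dvd c \<Longrightarrow> q dvd d"
  shows "8 dvd y"
proof (cases "y = 0")
  case False
  \<comment> \<open>The norm of \<open>e + b * \<kappa>\<close> from \<rat>(\<kappa>) is twice a
    square, as \<open>e2\<close> records.\<close>
  define e where "e = n + 2 * a"
  have e2: "e\<^sup>2 + d * b\<^sup>2 = 2 * (n + a)\<^sup>2"
    unfolding nab(1) e_def by (simp add: power2_eq_square algebra_simps)
  obtain z where z: "y = 4 * z" and x8: "x mod 8 = 1 \<or> x mod 8 = 7"
    using square_plus_7_mod_8[OF G(2) d(1) G(3)] by blast
  have G8: "G mod 8 = 1" "G mod 4 = 1" "odd G" using G(2) by presburger+
  have G2: "G > 2" by (rule odd_prime_gt_2[OF G(1) G8(3)])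
  have nG2: "\<not> G dvd 2" using zdvd_imp_le[of G 2] G2 by auto
  have not_dvd_both: False if q: "Factorial_Ring.prime q" "q dvd x" "q dvd y" for q
  proof -
    have "q\<^sup>2 dvd x\<^sup>2" "q\<^sup>2 dvd y\<^sup>2" using q(2,3) by simp_all
    then have qG: "q\<^sup>2 dvd G" unfolding G(3) by simp
    then have "q dvd G" by (metis dvd_mult_left power2_eq_square)
    then have "q = G" using primes_dvd_imp_eq[OF q(1) G(1)] by simp
    then show False using qG G2 zdvd_imp_le[of "G\<^sup>2" G] by (simp add: power2_eq_square)
  qed
  have nGy: "\<not> G dvd y"
  proof
    assume Gy: "G dvd y"
    then have "G dvd G - d * y\<^sup>2" by (simp add: power2_eq_square)
    then have "G dvd x\<^sup>2" by (simp add: G(3))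
    then show False using not_dvd_both[OF G(1) _ Gy] prime_dvd_square_iff[OF G(1)] by blast
  qed
  have nGd: "\<not> G dvd d" by (rule prime_not_dvd_form_coefficient[OF G d False])
  have nGc: "\<not> G dvd c" using c(2)[OF G(1) G8(3)] nGd by blast
  have "x\<^sup>2 - (\<kappa> * y)\<^sup>2 = G - (\<kappa>\<^sup>2 + d) * y\<^sup>2" by (simp add: G(3) power_mult_distrib algebra_simps)
  moreover have "G dvd G - (\<kappa>\<^sup>2 + d) * y\<^sup>2" using kappa by simp
  moreover have "(x + \<kappa> * y) * (x - \<kappa> * y) = x\<^sup>2 - (\<kappa> * y)\<^sup>2"
    by (simp add: power2_eq_square algebra_simps)
  ultimately have "G dvd (x + \<kappa> * y) * (x - \<kappa> * y)" by (simp only:)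
  then have "G dvd x + \<kappa> * y \<or> G dvd x - \<kappa> * y" using G(1) by (simp add: prime_dvd_mult_iff)
  then obtain x' where x': "x' = x \<or> x' = - x" "G dvd x' + \<kappa> * y"
  proof
    assume "G dvd x - \<kappa> * y"
    then have "G dvd - (x - \<kappa> * y)" by (simp only: dvd_minus_iff)
    then show ?thesis using that[of "- x"] by simp
  qed (use that[of x] in simp)
  have Gx': "G = x'\<^sup>2 + d * y\<^sup>2" using G(3) x'(1) by auto
  have x'8: "x' mod 8 = 1 \<or> x' mod 8 = 7" using x'(1) x8 by presburger
  have not_dvd_both': False if q: "Factorial_Ring.prime q" "q dvd x'" "q dvd y" for q
    using not_dvd_both[of q] q x'(1) by auto
  \<comment> \<open>Modulo \<open>G\<close> this is \<open>y * (e + b * \<kappa>)\<close>, with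
    \<open>\<kappa> * y\<close> replaced by \<open>- x'\<close>.\<close>
  define A where "A = e * y - b * x'"
  have A_eq: "A = y * (e + b * \<kappa>) - b * (x' + \<kappa> * y)" by (simp add: A_def algebra_simps)
  have nGA: "\<not> G dvd A"
  proof
    assume "G dvd A"
    then have "G dvd A + b * (x' + \<kappa> * y)" using x'(2) by simp
    then have "G dvd y * (e + b * \<kappa>)" by (simp add: A_eq)
    then have "G dvd e + b * \<kappa>" using G(1) nGy by (simp add: prime_dvd_mult_iff)
    then have "G dvd (e + b * \<kappa>) * (e - b * \<kappa>) + b\<^sup>2 * (\<kappa>\<^sup>2 + d)" using kappa by simp
    also have "(e + b * \<kappa>) * (e - b * \<kappa>) + b\<^sup>2 * (\<kappa>\<^sup>2 + d) = e\<^sup>2 + d * b\<^sup>2"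
      by (simp add: power2_eq_square algebra_simps)
    finally have "G dvd 2 * (n + a)\<^sup>2" by (simp only: e2)
    then show False using nG2 nab(4) G(1) by (simp add: prime_dvd_mult_iff prime_dvd_square_iff)
  qed
  \<comment> \<open>The square condition multiplied by \<open>y^2\<close>: now
    \<open>4 * c * y * A\<close> is a square modulo \<open>G\<close>, and the factor
    \<open>4 * c * y\<close> is handled through its prime divisors.\<close>
  have "G dvd y\<^sup>2 * (k\<^sup>2 - 4 * c * (e + b * \<kappa>)) + 4 * c * y * b * (x' + \<kappa> * y)"
    using sq x'(2) by (simp add: e_def)
  also have "\<dots> = (y * k)\<^sup>2 - (4 * c * y) * A"
    by (simp add: A_def power2_eq_square algebra_simps)
  finally have sqA: "G dvd (y * k)\<^sup>2 - (4 * c * y) * A" .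
  have nG4: "\<not> G dvd 4 * c * y"
  proof
    assume "G dvd 4 * c * y"
    then have "G dvd 2 * 2 * c * y" by simp
    then show False using G(1) nG2 nGc nGy by (simp only: prime_dvd_mult_iff) simp
  qed
  \<comment> \<open>Modulo a prime dividing \<open>d * y^2\<close>, the representation reads
    \<open>G \<equiv> x^2\<close>. This covers the odd primes of \<open>c\<close>, which divide
    \<open>d\<close>, and those of \<open>y\<close>.\<close>
  have leg_sq: "Legendre G q = 1" if q: "Factorial_Ring.prime q" "q dvd d * y\<^sup>2" "q \<noteq> G" for q
  proof (rule Legendre_eq_1I)
    show "q dvd x\<^sup>2 - G" using q(2) by (simp add: G(3))
    show "\<not> q dvd G" using q(3) primes_dvd_imp_eq[OF q(1) G(1)] by blast
  qed
  have "Legendre (4 * c * y) G = 1"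
  proof (rule Legendre_eq_1_by_prime_divisors[OF G(1) G8(1) _ nG4])
    show "4 * c * y \<noteq> 0" using c(1) False by simp
    fix q assume q: "Factorial_Ring.prime q" "odd q" "q dvd 4 * c * y"
    have "\<not> q dvd 2" using odd_prime_gt_2[OF q(1,2)] zdvd_imp_le[of q 2] by auto
    moreover have "q dvd 2 * 2 * c * y" using q(3) by simp
    ultimately have "q dvd c \<or> q dvd y" using q(1) by (simp only: prime_dvd_mult_iff) simp
    then have "q dvd d * y\<^sup>2" using c(2)[OF q(1,2)] by (auto simp: power2_eq_square)
    moreover have "q \<noteq> G" using q(3) nG4 by blast
    ultimately show "Legendre G q = 1" by (rule leg_sq[OF q(1)])
  qed
  moreover have "Legendre ((4 * c * y) * A) G = 1"
    using nG4 nGA G(1) by (intro Legendre_eq_1I[OF sqA]) (simp only: prime_dvd_mult_iff, simp)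
  ultimately have legA: "Legendre A G = 1" using Legendre_mult_int[OF G(1) G2, of "4 * c * y" A] by simp
  have qa: "\<not> q dvd a" if q: "Factorial_Ring.prime q" "q dvd b" for q
    using nab(2) q by (metis coprime_common_divisor not_prime_unit)
  have chib: "chi8 q = 1" if q: "Factorial_Ring.prime q" "q dvd b" for q
  proof (rule chi8_eq_1_if_dvd_square_minus_double_square[OF q(1) _ _ qa[OF q]])
    show "odd q" using q(2) nab(3) by (meson dvd_trans)
    show "q dvd n\<^sup>2 - 2 * a\<^sup>2" using q(2) nab(1) by (metis dvd_mult dvd_power dvd_trans zero_less_numeral)
  qed
  have "odd x'" using x'8 by presburger
  then have oddA: "odd A" using z nab(3) by (simp add: A_def)
  have "Legendre A G = chi8 A"
  proof (rule Legendre_eq_chi8[OF G(1) G8(2) oddA])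
    fix q assume q: "Factorial_Ring.prime q" "q dvd A"
    have oq: "odd q" using q(2) oddA by (meson dvd_trans)
    have q2: "q > 2" by (rule odd_prime_gt_2[OF q(1) oq])
    have qG: "q \<noteq> G" using q(2) nGA by blast
    have nqG: "\<not> q dvd G" using qG primes_dvd_imp_eq[OF q(1) G(1)] by blast
    have "Legendre q G = Legendre G q" by (rule Legendre_one_mod_4_reciprocity[OF G(1) G8(2) q(1) oq qG])
    also have "\<dots> = chi8 q"
    proof (cases "q dvd b")
      \<comment> \<open>Both symbols are 1: \<open>q\<close> divides \<open>e * y\<close> but not
        \<open>e\<close>, so it divides \<open>y\<close> and \<open>G\<close> is a square modulo
        \<open>q\<close>; and 2 is a square modulo \<open>q\<close> because \<open>q\<close> divides
        \<open>b\<close>.\<close>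
      case True
      have "\<not> q dvd e"
      proof
        assume qe: "q dvd e"
        have "q dvd e\<^sup>2 + d * b\<^sup>2" using qe True by (simp add: power2_eq_square)
        then have "q dvd 2 * (n + a)\<^sup>2" by (simp only: e2)
        moreover have "\<not> q dvd 2" using q2 zdvd_imp_le[of q 2] by auto
        ultimately have "q dvd n + a" using q(1) by (simp add: prime_dvd_mult_iff prime_dvd_square_iff)
        then have "q dvd e - (n + a)" using qe by simp
        then show False using qa[OF q(1) True] by (simp add: e_def)
      qed
      moreover have "q dvd A + b * x'" using q(2) True by simp
      ultimately have "q dvd y" using q(1) by (simp add: A_def prime_dvd_mult_iff)
      then have "Legendre G q = 1" by (intro leg_sq[OF q(1) _ qG]) (simp add: power2_eq_square)
      then show ?thesis using chib[OF q(1) True] by simp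
    next
      case False
      \<comment> \<open>Inserting the norm equation of \<open>e\<close> leaves
        \<open>(b * x')^2 - (e * y)^2\<close>, a difference of squares with \<open>A\<close> as a
        factor. So \<open>b^2 * G\<close> is twice a square modulo \<open>q\<close>.\<close>
      have "b\<^sup>2 * G - ((n + a) * y)\<^sup>2 * 2 = b\<^sup>2 * x'\<^sup>2 + (d * b\<^sup>2 - 2 * (n + a)\<^sup>2) * y\<^sup>2"
        unfolding Gx' by (simp add: power2_eq_square algebra_simps)
      also have "d * b\<^sup>2 - 2 * (n + a)\<^sup>2 = - e\<^sup>2" using e2 by simp
      also have "b\<^sup>2 * x'\<^sup>2 + - e\<^sup>2 * y\<^sup>2 = - (A * (e * y + b * x'))"
        by (simp add: A_def power2_eq_square algebra_simps)
      finally have dvd: "q dvd b\<^sup>2 * G - ((n + a) * y)\<^sup>2 * 2" using q(2) by simp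
      have "\<not> q dvd b\<^sup>2 * G" using q(1) False nqG by (simp add: prime_dvd_mult_iff prime_dvd_square_iff)
      then have "\<not> q dvd ((n + a) * y)\<^sup>2 * 2" using dvd by (metis dvd_diffD1 dvd_add_right_iff diff_add_cancel)
      then have ny: "\<not> q dvd (n + a) * y" by (auto simp: power2_eq_square)
      have "Legendre G q = Legendre (b\<^sup>2 * G) q" using Legendre_square_mult[OF q(1) q2 False] by simp
      also have "\<dots> = Legendre (((n + a) * y)\<^sup>2 * 2) q"
        using dvd by (intro Legendre_cong) (simp add: cong_iff_dvd_diff)
      also have "\<dots> = Legendre 2 q" by (rule Legendre_square_mult[OF q(1) q2 ny])
      also have "\<dots> = chi8 q" using Legendre_2[of "nat q"] q(1) q2 by simp
      finally show ?thesis .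
    qed
    finally show "Legendre q G = chi8 q" .
  qed
  then have "chi8 A = 1" using legA by simp
  then have A8: "A mod 8 = 1 \<or> A mod 8 = 7" by (simp add: chi8_def split: if_splits)
  have "chi8 b = 1" using nab(3) chib by (rule chi8_eq_1_by_prime_divisors)
  then have b8: "b mod 8 = 1 \<or> b mod 8 = 7" by (simp add: chi8_def split: if_splits)
  have "odd d" using d(1) by presburger
  then have "odd (d * b\<^sup>2)" using nab(3) by simp
  then have "odd e" by (simp add: e_def nab(1))
  then obtain e1 where e1: "e = 2 * e1 + 1" by (elim oddE)
  have "(b * x') mod 8 = ((b mod 8) * (x' mod 8)) mod 8" by (simp add: mod_mult_eq)
  then have bx: "(b * x') mod 8 = 1 \<or> (b * x') mod 8 = 7" using b8 x'8 by (elim disjE) simp_all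
  \<comment> \<open>With \<open>e\<close> odd and \<open>y = 4 * z\<close>, the term
    \<open>e * y\<close> is \<open>4 * z\<close> modulo 8; an odd \<open>z\<close> would put
    \<open>A\<close> and \<open>- b * x'\<close> 4 apart, impossible when both are 1 or 7 modulo
    8.\<close>
  have "A = 8 * (e1 * z) + 4 * z - b * x'" by (simp add: A_def e1 z algebra_simps)
  moreover have "even w" if "(8 * u + 4 * w - v) mod 8 = 1 \<or> (8 * u + 4 * w - v) mod 8 = 7" "v mod 8 = 1 \<or> v mod 8 = 7"
    for u v w :: int using that by presburger
  ultimately have "even z" using A8 bx by metis
  then show ?thesis by (auto simp: z)
qed simp

section \<open>Unramified quartic extensions\<close>

text \<open>The usual way of recognising a local unit below: a conjugate factor turns
  \<open>x\<close> into an integer prime to \<open>l\<close>.\<close>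

lemma notin_maximalideal_if_dvd:
  fixes l n :: int
  assumes L: "subfield L complex_field" and Q: "maximalideal Q (ring_of_integers L)"
    and l: "Factorial_Ring.prime l" "of_int l \<in> Q"
    and y: "y \<in> \<O> L" and xy: "x * y = of_int n" "\<not> l dvd n"
  shows "x \<notin> Q"
proof
  assume "x \<in> Q"
  moreover have "ideal Q (ring_of_integers L)" using Q by (simp add: maximalideal_def)
  ultimately have "x * y \<in> Q" using ideal_ring_of_integersD(5)[OF L _ y] by blast
  then show False using of_int_mem_maximalideal_iff[OF L Q l] xy by simp
qed

lemma squarefree_no_odd_prime_divisor:
  fixes n :: int
  assumes "squarefree n" "n > 0" "\<And>l. Factorial_Ring.prime l \<Longrightarrow> odd l \<Longrightarrow> \<not> l dvd n"
  shows "n = 1 \<or> n = 2"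
proof -
  have unit: "m = 1" if m: "m > 0" "odd m" "m dvd n" for m :: int
  proof (rule ccontr)
    assume "m \<noteq> 1"
    then have "\<not> is_unit m" using m(1) by auto
    then obtain q where q: "q dvd m" "Factorial_Ring.prime q" using m(1) prime_divisor_exists[of m] by auto
    then have "odd q" using m(2) by (meson dvd_trans)
    then show False using assms(3)[OF q(2)] dvd_trans[OF q(1) m(3)] by blast
  qed
  show ?thesis
  proof (cases "odd n")
    case True
    then show ?thesis using unit[of n] assms(2) by simp
  next
    case False
    have "Factorial_Ring.prime (2::int)" by simp
    then obtain m where m: "n = 2 * m" "\<not> 2 dvd m"
      using squarefree_prime_cofactor[OF assms(1), of 2] False by blast
    then have "m = 1" using unit[of m] assms(2) by simp
    then show ?thesis using m(1) by simp
  qed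
qed

context imaginary_quadratic
begin

text \<open>The radicand is a square in \<open>L\<close>, so its valuation is even at every prime.
  Testing this at odd primes of \<open>c\<close>, at odd primes of \<open>d\<close>, at 2, and at
  odd primes of the norm of \<open>a + b * \<theta>\<close> excludes every other shape; the norm
  comes out as twice a square.\<close>

lemma unramified_radical_norm_form:
  fixes a b c :: int
  assumes L: "subfield L complex_field" "\<theta> \<in> L" "s \<in> L" and fd: "CF.finite_dimension \<rat> L"
    and unram: "\<And>Q. maximalideal Q (ring_of_integers L) \<Longrightarrow> Q \<noteq> {0} \<Longrightarrow> ramification_index S L Q = 1"
    and c: "squarefree c" and ab: "Rings.coprime a b"
    and delta: "\<delta> \<in> L" "\<delta>\<^sup>2 = of_int c * (of_int a + of_int b * \<theta>) * (2 + s)"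
  obtains a' n where "a = 2 * a'" "odd b" "d * b\<^sup>2 = n\<^sup>2 - 2 * a'\<^sup>2"
    "\<And>q. Factorial_Ring.prime q \<Longrightarrow> odd q \<Longrightarrow> q dvd c \<Longrightarrow> q dvd d"
proof -
  define R where "R = ring_of_integers L"
  note cl = ring_of_integers_closed[OF L(1), folded R_def]
  note Lcl = subfield_complexD[OF L(1)]
  define x where "x = of_int a + of_int b * \<theta>"
  define y where "y = of_int a - of_int b * \<theta>"
  define N where "N = a\<^sup>2 + 2 * d * b\<^sup>2"
  have xy: "x * y = of_int N" unfolding x_def y_def N_def by (rule norm_lin)
  have x: "x \<in> carrier R" and y: "y \<in> carrier R"
    unfolding x_def y_def R_def by (rule lin_mem_ring[OF L(1,2)])+
  have th: "\<theta> \<in> carrier R" and sR: "s \<in> carrier R" and kR: "\<kappa> \<in> carrier R"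
    unfolding R_def using theta_mem_ring[OF L(1,2)] s_mem_ring[OF L(1,3)] kappa_mem_ring[OF L(1-3)] by blast+
  have s2: "2 + s \<in> carrier R" and s2': "2 - s \<in> carrier R" by (rule cl(1)[OF cl(8) sR] cl(3)[OF cl(8) sR])+
  have s2s2': "(2 + s) * (2 - s) = of_int 2" using s_s by (simp add: algebra_simps)
  have delta: "\<delta> \<in> L" "\<delta>\<^sup>2 = of_int c * x * (2 + s)" using delta by (simp_all add: x_def)
  have Q0: "Q \<noteq> {0}" if "of_int l \<in> Q" "Factorial_Ring.prime l" for l and Q :: "complex set"
    using that by auto
  have ab_l: False if "Factorial_Ring.prime l" "l dvd a" "l dvd b" for l
    using ab that by (metis coprime_common_divisor not_prime_unit)
  \<comment> \<open>At a prime \<open>Q\<close> above \<open>l\<close> avoiding \<open>x\<close>,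
    both \<open>x\<close> and \<open>2 + s\<close> (a divisor of 2) are units, so the squarefree
    \<open>c\<close> would contribute valuation one.\<close>
  have prime_c: "l dvd d" if l: "Factorial_Ring.prime l" "odd l" "l dvd c" for l
  proof (rule ccontr)
    assume "\<not> l dvd d"
    have l2: "\<not> l dvd 2" using odd_prime_gt_2[OF l(1,2)] zdvd_imp_le[of l 2] by auto
    then have l2d: "\<not> l dvd 2 * d" using \<open>\<not> l dvd d\<close> l(1) by (simp add: prime_dvd_mult_iff)
    obtain Q where Q: "maximalideal Q R" "of_int l \<in> Q" "x \<notin> Q"
      using maximalideal_avoiding[OF L(1,2) l(1) l2d ab] unfolding R_def x_def by blast
    note notin = maximalideal_mult_notin[OF L(1), folded R_def, OF Q(1)]
    note iff = of_int_mem_maximalideal_iff[OF L(1), folded R_def, OF Q(1) l(1) Q(2)]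
    obtain c' where c': "c = l * c'" "\<not> l dvd c'" using squarefree_prime_cofactor[OF c l(1,3)] .
    have s2Q: "2 + s \<notin> Q"
      using notin_maximalideal_if_dvd[OF L(1) Q(1)[unfolded R_def] l(1) Q(2) s2'[unfolded R_def] s2s2' l2] .
    have c'Q: "of_int c' \<notin> Q" using iff c'(2) by blast
    have eq: "1 * \<delta>\<^sup>2 = (of_int c' * x * (2 + s)) * of_int l" using delta(2) c'(1) by simp
    have one: "1 \<notin> Q" using iff[of 1] l(1) not_prime_unit[of l] by auto
    show False
      by (rule no_odd_valuation_unramified_prime[OF L(1,2) fd Q(1)[unfolded R_def] l(1) Q(2) l2d
            unram[OF Q(1)[unfolded R_def] Q0[OF Q(2) l(1)]], folded R_def,
            OF cl(7) one cl(2)[OF cl(2)[OF cl(5) x] s2] notin[OF cl(2)[OF cl(5) x] s2 notin[OF cl(5) x c'Q Q(3)] s2Q] delta(1) eq])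
  qed
  \<comment> \<open>If \<open>l\<close> divides \<open>a\<close>, then \<open>x\<close> is
    \<open>\<theta>\<close> times a local unit, since \<open>b\<close> is prime to \<open>l\<close>.
    The radicand then has valuation 1 or 3 in terms of \<open>\<theta>\<close>, according to whether
    \<open>l\<close> divides \<open>c\<close>.\<close>
  have nla: "\<not> l dvd a" if l: "Factorial_Ring.prime l" "odd l" "l dvd d" for l
  proof
    assume la: "l dvd a"
    then obtain a0 where a0: "a = l * a0" ..
    have l2: "\<not> l dvd 2" using odd_prime_gt_2[OF l(1,2)] zdvd_imp_le[of l 2] by auto
    have l2d: "l dvd 2 * d" using l(3) by simp
    obtain m where m: "2 * d = l * m" "\<not> l dvd m" using squarefree_prime_cofactor[OF squarefree_2d l(1) l2d] .
    obtain Q where Q: "maximalideal Q R" "of_int l \<in> Q"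
      using exists_maximalideal_over_prime[OF L(1) l(1)] unfolding R_def by blast
    have idQ: "ideal Q R" using Q(1) by (simp add: maximalideal_def)
    note QD = ideal_ring_of_integersD[OF L(1), folded R_def, OF idQ]
    note notin = maximalideal_mult_notin[OF L(1), folded R_def, OF Q(1)]
    note iff = of_int_mem_maximalideal_iff[OF L(1), folded R_def, OF Q(1) l(1) Q(2)]
    have tt: "\<theta> * \<theta> = of_int (- (l * m))" using theta_theta m(1) by (metis mult_minus_left of_int_minus of_int_mult of_int_numeral)
    have "of_int (- (l * m)) \<in> Q" using iff[of "- (l * m)"] by simp
    then have "\<theta> * \<theta> \<in> Q" by (simp only: tt)
    then have thQ: "\<theta> \<in> Q" using notin[OF th th] by blast
    define z where "z = of_int (m * b) - of_int a0 * \<theta>"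
    have zR: "z \<in> carrier R" unfolding z_def R_def by (rule lin_mem_ring(2)[OF L(1,2)])
    have "\<not> l dvd m * b" using l(1) m(2) ab_l[OF l(1) la] by (auto simp: prime_dvd_mult_iff)
    then have mbQ: "of_int (m * b) \<notin> Q" using iff by blast
    have zQ: "z \<notin> Q"
    proof
      assume "z \<in> Q"
      from QD(3)[OF this QD(4)[OF cl(5) thQ, of a0]] show False using mbQ by (simp add: z_def)
    qed
    have mx: "of_int m * x = z * \<theta>"
    proof -
      have "of_int m * x = of_int a0 * of_int (l * m) + of_int (m * b) * \<theta>"
        by (simp add: x_def a0 algebra_simps)
      also have "\<dots> = of_int (m * b) * \<theta> - of_int a0 * (\<theta> * \<theta>)" unfolding tt by simp
      also have "\<dots> = z * \<theta>" by (simp add: z_def algebra_simps)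
      finally show ?thesis .
    qed
    have s2Q: "2 + s \<notin> Q"
      using notin_maximalideal_if_dvd[OF L(1) Q(1)[unfolded R_def] l(1) Q(2) s2'[unfolded R_def] s2s2' l2] .
    have mQ: "of_int m \<notin> Q" using iff m(2) by blast
    note contra = no_odd_valuation_ramified_prime[OF L(1,2) fd Q(1)[unfolded R_def] l(1) Q(2) l2d
            unram[OF Q(1)[unfolded R_def] Q0[OF Q(2) l(1)]], folded R_def]
    have u2: "of_int e * (2 + s) * z \<in> carrier R" "of_int e * (2 + s) * z \<notin> Q" if "\<not> l dvd e" for e
    proof -
      have e: "of_int e \<notin> Q" using iff that by blast
      show "of_int e * (2 + s) * z \<in> carrier R" by (rule cl(2)[OF cl(2)[OF cl(5) s2] zR])
      show "of_int e * (2 + s) * z \<notin> Q" by (rule notin[OF cl(2)[OF cl(5) s2] zR notin[OF cl(5) s2 e s2Q] zQ])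
    qed
    show False
    proof (cases "l dvd c")
      case False
      have "of_int m * \<delta>\<^sup>2 = of_int c * (2 + s) * (of_int m * x)" unfolding delta(2) by (simp only: ac_simps)
      also have "\<dots> = (of_int c * (2 + s) * z) * \<theta>" unfolding mx by (simp only: ac_simps)
      finally show False by (rule contra[OF cl(5) mQ u2[OF False] delta(1)])
    next
      case True
      \<comment> \<open>The factor \<open>l\<close> of \<open>c\<close> is a unit times the square
        of \<open>\<theta>\<close>; dividing \<open>\<delta>\<close> by \<open>\<theta>\<close>
        removes it and leaves a single \<open>\<theta>\<close>.\<close>
      then obtain c' where c': "c = l * c'" "\<not> l dvd c'" using squarefree_prime_cofactor[OF c l(1)] by blast
      have mm: "of_int (m * m) \<notin> Q" using iff[of "m * m"] m(2) l(1) by (simp add: prime_dvd_mult_iff del: of_int_mult)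
      have "of_int (m * m) * \<delta>\<^sup>2 = of_int (- c') * (of_int (- (l * m))) * (2 + s) * (of_int m * x)"
        unfolding delta(2) c'(1) by simp
      also have "\<dots> = of_int (- c') * (\<theta> * \<theta>) * (2 + s) * (z * \<theta>)" unfolding mx tt ..
      finally have "of_int (m * m) * \<delta>\<^sup>2 = (\<theta> * \<theta>) * (of_int (- c') * (2 + s) * z * \<theta>)"
        by (simp only: ac_simps)
      then have eq: "of_int (m * m) * (\<delta> / \<theta>)\<^sup>2 = of_int (- c') * (2 + s) * z * \<theta>"
        using theta_nz by (simp add: power_divide power2_eq_square divide_simps)
      have nc: "\<not> l dvd - c'" using c'(2) by simp
      show False by (rule contra[OF cl(5) mm u2[OF nc] Lcl(8)[OF delta(1) L(2)] eq])
    qed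
  qed
  \<comment> \<open>Above 2 the elements \<open>\<kappa>\<close> and \<open>t = 1 + s\<close> are
    units, and \<open>2 + s = s * t\<close> with \<open>\<kappa> * s = \<theta>\<close>; so
    \<open>2 + s\<close> has the valuation of \<open>\<theta>\<close>. An odd \<open>a\<close> would
    make \<open>x\<close> a unit and leave this odd valuation unbalanced.\<close>
  have evena: "even a"
  proof (rule ccontr)
    assume odda: "odd a"
    have l: "Factorial_Ring.prime (2::int)" by simp
    have l2d: "2 dvd 2 * d" by simp
    obtain Q where Q: "maximalideal Q R" "of_int 2 \<in> Q"
      using exists_maximalideal_over_prime[OF L(1) l] unfolding R_def by blast
    have idQ: "ideal Q R" using Q(1) by (simp add: maximalideal_def)
    note QD = ideal_ring_of_integersD[OF L(1), folded R_def, OF idQ]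
    note notin = maximalideal_mult_notin[OF L(1), folded R_def, OF Q(1)]
    note iff = of_int_mem_maximalideal_iff[OF L(1), folded R_def, OF Q(1) l Q(2)]
    note nd = notin_maximalideal_if_dvd[OF L(1), folded R_def, OF Q(1) l Q(2)]
    have "\<not> 2 dvd N" using odda by (simp add: N_def)
    then have xQ: "x \<notin> Q" by (rule nd[OF y xy])
    have "\<kappa> * \<kappa> = of_int (- d)" using kappa_sq by (simp add: power2_eq_square)
    moreover have "\<not> 2 dvd - d" using d_odd by simp
    ultimately have kQ: "\<kappa> \<notin> Q" by (rule nd[OF kR])
    define t where "t = 1 + s"
    have tR: "t \<in> carrier R" unfolding t_def by (rule cl(1)[OF cl(7) sR])
    have "t * (s - 1) = of_int 1" using s_s by (simp add: t_def algebra_simps)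
    moreover have "\<not> 2 dvd (1::int)" by simp
    ultimately have tQ: "t \<notin> Q" by (rule nd[OF cl(3)[OF sR cl(7)]])
    have kst: "\<kappa> * (2 + s) = t * \<theta>"
    proof -
      have "2 + s = s * t" using s_s by (simp add: t_def algebra_simps)
      then have "\<kappa> * (2 + s) = (\<kappa> * s) * t" by (simp only: ac_simps)
      then show ?thesis unfolding kappa_s by (simp only: ac_simps)
    qed
    note contra = no_odd_valuation_ramified_prime[OF L(1,2) fd Q(1)[unfolded R_def] l Q(2) l2d
            unram[OF Q(1)[unfolded R_def] Q0[OF Q(2) l]], folded R_def]
    have u2: "of_int e * x * t \<in> carrier R" "of_int e * x * t \<notin> Q" if "odd e" for e
    proof -
      have e: "of_int e \<notin> Q" using iff that by blast
      show "of_int e * x * t \<in> carrier R" by (rule cl(2)[OF cl(2)[OF cl(5) x] tR])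
      show "of_int e * x * t \<notin> Q" by (rule notin[OF cl(2)[OF cl(5) x] tR notin[OF cl(5) x e xQ] tQ])
    qed
    show False
    proof (cases "odd c")
      case True
      have "\<kappa> * \<delta>\<^sup>2 = of_int c * x * (\<kappa> * (2 + s))" unfolding delta(2) by (simp only: ac_simps)
      also have "\<dots> = (of_int c * x * t) * \<theta>" unfolding kst by (simp only: ac_simps)
      finally show False by (rule contra[OF kR kQ u2[OF True] delta(1)])
    next
      case False
      then have "2 dvd c" by simp
      then obtain c' where c': "c = 2 * c'" "\<not> 2 dvd c'" using squarefree_prime_cofactor[OF c l] by blast
      have dQ: "of_int d \<notin> Q" using iff[of d] d_odd by blast
      have "(of_int d * \<kappa>) * \<delta>\<^sup>2 = of_int (- c') * (- 2 * of_int d) * x * (\<kappa> * (2 + s))"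
        unfolding delta(2) c'(1) by simp
      also have "\<dots> = of_int (- c') * (\<theta> * \<theta>) * x * (t * \<theta>)" unfolding kst theta_theta ..
      finally have "(of_int d * \<kappa>) * \<delta>\<^sup>2 = (\<theta> * \<theta>) * (of_int (- c') * x * t * \<theta>)"
        by (simp only: ac_simps)
      then have eq: "(of_int d * \<kappa>) * (\<delta> / \<theta>)\<^sup>2 = of_int (- c') * x * t * \<theta>"
        using theta_nz by (simp add: power_divide power2_eq_square divide_simps)
      have nc: "odd (- c')" using c'(2) by simp
      show False
        by (rule contra[OF cl(2)[OF cl(5) kR] notin[OF cl(5) kR dQ kQ] u2[OF nc] Lcl(8)[OF delta(1) L(2)] eq])
    qed
  qed
  have oddb: "odd b" using evena ab_l[of 2] by auto
  have Npos: "N > 0"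
  proof -
    have "b \<noteq> 0" using oddb by auto
    then have "d * b\<^sup>2 > 0" using d_pos by simp
    then show ?thesis unfolding N_def by (simp add: add_nonneg_pos mult.assoc)
  qed
  define q where "q = squarefree_part N"
  define h where "h = square_part N"
  have Nqh: "N = q * h\<^sup>2" unfolding q_def h_def by (rule squarefree_decompose)
  have h0: "h \<noteq> 0" and q0: "q \<noteq> 0" using Npos Nqh by auto
  have "q > 0" using Npos Nqh h0 by (simp add: zero_less_mult_iff)
  moreover have "squarefree q" by (simp add: q_def)
  \<comment> \<open>At a prime above \<open>l\<close> that avoids the conjugate \<open>y\<close>,
    multiplying the radicand by \<open>y\<close> turns \<open>x\<close> into the norm, which
    contains \<open>l\<close> to an odd power; \<open>c\<close> cannot compensate, as its odd primes
    divide \<open>d\<close> and \<open>l\<close> does not.\<close>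
  moreover have "\<not> l dvd q" if l: "Factorial_Ring.prime l" "odd l" for l
  proof
    assume lq: "l dvd q"
    then have lN: "l dvd N" by (simp add: Nqh)
    have l2: "\<not> l dvd 2" using odd_prime_gt_2[OF l(1,2)] zdvd_imp_le[of l 2] by auto
    have nld: "\<not> l dvd d"
    proof
      assume ld: "l dvd d"
      then have "l dvd N - 2 * d * b\<^sup>2" using lN by simp
      then have "l dvd a\<^sup>2" by (simp add: N_def)
      then show False using nla[OF l ld] prime_dvd_square_iff[OF l(1)] by blast
    qed
    then have l2d: "\<not> l dvd 2 * d" using l2 l(1) by (simp add: prime_dvd_mult_iff)
    obtain m where m: "q = l * m" "\<not> l dvd m" using squarefree_prime_cofactor[OF \<open>squarefree q\<close> l(1) lq] .
    have ab': "Rings.coprime a (- b)" using ab by simp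
    obtain Q where Q: "maximalideal Q R" "of_int l \<in> Q" "y \<notin> Q"
      using maximalideal_avoiding[OF L(1,2) l(1) l2d ab'] unfolding R_def y_def by auto
    note notin = maximalideal_mult_notin[OF L(1), folded R_def, OF Q(1)]
    note iff = of_int_mem_maximalideal_iff[OF L(1), folded R_def, OF Q(1) l(1) Q(2)]
    have s2Q: "2 + s \<notin> Q"
      using notin_maximalideal_if_dvd[OF L(1) Q(1)[unfolded R_def] l(1) Q(2) s2'[unfolded R_def] s2s2' l2] .
    have "\<not> l dvd c * m" using prime_c[OF l] nld m(2) l(1) by (auto simp: prime_dvd_mult_iff)
    then have cmQ: "of_int (c * m) \<notin> Q" using iff by blast
    have "y * \<delta>\<^sup>2 = of_int c * (x * y) * (2 + s)" unfolding delta(2) by (simp only: ac_simps)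
    also have "\<dots> = of_int h * of_int h * (of_int (c * m) * (2 + s) * of_int l)"
      unfolding xy Nqh m(1) by (simp add: power2_eq_square)
    finally have "y * (\<delta> / of_int h)\<^sup>2 = (of_int (c * m) * (2 + s)) * of_int l"
      using h0 by (simp add: power_divide power2_eq_square divide_simps)
    then show False
      by (intro no_odd_valuation_unramified_prime[OF L(1,2) fd Q(1)[unfolded R_def] l(1) Q(2) l2d
            unram[OF Q(1)[unfolded R_def] Q0[OF Q(2) l(1)]], folded R_def,
            OF y Q(3) cl(2)[OF cl(5) s2] notin[OF cl(5) s2 cmQ s2Q] Lcl(8)[OF delta(1) Lcl(9)]])
  qed
  ultimately have q12: "q = 1 \<or> q = 2" by (intro squarefree_no_odd_prime_divisor)
  obtain a' where a': "a = 2 * a'" using evena ..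
  have N2: "N = 2 * (2 * a'\<^sup>2 + d * b\<^sup>2)" by (simp add: N_def a' power2_eq_square)
  \<comment> \<open>If the norm were a square, its root would be even, and halving would equate an
    even number with \<open>2 * a'^2 + d * b^2\<close>, which is odd.\<close>
  have "q = 2"
  proof (rule ccontr)
    assume "q \<noteq> 2"
    then have N: "N = h\<^sup>2" using q12 Nqh by simp
    then have "even (h\<^sup>2)" using N2 by (metis dvd_triv_left)
    then obtain h' where "h = 2 * h'" by auto
    then have "2 * h'\<^sup>2 = 2 * a'\<^sup>2 + d * b\<^sup>2" using N N2 by (simp add: power2_eq_square)
    then have "even (2 * a'\<^sup>2 + d * b\<^sup>2)" by (metis dvd_triv_left)
    then show False using d_odd oddb by simp
  qed
  then have "d * b\<^sup>2 = h\<^sup>2 - 2 * a'\<^sup>2" using N2 Nqh by simp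
  then show ?thesis using that[of a' h] a' oddb prime_c by blast
qed

end

section \<open>Splitting of Gaussian Mersenne primes\<close>

text \<open>The sixth power of 1 + \<i> is - 8 \<i>, so the number is congruent to -1 modulo 8 in
  the Gaussian integers; the norm of -1 + 8 \<gamma> is 1 modulo 16.\<close>

lemma gaussian_mersenne_norm_mod_16:
  assumes "p \<ge> 6"
  shows "gaussian_mersenne_norm p mod 16 = 1"
proof -
  define w where "w = (1 + \<i>) ^ (p - 6)"
  have "Re ((1 + \<i>) ^ k) \<in> \<int> \<and> Im ((1 + \<i>) ^ k) \<in> \<int>" for k by (induction k) auto
  then have "Re w \<in> \<int> \<and> Im w \<in> \<int>" by (simp add: w_def)
  then obtain u v where uv: "Re w = of_int u" "Im w = of_int v" by (auto elim!: Ints_cases)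
  have "(1 + \<i>) ^ 6 = ((1 + \<i>)\<^sup>2) ^ 3" by (simp flip: power_mult)
  also have "(1 + \<i>)\<^sup>2 = 2 * \<i>" by (simp add: power2_eq_square algebra_simps)
  also have "(2 * \<i>) ^ 3 = - 8 * \<i>" by (simp add: power3_eq_cube)
  finally have six: "(1 + \<i>) ^ 6 = - 8 * \<i>" .
  have "(1 + \<i>) ^ p = (1 + \<i>) ^ 6 * w" unfolding w_def using assms by (simp flip: power_add)
  then have "gaussian_mersenne p = - 8 * \<i> * w - 1" unfolding six by (simp add: gaussian_mersenne_def)
  then have "Re (gaussian_mersenne p) = of_int (8 * v - 1)" "Im (gaussian_mersenne p) = of_int (- 8 * u)"
    using uv by simp_all
  then have "(Re (gaussian_mersenne p))\<^sup>2 + (Im (gaussian_mersenne p))\<^sup>2 = of_int ((8 * v - 1)\<^sup>2 + (- 8 * u)\<^sup>2)"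
    by simp
  then have "gaussian_mersenne_norm p = (8 * v - 1)\<^sup>2 + (- 8 * u)\<^sup>2"
    unfolding gaussian_mersenne_norm_def gaussian_norm_def by (simp only: floor_of_int)
  also have "\<dots> = 1 + 16 * (4 * v * v - v + 4 * u * u)"
    by (simp add: power2_eq_square algebra_simps)
  finally have "gaussian_mersenne_norm p = 1 + 16 * (4 * v * v - v + 4 * u * u)" .
  moreover have "(1 + 16 * t) mod 16 = 1" for t :: int by presburger
  ultimately show ?thesis by (simp only:)
qed

lemma gaussian_mersenne_norm_small:
  "gaussian_mersenne_norm 2 = 5" "gaussian_mersenne_norm 3 = 13" "gaussian_mersenne_norm 5 = 41"
  by (simp_all add: gaussian_mersenne_norm_def gaussian_norm_def gaussian_mersenne_def eval_nat_numeral)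

text \<open>The norms are 5, 13 and 41. A nonzero \<open>y\<close> bounds \<open>d\<close> by 41,
  leaving 7 and 31, with \<open>y\<close> at most 2 and \<open>x\<close> at most 6 in absolute
  value; the remaining cases are enumerated.\<close>

lemma small_gaussian_mersenne_norm_rep:
  fixes d x y :: int
  assumes p: "Factorial_Ring.prime p" "p < 6" and d: "d mod 24 = 7" "d > 0"
    and G: "gaussian_mersenne_norm p = x\<^sup>2 + d * y\<^sup>2"
  shows "y = 0"
proof (rule ccontr)
  assume "y \<noteq> 0"
  have "p \<ge> 2" using p(1) prime_ge_2_nat by blast
  moreover have "p \<noteq> 4"
  proof
    assume "p = 4"
    then have "2 dvd p" by simp
    then show False using p(1) \<open>p = 4\<close> primes_dvd_imp_eq[of 2 p] by simp
  qed
  ultimately have "p = 2 \<or> p = 3 \<or> p = 5" using p(2) by linarith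
  then have G': "x\<^sup>2 + d * y\<^sup>2 = 5 \<or> x\<^sup>2 + d * y\<^sup>2 = 13 \<or> x\<^sup>2 + d * y\<^sup>2 = 41"
    using G gaussian_mersenne_norm_small by auto
  define Y where "Y = \<bar>y\<bar>"
  define Z where "Z = \<bar>x\<bar>"
  have YZ: "Y \<ge> 1" "Z \<ge> 0" "y\<^sup>2 = Y * Y" "x\<^sup>2 = Z * Z"
    using \<open>y \<noteq> 0\<close> by (auto simp: Y_def Z_def power2_eq_square)
  have G'': "Z * Z + d * (Y * Y) = 5 \<or> Z * Z + d * (Y * Y) = 13 \<or> Z * Z + d * (Y * Y) = 41"
    using G' YZ(3,4) by simp
  have "d * (Y * Y) \<ge> 0" "Z * Z \<ge> 0" using d(2) by simp_all
  then have le: "d * (Y * Y) \<le> 41" "Z * Z \<le> 41" using G'' by linarith+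
  have "Y * Y \<ge> 1" using YZ(1) mult_mono[of 1 Y 1 Y] by simp
  then have "d * 1 \<le> d * (Y * Y)" using d(2) by (intro mult_left_mono) auto
  then have "d \<le> 41" using le(1) by simp
  then have d': "d = 7 \<or> d = 31" using d by presburger
  then have "7 * (Y * Y) \<le> 41" using le(1) \<open>Y * Y \<ge> 1\<close> by (elim disjE) auto
  have "Y < 3"
  proof (rule ccontr)
    assume "\<not> Y < 3"
    then have "3 * 3 \<le> Y * Y" by (intro mult_mono) auto
    then show False using \<open>7 * (Y * Y) \<le> 41\<close> by simp
  qed
  then have Y: "Y = 1 \<or> Y = 2" using YZ(1) by auto
  have "Z < 7"
  proof (rule ccontr)
    assume "\<not> Z < 7"
    then have "7 * 7 \<le> Z * Z" by (intro mult_mono) auto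
    then show False using le(2) by simp
  qed
  then have Z: "Z = 0 \<or> Z = 1 \<or> Z = 2 \<or> Z = 3 \<or> Z = 4 \<or> Z = 5 \<or> Z = 6" using YZ(2) by auto
  show False using G'' d' Y Z by (elim disjE) simp_all
qed

context imaginary_quadratic
begin

text \<open>Square factors may be absorbed into the radical, so denominators are cleared by a
  square, the gcd of the coefficients is taken out, and only its squarefree part is kept.\<close>

lemma S_element_normal_form:
  assumes "r \<in> S" "r \<noteq> 0"
  obtains m and a b c :: int where "m \<in> \<rat>" "squarefree c" "Rings.coprime a b"
    "r * m\<^sup>2 = of_int c * (of_int a + of_int b * \<theta>)"
proof -
  obtain p q where pq: "r = p + q * \<theta>" "p \<in> \<rat>" "q \<in> \<rat>" using assms(1) unfolding S_eq by blast
  obtain p1 p2 where p: "p2 > 0" "p = of_int p1 / of_int p2" using pq(2) by (rule Rats_cases')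
  obtain q1 q2 where q: "q2 > 0" "q = of_int q1 / of_int q2" using pq(3) by (rule Rats_cases')
  define D where "D = p2 * q2"
  \<comment> \<open>The extra factor \<open>D\<close> makes the total multiplier the square of
    \<open>D\<close> rather than \<open>D\<close> itself.\<close>
  define A where "A = D * (p1 * q2)"
  define B where "B = D * (q1 * p2)"
  have nz: "(of_int p2 :: complex) \<noteq> 0" "(of_int q2 :: complex) \<noteq> 0" using p(1) q(1) by simp_all
  have D0: "(of_int D :: complex) \<noteq> 0" using nz by (simp add: D_def)
  have eq: "r * (of_int D)\<^sup>2 = of_int A + of_int B * \<theta>"
  proof -
    have "of_int D * p = of_int (p1 * q2)" "of_int D * q = of_int (q1 * p2)"
      using nz unfolding p(2) q(2) D_def by simp_all
    moreover have "r * of_int D = of_int D * p + of_int D * q * \<theta>"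
      unfolding pq(1) by (simp add: algebra_simps)
    ultimately have "r * of_int D = of_int (p1 * q2) + of_int (q1 * p2) * \<theta>" by (simp only:)
    then have "r * of_int D * of_int D = (of_int (p1 * q2) + of_int (q1 * p2) * \<theta>) * of_int D" by simp
    then show ?thesis by (simp add: A_def B_def power2_eq_square algebra_simps)
  qed
  define g where "g = gcd A B"
  have "r * (of_int D)\<^sup>2 \<noteq> 0" using assms(2) D0 by simp
  then have AB: "A \<noteq> 0 \<or> B \<noteq> 0" unfolding eq by auto
  then have g0: "g \<noteq> 0" by (simp add: g_def)
  obtain a where a: "A = gcd A B * a" by (rule dvdE[OF gcd_dvd1])
  obtain b where b: "B = gcd A B * b" by (rule dvdE[OF gcd_dvd2])
  have cop: "Rings.coprime a b"
  proof (rule gcd_coprime)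
    show "gcd A B \<noteq> 0" using AB by simp
    show "A = a * gcd A B" by (subst mult.commute) (rule a)
    show "B = b * gcd A B" by (subst mult.commute) (rule b)
  qed
  define c where "c = squarefree_part g"
  define h where "h = square_part g"
  have g: "g = c * h\<^sup>2" unfolding c_def h_def by (rule squarefree_decompose)
  have h0: "(of_int h :: complex) \<noteq> 0" using g0 g by auto
  have eq': "r * (of_int D)\<^sup>2 = (of_int h)\<^sup>2 * (of_int c * (of_int a + of_int b * \<theta>))"
  proof -
    have "r * (of_int D)\<^sup>2 = of_int (g * a) + of_int (g * b) * \<theta>"
      using eq a b unfolding g_def by simp
    then show ?thesis unfolding g by (simp add: algebra_simps)
  qed
  show ?thesis
  proof (rule that[of "of_int D / of_int h" c a b])
    show "r * (of_int D / of_int h)\<^sup>2 = of_int c * (of_int a + of_int b * \<theta>)"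
      using eq' h0 by (simp add: power_divide field_simps)
  qed (use cop in \<open>auto simp: c_def\<close>)
qed

text \<open>The square root is \<open>k + k'\<close>, where \<open>k\<close> is the reduction of \<open>\<delta>\<close> and \<open>k' = 2 c n / k\<close> that of the conjugate
  \<open>\<surd>(c (a - b \<theta>) (2 - s))\<close>; the choice of \<open>Q\<close> keeps \<open>k\<close> nonzero.\<close>

lemma split_prime_square_mod:
  fixes a b c n a' G :: int
  assumes L: "subfield L complex_field" "\<theta> \<in> L" "s \<in> L" and fd: "CF.finite_dimension \<rat> L"
    and G: "Factorial_Ring.prime G" "\<not> G dvd 2 * d" "\<not> G dvd c"
    and split: "splits_completely \<rat> L (cgenideal (ring_of_integers \<rat>) (of_int G))"
    and ab: "Rings.coprime a b" "a = 2 * a'" "d * b\<^sup>2 = n\<^sup>2 - 2 * a'\<^sup>2"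
    and delta: "\<delta> \<in> L" "\<delta>\<^sup>2 = of_int c * (of_int a + of_int b * \<theta>) * (2 + s)"
  obtains k \<kappa>0 where "G dvd \<kappa>0\<^sup>2 + d" "G dvd k\<^sup>2 - 4 * c * (n + 2 * a' + b * \<kappa>0)"
proof -
  define R where "R = ring_of_integers L"
  note cl = ring_of_integers_closed[OF L(1), folded R_def]
  obtain Q where Q: "maximalideal Q R" "of_int G \<in> Q" "of_int a + of_int b * \<theta> \<notin> Q"
    using maximalideal_avoiding[OF L(1,2) G(1,2) ab(1)] unfolding R_def by blast
  have idQ: "ideal Q R" using Q(1) by (simp add: maximalideal_def)
  note QD = ideal_ring_of_integersD[OF L(1), folded R_def, OF idQ]
  note iff = of_int_mem_maximalideal_iff[OF L(1), folded R_def, OF Q(1) G(1) Q(2)]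
  have primeQ: "primeideal Q (ring_of_integers L)"
    using cring.maximalideal_prime[OF cring_ring_of_integers[OF L(1)]] Q(1) by (simp add: R_def)
  \<comment> \<open>The splitting hypothesis speaks of the principal ideal of \<open>G\<close>, so
    the prime below \<open>Q\<close> has to be identified with it before the residue degree is
    available.\<close>
  have "prime_below \<rat> Q = cgenideal (ring_of_integers \<rat>) (of_int G)"
  proof (rule Set.set_eqI)
    fix x
    show "x \<in> prime_below \<rat> Q \<longleftrightarrow> x \<in> cgenideal (ring_of_integers \<rat>) (of_int G)"
    proof
      assume "x \<in> prime_below \<rat> Q"
      then have x: "x \<in> Q" "x \<in> \<rat>" "algebraic_int x" by (auto simp: prime_below_def)
      then have "x \<in> \<int>" using rational_algebraic_int_is_int by blast
      then obtain j where j: "x = of_int j" by (rule Ints_cases)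
      then have "G dvd j" using x(1) iff by blast
      then obtain i where "j = G * i" ..
      then have "x = of_int i * of_int G" using j by simp
      then show "x \<in> cgenideal (ring_of_integers \<rat>) (of_int G)"
        using algebraic_int_of_int_complex[of i] by (auto simp: cgenideal_def)
    next
      assume "x \<in> cgenideal (ring_of_integers \<rat>) (of_int G)"
      then obtain i where i: "x = i * of_int G" "i \<in> \<rat>" "algebraic_int i" by (auto simp: cgenideal_def)
      then have "i \<in> \<int>" using rational_algebraic_int_is_int by blast
      then obtain j where "i = of_int j" by (rule Ints_cases)
      then have x: "x = of_int (j * G)" using i(1) by simp
      then have "x \<in> Q" using iff[of "j * G"] by (simp only: dvd_triv_right)
      then show "x \<in> prime_below \<rat> Q" using algebraic_int_of_int_complex[of "j * G"]
        unfolding prime_below_def x by simp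
    qed
  qed
  then have deg: "residue_degree \<rat> L Q = 1" using split primeQ unfolding splits_completely_def by blast
  note int = residue_degree_one_int[OF L(1) fd Q(1)[unfolded R_def] G(1) Q(2) deg, folded R_def]
  have sR: "s \<in> carrier R" and kR: "\<kappa> \<in> carrier R"
    unfolding R_def using s_mem_ring[OF L(1,3)] kappa_mem_ring[OF L(1-3)] by blast+
  have s2R: "2 + s \<in> carrier R" by (rule cl(1)[OF cl(8) sR])
  have dR: "\<delta> \<in> carrier R"
  proof -
    have "\<delta>\<^sup>2 \<in> carrier R"
      unfolding delta(2) using lin_mem_ring(1)[OF L(1,2), of a b, folded R_def] s2R by (intro cl(2)[OF cl(2)[OF cl(5)]])
    then show ?thesis using algebraic_int_sqrt_of_square[of \<delta>] delta(1) by (simp add: R_def)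
  qed
  obtain k where k: "\<delta> - of_int k \<in> Q" using int[OF dR] .
  obtain \<kappa>0 where k0: "\<kappa> - of_int \<kappa>0 \<in> Q" using int[OF kR] .
  obtain s0 where s0: "s - of_int s0 \<in> Q" using int[OF sR] .
  have Cmul: "u * v - u' * v' \<in> Q" if "u - u' \<in> Q" "v - v' \<in> Q" "u \<in> carrier R" "v' \<in> carrier R" for u u' v v'
  proof -
    have "u * v - u' * v' = u * (v - v') + (u - u') * v'" by (simp add: algebra_simps)
    then show ?thesis using QD(3)[OF QD(4)[OF that(3,2)] QD(5)[OF that(4,1)]] by simp
  qed
  have "s * s - of_int s0 * of_int s0 \<in> Q" by (rule Cmul[OF s0 s0 sR cl(5)])
  then have "of_int (2 - s0 * s0) \<in> Q" using s_s by simp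
  then have S0: "G dvd 2 - s0 * s0" using iff by blast
  have "\<kappa> * \<kappa> - of_int \<kappa>0 * of_int \<kappa>0 \<in> Q" by (rule Cmul[OF k0 k0 kR cl(5)])
  then have "of_int (- d - \<kappa>0 * \<kappa>0) \<in> Q" using kappa_sq by (simp add: power2_eq_square)
  then have "G dvd - (- d - \<kappa>0 * \<kappa>0)" using iff by (simp only: dvd_minus_iff)
  then have K0: "G dvd \<kappa>0\<^sup>2 + d" by (simp add: power2_eq_square add.commute)
  define X0 where "X0 = a + b * (\<kappa>0 * s0)"
  have ks: "\<kappa> * s - of_int \<kappa>0 * of_int s0 \<in> Q" by (rule Cmul[OF k0 s0 kR cl(5)])
  have x_cong: "(of_int a + of_int b * \<theta>) - of_int X0 \<in> Q"
  proof -
    have "(of_int a + of_int b * \<theta>) - of_int X0 = of_int b * (\<kappa> * s - of_int \<kappa>0 * of_int s0)"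
      unfolding kappa_s by (simp add: X0_def algebra_simps)
    then show ?thesis using QD(4)[OF cl(5) ks] by simp
  qed
  have nX0: "\<not> G dvd X0"
  proof
    assume "G dvd X0"
    then have "of_int X0 \<in> Q" using iff by blast
    from QD(3)[OF x_cong this] show False using Q(3) by simp
  qed
  \<comment> \<open>The reduction of \<open>\<delta>^2\<close>, with
    \<open>\<theta> = \<kappa> * s\<close> reduced to \<open>\<kappa>0 * s0\<close>; below,
    \<open>T'\<close> is its conjugate under \<open>s0 \<mapsto> - s0\<close>.\<close>
  define T where "T = c * X0 * (2 + s0)"
  have "(of_int c * (of_int a + of_int b * \<theta>)) * (2 + s) - (of_int c * of_int X0) * of_int (2 + s0) \<in> Q"
  proof (rule Cmul)
    have "of_int c * (of_int a + of_int b * \<theta>) - of_int c * of_int X0 = of_int c * (of_int a + of_int b * \<theta> - of_int X0)"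
      by (simp add: algebra_simps)
    then show "of_int c * (of_int a + of_int b * \<theta>) - of_int c * of_int X0 \<in> Q"
      using QD(4)[OF cl(5) x_cong] by simp
    show "2 + s - of_int (2 + s0) \<in> Q" using s0 by simp
    show "of_int c * (of_int a + of_int b * \<theta>) \<in> carrier R"
      using cl(2)[OF cl(5)] lin_mem_ring(1)[OF L(1,2), of a b, folded R_def] by blast
  qed (rule cl(5))
  then have "\<delta>\<^sup>2 - of_int T \<in> Q" unfolding delta(2) T_def by simp
  moreover have "\<delta> * \<delta> - of_int k * of_int k \<in> Q" by (rule Cmul[OF k k dR cl(5)])
  ultimately have "(\<delta>\<^sup>2 - of_int T) - (\<delta> * \<delta> - of_int k * of_int k) \<in> Q" by (rule QD(7))
  then have "of_int (k * k - T) \<in> Q" by (simp add: power2_eq_square)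
  then have kT: "G dvd k * k - T" using iff by blast
  have nG2: "\<not> G dvd 2" using G(2) by (meson dvd_mult2)
  have n2s: "\<not> G dvd 2 + s0"
  proof
    assume "G dvd 2 + s0"
    then have "G dvd (2 + s0) * (2 - s0) - (2 - s0 * s0)" using S0 by simp
    then show False using nG2 by (simp add: algebra_simps)
  qed
  have nT: "\<not> G dvd T" unfolding T_def using G(1,3) nX0 n2s by (simp add: prime_dvd_mult_iff)
  have nk: "\<not> G dvd k"
  proof
    assume "G dvd k"
    then have "G dvd k * k - (k * k - T)" by (rule dvd_diff[OF dvd_mult2 kT])
    then show False using nT by simp
  qed
  obtain u w where uw: "u * k + w * G = 1" using prime_bezout[OF G(1) nk] by metis
  define k' where "k' = 2 * c * n * u"
  define T' where "T' = c * (a - b * (\<kappa>0 * s0)) * (2 - s0)"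
  have h1: "[k * k = T] (mod G)" using kT by (simp add: cong_iff_dvd_diff)
  have cs: "[s0 * s0 = 2] (mod G)" using S0 by (simp add: cong_iff_dvd_diff dvd_diff_commute)
  have ck: "[\<kappa>0 * \<kappa>0 = - d] (mod G)" using K0 by (simp add: cong_iff_dvd_diff power2_eq_square)
  have h2: "[4 * c * (a + b * \<kappa>0) = T + T'] (mod G)"
  proof -
    have "T + T' = c * (4 * a + 2 * b * \<kappa>0 * (s0 * s0))"
      by (simp add: T_def T'_def X0_def algebra_simps)
    moreover have "[c * (4 * a + 2 * b * \<kappa>0 * 2) = c * (4 * a + 2 * b * \<kappa>0 * (s0 * s0))] (mod G)"
      by (intro cong_mult cong_add cong_refl cong_sym[OF cs])
    moreover have "c * (4 * a + 2 * b * \<kappa>0 * 2) = 4 * c * (a + b * \<kappa>0)" by (simp add: algebra_simps)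
    ultimately show ?thesis by (simp only:)
  qed
  \<comment> \<open>The norm equation gives \<open>a^2 + 2 * d * b^2 = 2 * n^2\<close>, and
    \<open>(2 + s0) * (2 - s0)\<close> is 2 modulo \<open>G\<close>; together the product is a
    square.\<close>
  have h3: "[T * T' = (2 * c * n) * (2 * c * n)] (mod G)"
  proof -
    have "T * T' = (c * c) * ((a * a - b * b * ((\<kappa>0 * \<kappa>0) * (s0 * s0))) * (4 - s0 * s0))"
      by (simp add: T_def T'_def X0_def algebra_simps)
    moreover have "[(c * c) * ((a * a - b * b * ((\<kappa>0 * \<kappa>0) * (s0 * s0))) * (4 - s0 * s0))
        = (c * c) * ((a * a - b * b * (- d * 2)) * (4 - 2))] (mod G)"
      by (intro cong_mult cong_diff cong_refl cs ck)
    moreover have "(c * c) * ((a * a - b * b * (- d * 2)) * (4 - 2)) = (2 * c * n) * (2 * c * n)"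
    proof -
      have nn: "n * n = d * (b * b) + 2 * (a' * a')" using ab(3) by (simp add: power2_eq_square)
      have "(2 * c * n) * (2 * c * n) = 4 * (c * c) * (n * n)" by simp
      then show ?thesis unfolding nn ab(2) by (simp add: algebra_simps)
    qed
    ultimately show ?thesis by (simp only:)
  qed
  have h4: "[k * k' = 2 * c * n] (mod G)"
  proof -
    have "k * k' - 2 * c * n = (2 * c * n) * (u * k + w * G - 1) - (2 * c * n * w) * G"
      by (simp add: k'_def algebra_simps)
    also have "\<dots> = - (2 * c * n * w) * G" unfolding uw by simp
    finally show ?thesis by (simp add: cong_iff_dvd_diff)
  qed
  \<comment> \<open>The identity is proved after multiplication by \<open>k^2\<close>, where only
    the known values of \<open>k * k\<close> and \<open>k * k'\<close> enter; \<open>k^2\<close> is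
    cancelled at the end because \<open>k\<close> is nonzero modulo \<open>G\<close>.\<close>
  have "[(k * k + k * k') * (k * k + k * k') = (T + 2 * c * n) * (T + 2 * c * n)] (mod G)"
    by (intro cong_mult cong_add h1 h4)
  also have "(T + 2 * c * n) * (T + 2 * c * n) = T * (4 * c * n + T) + (2 * c * n) * (2 * c * n)"
    by (simp add: algebra_simps)
  also have "[T * (4 * c * n + T) + (2 * c * n) * (2 * c * n) = T * (4 * c * n + T) + T * T'] (mod G)"
    by (intro cong_add cong_refl cong_sym[OF h3])
  also have "T * (4 * c * n + T) + T * T' = T * (4 * c * n + (T + T'))" by (simp add: algebra_simps)
  also have "[T * (4 * c * n + (T + T')) = k * k * (4 * c * n + 4 * c * (a + b * \<kappa>0))] (mod G)"
    by (rule cong_sym) (intro cong_mult cong_add cong_refl h1 h2)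
  finally have "[(k * k + k * k') * (k * k + k * k') = k * k * (4 * c * n + 4 * c * (a + b * \<kappa>0))] (mod G)" .
  then have "G dvd (k * k + k * k') * (k * k + k * k') - k * k * (4 * c * n + 4 * c * (a + b * \<kappa>0))"
    by (simp add: cong_iff_dvd_diff)
  also have "\<dots> = k * k * ((k + k')\<^sup>2 - 4 * c * (n + 2 * a' + b * \<kappa>0))"
    by (simp add: ab(2) power2_eq_square algebra_simps)
  finally have "G dvd (k + k')\<^sup>2 - 4 * c * (n + 2 * a' + b * \<kappa>0)"
    using G(1) nk by (simp add: prime_dvd_mult_iff)
  then show ?thesis using that K0 by blast
qed

end

theorem theorem3p2:
  fixes d x y :: int and p :: nat and S H4 H :: "complex set"
  assumes "d > 0" and "squarefree d" and "[d = 7] (mod 24)"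
    and "S = generate_field complex_field {csqrt (of_int (- 2 * d))}"
    and "is_hilbert_class_field S H"
    and "cyclic_extension S H4" and "ext_degree S H4 = 4"
    and "H4 \<subseteq> H" and "csqrt 2 \<in> H4"
    and "gaussian_mersenne_prime p"
    and "splits_completely \<rat> H4
           (cgenideal (ring_of_integers \<rat>) (of_int (gaussian_mersenne_norm p)))"
    and "gaussian_mersenne_norm p = x\<^sup>2 + d * y\<^sup>2"
  shows "8 dvd y"
proof (cases "y = 0 \<or> p < 6")
  case True
  have "Factorial_Ring.prime p" using assms(10) by (simp add: gaussian_mersenne_prime_def)
  moreover have "d mod 24 = 7" using assms(3) by (simp add: cong_def)
  ultimately have "y = 0" using True small_gaussian_mersenne_norm_rep[of p d x y] assms(1,12) by blast
  then show ?thesis by simp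
next
  case False
  define G where "G = gaussian_mersenne_norm p"
  have prime: "Factorial_Ring.prime G" using assms(10) by (simp add: gaussian_mersenne_prime_def G_def)
  have G16: "G mod 16 = 1" unfolding G_def using False by (intro gaussian_mersenne_norm_mod_16) simp
  have rep: "G = x\<^sup>2 + d * y\<^sup>2" using assms(12) by (simp add: G_def)
  have d24: "d mod 24 = 7" using assms(3) by (simp add: cong_def)
  then have d8: "d mod 8 = 7" and dodd: "odd d" by presburger+
  interpret imaginary_quadratic d using assms(1,2) dodd by unfold_locales
  have S: "S = imaginary_quadratic.S d" using assms(4) by (simp add: S_def \<theta>_def)
  have galH: "galois_extension S H" and nfS: "number_field S" and unram: "unramified_extension S H"
    using assms(5) by (auto simp: is_hilbert_class_field_def abelian_extension_def)
  have galH4: "galois_extension S H4" using assms(6) by (simp add: cyclic_extension_def)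
  have fields: "subfield S complex_field" "subfield H complex_field" "subfield H4 complex_field"
    "S \<subseteq> H" "S \<subseteq> H4" "CF.finite_dimension S H" "CF.finite_dimension S H4" "CF.finite_dimension \<rat> S"
    using galH galH4 nfS by (auto simp: galois_extension_def finite_extension_def number_field_def)
  have fdH: "CF.finite_dimension \<rat> H" and fdH4: "CF.finite_dimension \<rat> H4"
    using CF.telescopic_base_dim(1)[OF subfield_Rats fields(1,8)] fields(6,7) by blast+
  have sH4: "s \<in> H4" and thH4: "\<theta> \<in> H4" using assms(9) theta_in_S fields(5) S by (auto simp: s_def)
  then have sH: "s \<in> H" and thH: "\<theta> \<in> H" using assms(8) by auto
  obtain \<delta>0 r where d0: "\<delta>0 \<in> H4" "r \<in> S" "r \<noteq> 0" "\<delta>0\<^sup>2 = r * (2 + s)"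
    using cyclic_quartic_radical[OF assms(6,7) sH4 _ s_sq] s_notin_S S by blast
  obtain m a b c where abc: "m \<in> \<rat>" "squarefree c" "Rings.coprime a b"
    "r * m\<^sup>2 = of_int c * (of_int a + of_int b * \<theta>)"
    using S_element_normal_form[OF d0(2)[unfolded S] d0(3)] by metis
  \<comment> \<open>Scaling by the rational \<open>m\<close> puts the radicand into normal form
    without leaving \<open>H4\<close>.\<close>
  define \<delta> where "\<delta> = \<delta>0 * m"
  have dH4: "\<delta> \<in> H4" unfolding \<delta>_def
    using d0(1) abc(1) subfield_complexD(4,12)[OF fields(3)] by blast
  have "\<delta>\<^sup>2 = (r * m\<^sup>2) * (2 + s)" unfolding \<delta>_def power_mult_distrib d0(4) by (simp only: ac_simps)
  then have d2: "\<delta>\<^sup>2 = of_int c * (of_int a + of_int b * \<theta>) * (2 + s)" unfolding abc(4) .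
  have ram: "ramification_index (imaginary_quadratic.S d) H Q = 1"
    if "maximalideal Q (ring_of_integers H)" "Q \<noteq> {0}" for Q
    using unram that cring.maximalideal_prime[OF cring_ring_of_integers[OF fields(2)]]
    unfolding unramified_extension_def S by blast
  obtain a' n where an: "a = 2 * a'" "odd b" "d * b\<^sup>2 = n\<^sup>2 - 2 * a'\<^sup>2"
    "\<And>q. Factorial_Ring.prime q \<Longrightarrow> odd q \<Longrightarrow> q dvd c \<Longrightarrow> q dvd d"
    using unramified_radical_norm_form[OF fields(2) thH sH fdH ram abc(2,3) subsetD[OF assms(8) dH4] d2] by blast
  have oddG: "odd G" using G16 by presburger
  have nG2: "\<not> G dvd 2" using odd_prime_gt_2[OF prime oddG] zdvd_imp_le[of G 2] by auto
  have nGd: "\<not> G dvd d" using prime_not_dvd_form_coefficient[OF prime G16 rep d8 assms(1)] False by blast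
  have nG2d: "\<not> G dvd 2 * d" using prime nG2 nGd by (simp add: prime_dvd_mult_iff)
  have nGc: "\<not> G dvd c" using an(4)[OF prime oddG] nGd by blast
  \<comment> \<open>Only the square of \<open>n\<close> is determined, so its sign may be chosen to
    make \<open>n' + a'\<close> prime to \<open>G\<close>. If \<open>G\<close> divided both sums, it
    would divide \<open>a'\<close>, \<open>n\<close> and then \<open>b\<close>, against
    coprimality.\<close>
  have "\<not> (G dvd n + a' \<and> G dvd - n + a')"
  proof
    assume *: "G dvd n + a' \<and> G dvd - n + a'"
    have "G dvd (n + a') + (- n + a')" by (rule dvd_add[OF conjunct1[OF *] conjunct2[OF *]])
    then have "G dvd 2 * a'" by simp
    then have Ga: "G dvd a'" using prime nG2 by (simp add: prime_dvd_mult_iff)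
    have "G dvd (n + a') - a'" by (rule dvd_diff[OF conjunct1[OF *] Ga])
    then have "G dvd n" by simp
    then have "G dvd n\<^sup>2 - 2 * a'\<^sup>2" using Ga by (simp add: power2_eq_square)
    then have "G dvd d * b\<^sup>2" by (simp only: an(3))
    then have "G dvd b" using prime nGd by (simp add: prime_dvd_mult_iff prime_dvd_square_iff)
    moreover have "G dvd a" using Ga an(1) by simp
    ultimately show False using abc(3) prime by (metis coprime_common_divisor not_prime_unit)
  qed
  then obtain n' where n': "n' = n \<or> n' = - n" "\<not> G dvd n' + a'" by blast
  have an': "d * b\<^sup>2 = n'\<^sup>2 - 2 * a'\<^sup>2" using an(3) n'(1) by auto
  have cop: "Rings.coprime a' b" using abc(3) an(1) by simp
  obtain k \<kappa>0 where k: "G dvd \<kappa>0\<^sup>2 + d" "G dvd k\<^sup>2 - 4 * c * (n' + 2 * a' + b * \<kappa>0)"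
    using split_prime_square_mod[OF fields(3) thH4 sH4 fdH4 prime nG2d nGc assms(11)[folded G_def] abc(3) an(1) an' dH4 d2]
    by blast
  have "c \<noteq> 0" using abc(2) by auto
  then show ?thesis
    using eight_dvd_if_square[OF prime G16 rep d8 assms(1) an' cop an(2) n'(2) k(1,2)] an(4) by blast
qed

end
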